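(* Let $\mu,c>0$ and $\gamma\in(0,1)$, and let $u=u^{\mu,c(1-\gamma)}$ be the value function of the one-dimensional sequential testing problem $ST(\mu,c(1-\gamma))$. For $\pi=(\pi_1,\pi_2)\in[0,1]^2$ let $$g(\pi_1,\pi_2)=\bigl(\pi_1\wedge(1-\pi_1)+u(\pi_2)\bigr)\wedge\bigl(u(\pi_1)+\pi_2\wedge(1-\pi_2)\bigr),\qquad V(\pi)=\inf_\tau\mathbb E_\pi\left[g(\Pi^1_\tau,\Pi^2_\tau)+c\tau\right],$$ let $\mathcal D=\{\pi\in[0,1]^2:V(\pi)=g(\pi)\}$ be the stopping region, and let $T=\{\pi\in[0,1]^2:0\le\pi_2\le\pi_1\wedge(1-\pi_1)\}$. Then there exists an upper semi-continuous function $b:[0,1]\to[0,1/2]$ with $b(\pi_1)\le\pi_1\wedge(1-\pi_1)$ for all $\pi_1\in[0,1]$ such that $$\mathcal D\cap T=\{\pi\in T:\pi_2\le b(\pi_1)\}.$$ Moreover, $b(\pi_1)=b(1-\pi_1)$.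
   Context: Set-up (two-dimensional sequential testing with equal drifts $\mu_1=\mu_2=\mu$). For $\pi\in[0,1]^2$, under $\mathbb P_\pi$ (expectation $\mathbb E_\pi$) the random variables $Y^1,Y^2$ take values in $\{0,1\}$ with $\mathbb P_\pi(Y^i=1)=\pi_i$, $W^1,W^2$ are standard Brownian motions, and $Y^1,Y^2,W^1,W^2$ are independent. One observes $X=(X^1,X^2)$ with $X^i_t=\mu Y^it+W^i_t$, and $\mathcal F^X$ is the filtration generated by $X$. The posterior process $\Pi=(\Pi^1,\Pi^2)$ is $\Pi^i_t=\mathbb E_\pi[Y^i\mid\mathcal F^X_t]$ (continuous version); it satisfies $\Pi_0=\pi$ and $d\Pi^i_t=\mu\Pi^i_t(1-\Pi^i_t)\,d\bar W^i_t$, where $\bar W^i_t=X^i_t-\mu\int_0^t\Pi^i_s\,ds$ and $(\bar W^1,\bar W^2)$ is a two-dimensional standard Brownian motion. The infimum in $V$ is over ($\mathbb P_\pi$-a.s. finite) $\mathcal F^X$-stopping times. Since $V\le g$, the stopping region $\mathcal D$ is the complement in $[0,1]^2$ of the continuation region $\mathcal C=\{V<g\}$. One-dimensional problem $ST(\mu,k)$, for $\mu,k>0$: with $\Pi$ the one-dimensional posterior process defined in the same way from a single observation $X_t=\mu Yt+W_t$ with $\mathbb P_\pi(Y=1)=\pi\in[0,1]$ (so $d\Pi_t=\mu\Pi_t(1-\Pi_t)\,d\bar W_t$, $\Pi_0=\pi$), its value function is $u^{\mu,k}(\pi)=\inf_\tau\mathbb E_\pi[\Pi_\tau\wedge(1-\Pi_\tau)+k\tau]$.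 *)

theory Defs
  imports "HOL-Probability.Probability"
begin

definition process_sigma ::
  "'a set \<Rightarrow> (real \<Rightarrow> 'a \<Rightarrow> 'b::topological_space) \<Rightarrow> real set \<Rightarrow> 'a measure" where
  "process_sigma \<Omega> Z I = sigma \<Omega> (\<Union>t\<in>I. {Z t -` B \<inter> \<Omega> |B. B \<in> sets borel})"

text \<open>The time index of a filtration is \<^typ>\<open>ennreal\<close> rather than \<^typ>\<open>real\<close>, so that stopping
  times in the sense of \<^const>\<open>stopping_time\<close> may take the value infinity.\<close>

definition natural_filtration ::
  "'a set \<Rightarrow> (real \<Rightarrow> 'a \<Rightarrow> 'b::topological_space) \<Rightarrow> ennreal \<Rightarrow> 'a measure" where
  "natural_filtration \<Omega> Z t = process_sigma \<Omega> Z {s. 0 \<le> s \<and> ennreal s \<le> t}"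

text \<open>Processes are indexed by \<^typ>\<open>real\<close>; their values at negative times are irrelevant.\<close>

definition standard_brownian_motion :: "'a measure \<Rightarrow> (real \<Rightarrow> 'a \<Rightarrow> real) \<Rightarrow> bool" where
  "standard_brownian_motion M B \<longleftrightarrow>
     prob_space M \<and>
     (\<forall>t\<ge>0. B t \<in> borel_measurable M) \<and>
     (AE \<omega> in M. B 0 \<omega> = 0) \<and>
     (AE \<omega> in M. continuous_on {0..} (\<lambda>t. B t \<omega>)) \<and>
     (\<forall>(t :: nat \<Rightarrow> real) n. 0 \<le> t 0 \<and> mono t \<longrightarrow>
        prob_space.indep_vars M (\<lambda>_. borel) (\<lambda>k \<omega>. B (t (Suc k)) \<omega> - B (t k) \<omega>) {..<n}) \<and>
     (\<forall>s t. 0 \<le> s \<and> s < t \<longrightarrow>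
        distributed M lborel (\<lambda>\<omega>. B t \<omega> - B s \<omega>) (normal_density 0 (sqrt (t - s))))"

definition prior_cube :: "(real^'n) set" where
  "prior_cube = {\<pi>. \<forall>i. 0 \<le> \<pi> $ i \<and> \<pi> $ i \<le> 1}"

definition observation ::
  "real \<Rightarrow> ('n \<Rightarrow> 'a \<Rightarrow> real) \<Rightarrow> ('n \<Rightarrow> real \<Rightarrow> 'a \<Rightarrow> real) \<Rightarrow> real \<Rightarrow> 'a \<Rightarrow> real^'n" where
  "observation \<mu> Y W t \<omega> = (\<chi> i. \<mu> * Y i \<omega> * t + W i t \<omega>)"

text \<open>The model with one coordinate per element of the finite type \<^typ>\<open>'n\<close>: all the laws
  \<open>P \<pi>\<close>, for priors \<open>\<pi>\<close> in the unit cube, live on one measurable space \<open>S\<close> (whose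
  measure plays no role), and \<open>post \<pi>\<close> is the continuous version of the posterior process
  under \<open>P \<pi>\<close>.\<close>

locale sequential_testing =
  fixes S :: "'a measure"
    and \<mu> :: real
    and P :: "real^'n::finite \<Rightarrow> 'a measure"
    and Y :: "'n \<Rightarrow> 'a \<Rightarrow> real"
    and W :: "'n \<Rightarrow> real \<Rightarrow> 'a \<Rightarrow> real"
    and post :: "real^'n \<Rightarrow> real \<Rightarrow> 'a \<Rightarrow> real^'n"
  assumes prob_space_P: "\<pi> \<in> prior_cube \<Longrightarrow> prob_space (P \<pi>)"
    and sets_P: "\<pi> \<in> prior_cube \<Longrightarrow> sets (P \<pi>) = sets S"
    and Y_measurable: "Y i \<in> borel_measurable S"
    and Y_values: "\<omega> \<in> space S \<Longrightarrow> Y i \<omega> \<in> {0, 1}"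
    and Y_prior: "\<pi> \<in> prior_cube \<Longrightarrow> measure (P \<pi>) {\<omega> \<in> space S. Y i \<omega> = 1} = \<pi> $ i"
    and W_brownian: "\<pi> \<in> prior_cube \<Longrightarrow> standard_brownian_motion (P \<pi>) (W i)"
    and independent: "\<pi> \<in> prior_cube \<Longrightarrow>
      prob_space.indep_sets (P \<pi>)
        (case_sum (\<lambda>i. sets (vimage_algebra (space S) (Y i) borel))
                  (\<lambda>i. sets (process_sigma (space S) (W i) {0..})))
        UNIV"
    and post_adapted: "\<pi> \<in> prior_cube \<Longrightarrow> 0 \<le> t \<Longrightarrow>
      post \<pi> t \<in> borel_measurable
        (natural_filtration (space S) (observation \<mu> Y W) (ennreal t))"
    and post_posterior: "\<pi> \<in> prior_cube \<Longrightarrow> 0 \<le> t \<Longrightarrow>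
      AE \<omega> in P \<pi>. post \<pi> t \<omega> $ i =
        real_cond_exp (P \<pi>)
          (natural_filtration (space S) (observation \<mu> Y W) (ennreal t)) (Y i) \<omega>"
    and post_continuous: "\<pi> \<in> prior_cube \<Longrightarrow> \<omega> \<in> space S \<Longrightarrow>
      continuous_on {0..} (\<lambda>t. post \<pi> t \<omega>)"
begin

abbreviation FX :: "ennreal \<Rightarrow> 'a measure" where
  "FX \<equiv> natural_filtration (space S) (observation \<mu> Y W)"

definition admissible_times :: "real^'n \<Rightarrow> ('a \<Rightarrow> ennreal) set" where
  "admissible_times \<pi> = {\<tau>. stopping_time FX \<tau> \<and> (AE \<omega> in P \<pi>. \<tau> \<omega> < \<infinity>)}"

text \<open>The infimum over \<open>\<tau>\<close> of the expectation of \<open>h (post \<pi> \<tau>) + k * \<tau>\<close>, for a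
  nonnegative \<open>h\<close>. Expectations are nonnegative integrals, so a \<open>\<tau>\<close> of infinite
  expectation costs infinity (and not 0, as it would with the Bochner integral).
  The infimum itself is finite, because \<open>\<tau> = 0\<close> is admissible.\<close>

definition testing_value :: "real \<Rightarrow> (real^'n \<Rightarrow> real) \<Rightarrow> real^'n \<Rightarrow> real" where
  "testing_value k h \<pi> = enn2real (INF \<tau> \<in> admissible_times \<pi>.
     \<integral>\<^sup>+ \<omega>. ennreal (h (post \<pi> (enn2real (\<tau> \<omega>)) \<omega>)) + ennreal k * \<tau> \<omega> \<partial>P \<pi>)"

end

definition upper_semicontinuous_on ::
  "'a::topological_space set \<Rightarrow> ('a \<Rightarrow> real) \<Rightarrow> bool" where
  "upper_semicontinuous_on A f \<longleftrightarrow>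
     (\<forall>x\<in>A. \<forall>y>f x. eventually (\<lambda>z. f z < y) (at x within A))"

end

theory Submission
  imports Defs
begin

text \<open>
  By Girsanov's formula for a constant drift, the posterior at time \<open>t\<close> is an explicit function
  of the observation at time \<open>t\<close>, and it is a Markov process with an explicit Gaussian
  transition kernel. Restricting stopping times to dyadic grids turns both values into infima
  of finite-horizon Bellman recursions, which depend on the kernel only. The kernel preserves
  concavity in each coordinate and commutes with the reflections \<open>p \<mapsto> 1 - p\<close>, so
  \<open>u\<close> and \<open>V\<close> inherit both properties, and \<open>u\<close> is 1-Lipschitz because
  \<open>0 \<le> u p \<le> min p (1 - p)\<close>. On \<open>T\<close> this gives \<open>g = u \<pi>\<^sub>1 + \<pi>\<^sub>2\<close>; on the edge
  \<open>\<pi>\<^sub>2 = 0\<close> the submartingale property of \<open>u (\<Pi>\<^sub>t) + c (1 - \<gamma>) t\<close> gives \<open>V = g\<close>.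
  The concave function \<open>q \<mapsto> V (p, q) - u p - q \<le> 0\<close> vanishes at \<open>0\<close>, hence
  its zero set is an interval \<open>[0, b p]\<close>. Separate concavity makes \<open>V\<close> locally
  Lipschitz inside the square, which yields the upper semicontinuity of \<open>b\<close>.
\<close>

section \<open>The Gaussian update of a prior\<close>

text \<open>The two values live on unrelated probability spaces, and \<open>testing_value\<close>
  ranges over all stopping times of the observation filtration. They become comparable only once
  both are expressed through the kernel, and this is what the long probabilistic part achieves.
  Dyadic grids are nested, and halving the mesh can only lower the recursion. Hence the infimum over
  mesh and horizon is reached along one decreasing sequence, and monotone convergence carries the
  one-step inequality over to the limit. That inequality holds for \<open>u\<close> with running
  cost \<open>c * (1 - \<gamma>)\<close>, while \<open>V\<close> pays \<open>c\<close>; on the edge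
  the comparison rests on \<open>c * (1 - \<gamma>) \<le> c\<close>. Concavity gives no continuity
  at the boundary of the square. The way out is that a point of \<open>T\<close> at height
  \<open>q > 0\<close> has distance at least \<open>q\<close> from all four edges, whereas at height
  0 every point is a stopping point. So the contact set has to be shown closed only at positive
  heights.\<close>

definition likelihood_ratio :: "real \<Rightarrow> real \<Rightarrow> real \<Rightarrow> real" where
  "likelihood_ratio \<mu> t x = exp (\<mu> * x - \<mu>\<^sup>2 * t / 2)"

text \<open>Density of \<open>\<mu> * Y * t + W t\<close> under the prior \<open>p\<close>, relative to the law of \<open>W t\<close>.\<close>

definition evidence :: "real \<Rightarrow> real \<Rightarrow> real \<Rightarrow> real \<Rightarrow> real" where
  "evidence \<mu> t p x = 1 - p + p * likelihood_ratio \<mu> t x"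

definition bayes :: "real \<Rightarrow> real \<Rightarrow> real \<Rightarrow> real \<Rightarrow> real" where
  "bayes \<mu> t p x = p * likelihood_ratio \<mu> t x / evidence \<mu> t p x"

definition gauss :: "real \<Rightarrow> real measure" where
  "gauss t = density lborel (normal_density 0 (sqrt t))"

lemma likelihood_ratio_pos [simp]: "likelihood_ratio \<mu> t x > 0"
  by (simp add: likelihood_ratio_def)

lemma likelihood_ratio_0 [simp]: "likelihood_ratio \<mu> 0 0 = 1"
  by (simp add: likelihood_ratio_def)

lemma likelihood_ratio_add:
  "likelihood_ratio \<mu> (s + t) (x + y) = likelihood_ratio \<mu> s x * likelihood_ratio \<mu> t y"
  by (simp add: likelihood_ratio_def exp_add[symmetric] algebra_simps add_divide_distrib)

lemma evidence_pos:
  assumes "p \<in> {0..1}"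
  shows "evidence \<mu> t p x > 0"
proof (cases "p = 0")
  case False
  then have "p * likelihood_ratio \<mu> t x > 0" using assms by simp
  then show ?thesis using assms unfolding evidence_def by simp
qed (simp add: evidence_def)

lemma bayes_le_1_iff: "evidence \<mu> t p x > 0 \<Longrightarrow> bayes \<mu> t p x \<le> 1 \<longleftrightarrow> p \<le> 1"
  by (simp add: bayes_def divide_le_eq_1 evidence_def)

lemma bayes_in_unit:
  assumes "p \<in> {0..1}"
  shows "bayes \<mu> t p x \<in> {0..1}"
proof -
  have "0 \<le> bayes \<mu> t p x"
    using evidence_pos[OF assms, of \<mu> t x] assms
    by (auto simp: bayes_def intro!: divide_nonneg_pos mult_nonneg_nonneg less_imp_le[OF likelihood_ratio_pos])
  then show ?thesis using bayes_le_1_iff[OF evidence_pos[OF assms, of \<mu> t x]] assms by auto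
qed

lemma bayes_0 [simp]: "bayes \<mu> t 0 x = 0" and evidence_0 [simp]: "evidence \<mu> t 0 x = 1"
  by (simp_all add: bayes_def evidence_def)

lemma bayes_time_0 [simp]: "bayes \<mu> 0 p 0 = p" and evidence_time_0 [simp]: "evidence \<mu> 0 p 0 = 1"
  by (simp_all add: bayes_def evidence_def)

text \<open>Chain rule for marginal likelihoods: the weight of a later increment uses the posterior
  after the earlier one as its prior. Together with \<open>bayes_add\<close> this is the source of
  the Markov property, since splitting the time interval splits both the weight and the
  update.\<close>

lemma evidence_add:
  assumes "p \<in> {0..1}"
  shows "evidence \<mu> (s + t) p (x + y) = evidence \<mu> s p x * evidence \<mu> t (bayes \<mu> s p x) y"
proof -
  have "evidence \<mu> s p x * bayes \<mu> s p x = p * likelihood_ratio \<mu> s x"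
    using evidence_pos[OF assms, of \<mu> s x] by (simp add: bayes_def)
  then have "evidence \<mu> s p x * evidence \<mu> t (bayes \<mu> s p x) y =
      evidence \<mu> s p x - p * likelihood_ratio \<mu> s x + p * likelihood_ratio \<mu> s x * likelihood_ratio \<mu> t y"
    by (simp add: evidence_def[of \<mu> t] ring_distribs mult.assoc[symmetric])
  then show ?thesis by (simp add: evidence_def likelihood_ratio_add)
qed

lemma bayes_add:
  assumes "p \<in> {0..1}"
  shows "bayes \<mu> (s + t) p (x + y) = bayes \<mu> t (bayes \<mu> s p x) y"
proof -
  have "bayes \<mu> t (bayes \<mu> s p x) y =
      p * (likelihood_ratio \<mu> s x * likelihood_ratio \<mu> t y) /
        (evidence \<mu> s p x * evidence \<mu> t (bayes \<mu> s p x) y)"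
    by (simp only: bayes_def[of \<mu> t] bayes_def[of \<mu> s p x]) simp
  then show ?thesis
    by (simp only: evidence_add[OF assms] bayes_def[of \<mu> "s + t"] likelihood_ratio_add)
qed

lemma measurable_likelihood_ratio [measurable]: "likelihood_ratio \<mu> t \<in> borel_measurable borel"
  unfolding likelihood_ratio_def by measurable

lemma measurable_evidence [measurable (raw)]:
  assumes [measurable]: "f \<in> borel_measurable M" "g \<in> borel_measurable M"
  shows "(\<lambda>x. evidence \<mu> t (f x) (g x)) \<in> borel_measurable M"
  unfolding evidence_def likelihood_ratio_def by measurable

lemma measurable_bayes [measurable (raw)]:
  assumes [measurable]: "f \<in> borel_measurable M" "g \<in> borel_measurable M"
  shows "(\<lambda>x. bayes \<mu> t (f x) (g x)) \<in> borel_measurable M"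
  unfolding bayes_def likelihood_ratio_def by measurable

lemma sets_gauss [measurable_cong, simp]: "sets (gauss t) = sets borel"
  and space_gauss [simp]: "space (gauss t) = UNIV"
  by (simp_all add: gauss_def)

lemma prob_space_gauss: "t > 0 \<Longrightarrow> prob_space (gauss t)"
  unfolding gauss_def by (rule prob_space_normal_density) simp

lemma nn_integral_gauss:
  "f \<in> borel_measurable borel \<Longrightarrow>
   (\<integral>\<^sup>+x. f x \<partial>gauss t) = (\<integral>\<^sup>+x. ennreal (normal_density 0 (sqrt t) x) * f x \<partial>lborel)"
  unfolding gauss_def by (subst nn_integral_density) auto

text \<open>Girsanov's formula at one fixed time: completing the square turns the drift into the
  factor \<open>likelihood_ratio\<close>.\<close>

lemma normal_density_shift:
  assumes "t > 0"
  shows "normal_density 0 (sqrt t) (x - \<mu> * t) = normal_density 0 (sqrt t) x * likelihood_ratio \<mu> t x"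
proof -
  have "- (x - \<mu> * t)\<^sup>2 / (2 * t) = - x\<^sup>2 / (2 * t) + (\<mu> * x - \<mu>\<^sup>2 * t / 2)"
    using assms by (simp add: field_simps power2_eq_square)
  then show ?thesis
    using assms by (simp add: normal_density_def likelihood_ratio_def exp_add[symmetric])
qed

lemma nn_integral_gauss_shift:
  assumes "t > 0" and [measurable]: "f \<in> borel_measurable borel"
  shows "(\<integral>\<^sup>+x. f (x + \<mu> * t) \<partial>gauss t) = (\<integral>\<^sup>+x. f x * ennreal (likelihood_ratio \<mu> t x) \<partial>gauss t)"
proof -
  have "(\<integral>\<^sup>+x. f (x + \<mu> * t) \<partial>gauss t) =
      (\<integral>\<^sup>+x. ennreal (normal_density 0 (sqrt t) x) * f (x + \<mu> * t) \<partial>lborel)"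
    by (subst nn_integral_gauss) auto
  also have "\<dots> = (\<integral>\<^sup>+x. ennreal (normal_density 0 (sqrt t) (x - \<mu> * t)) * f x \<partial>lborel)"
    by (subst nn_integral_real_affine[where c=1 and t="- (\<mu> * t)"]) auto
  also have "\<dots> = (\<integral>\<^sup>+x. ennreal (normal_density 0 (sqrt t) x) * (f x * ennreal (likelihood_ratio \<mu> t x)) \<partial>lborel)"
    by (intro nn_integral_cong) (simp add: normal_density_shift[OF assms(1)] ennreal_mult' less_imp_le mult_ac)
  finally show ?thesis by (subst (asm) nn_integral_gauss[symmetric]) auto
qed

text \<open>Sending \<open>x\<close> to \<open>\<mu> * t - x\<close> exchanges the laws with drift 0
  and drift \<open>\<mu>\<close>, that is, the two hypotheses, so the likelihood ratio is inverted.
  The next three lemmas draw the consequences for the evidence, the update and the kernel.\<close>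

lemma likelihood_ratio_reflect: "likelihood_ratio \<mu> t (\<mu> * t - x) = inverse (likelihood_ratio \<mu> t x)"
proof -
  have "\<mu> * (\<mu> * t - x) - \<mu>\<^sup>2 * t / 2 = - (\<mu> * x - \<mu>\<^sup>2 * t / 2)"
    by (simp add: field_simps power2_eq_square)
  then show ?thesis by (simp only: likelihood_ratio_def exp_minus)
qed

lemma evidence_reflect:
  "evidence \<mu> t (1 - p) (\<mu> * t - x) * likelihood_ratio \<mu> t x = evidence \<mu> t p x"
  using likelihood_ratio_pos[of \<mu> t x, THEN less_imp_neq]
  by (simp add: evidence_def likelihood_ratio_reflect ring_distribs)

lemma bayes_reflect:
  assumes "p \<in> {0..1}"
  shows "bayes \<mu> t (1 - p) (\<mu> * t - x) = 1 - bayes \<mu> t p x"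
proof -
  have "bayes \<mu> t (1 - p) (\<mu> * t - x) =
      (1 - p) * inverse (likelihood_ratio \<mu> t x) / evidence \<mu> t (1 - p) (\<mu> * t - x)"
    by (simp add: bayes_def likelihood_ratio_reflect)
  also have "\<dots> = (1 - p) / (evidence \<mu> t (1 - p) (\<mu> * t - x) * likelihood_ratio \<mu> t x)"
    by (simp add: divide_inverse)
  also have "\<dots> = 1 - bayes \<mu> t p x"
    using evidence_pos[OF assms, of \<mu> t x] unfolding evidence_reflect
    by (simp add: bayes_def evidence_def field_simps)
  finally show ?thesis .
qed

lemma nn_integral_gauss_reflect:
  assumes "t > 0" "p \<in> {0..1}" and [measurable]: "f \<in> borel_measurable borel"
  shows "(\<integral>\<^sup>+x. f (bayes \<mu> t (1 - p) x) * ennreal (evidence \<mu> t (1 - p) x) \<partial>gauss t) =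
    (\<integral>\<^sup>+x. f (1 - bayes \<mu> t p x) * ennreal (evidence \<mu> t p x) \<partial>gauss t)"
proof -
  have dens: "normal_density 0 (sqrt t) (\<mu> * t - x) = normal_density 0 (sqrt t) x * likelihood_ratio \<mu> t x" for x
    using normal_density_shift[OF assms(1), of x \<mu>]
    by (simp add: normal_density_def power2_commute)
  have *: "ennreal (evidence \<mu> t p x) =
      ennreal (likelihood_ratio \<mu> t x) * ennreal (evidence \<mu> t (1 - p) (\<mu> * t - x))" for x
    by (subst evidence_reflect[symmetric])
      (metis ennreal_mult' likelihood_ratio_pos less_imp_le mult.commute)
  have "(\<integral>\<^sup>+x. f (bayes \<mu> t (1 - p) x) * ennreal (evidence \<mu> t (1 - p) x) \<partial>gauss t) =
      (\<integral>\<^sup>+x. ennreal (normal_density 0 (sqrt t) x) *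
        (f (bayes \<mu> t (1 - p) x) * ennreal (evidence \<mu> t (1 - p) x)) \<partial>lborel)"
    by (subst nn_integral_gauss) auto
  also have "\<dots> = (\<integral>\<^sup>+x. ennreal (normal_density 0 (sqrt t) (\<mu> * t - x)) *
        (f (bayes \<mu> t (1 - p) (\<mu> * t - x)) * ennreal (evidence \<mu> t (1 - p) (\<mu> * t - x))) \<partial>lborel)"
    by (subst nn_integral_real_affine[where c="-1" and t="\<mu> * t"]) auto
  also have "\<dots> = (\<integral>\<^sup>+x. ennreal (normal_density 0 (sqrt t) x) *
        (f (1 - bayes \<mu> t p x) * ennreal (evidence \<mu> t p x)) \<partial>lborel)"
    by (intro nn_integral_cong)
      (simp add: * bayes_reflect[OF assms(2)] dens ennreal_mult' less_imp_le mult_ac)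
  also have "\<dots> = (\<integral>\<^sup>+x. f (1 - bayes \<mu> t p x) * ennreal (evidence \<mu> t p x) \<partial>gauss t)"
    by (subst nn_integral_gauss) auto
  finally show ?thesis .
qed

lemma nn_integral_evidence:
  assumes "t > 0" "p \<in> {0..1}"
  shows "(\<integral>\<^sup>+x. ennreal (evidence \<mu> t p x) \<partial>gauss t) = 1"
proof -
  interpret prob_space "gauss t" by (rule prob_space_gauss) fact
  have "(\<integral>\<^sup>+x. ennreal (evidence \<mu> t p x) \<partial>gauss t) =
      (\<integral>\<^sup>+x. ennreal (1 - p) + ennreal p * (1 * ennreal (likelihood_ratio \<mu> t x)) \<partial>gauss t)"
    using assms
    by (intro nn_integral_cong) (simp add: evidence_def ennreal_plus ennreal_mult' less_imp_le)
  also have "\<dots> = ennreal (1 - p) + ennreal p * (\<integral>\<^sup>+x. 1 * ennreal (likelihood_ratio \<mu> t x) \<partial>gauss t)"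
    using emeasure_space_1 by (simp add: nn_integral_add nn_integral_cmult)
  also have "\<dots> = ennreal (1 - p) + ennreal p"
    using assms emeasure_space_1 by (subst nn_integral_gauss_shift[symmetric]) auto
  finally show ?thesis using assms by (simp flip: ennreal_plus)
qed

text \<open>Both measures agree on boxes, where the integral of a product factors. The lemma turns
  densities of independent increments into a joint density.\<close>

lemma PiM_density:
  assumes "finite I" "\<And>i. prob_space (M i)" "\<And>i. f i \<in> borel_measurable (M i)"
    "\<And>i. prob_space (density (M i) (f i))"
  shows "PiM I (\<lambda>i. density (M i) (f i)) = density (PiM I M) (\<lambda>x. \<Prod>i\<in>I. f i (x i))"
proof -
  note [measurable] = assms(3)
  interpret N: product_sigma_finite "\<lambda>i. density (M i) (f i)"
    using assms(2,4) by (simp add: product_sigma_finite_def prob_space_imp_sigma_finite)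
  interpret N': product_sigma_finite M
    using assms(2,4) by (simp add: product_sigma_finite_def prob_space_imp_sigma_finite)
  show ?thesis
  proof (rule N.PiM_eqI[symmetric])
    show "sets (density (Pi\<^sub>M I M) (\<lambda>x. \<Prod>i\<in>I. f i (x i))) = sets (\<Pi>\<^sub>M i\<in>I. density (M i) (f i))"
      unfolding sets_density by (intro sets_PiM_cong) auto
    fix A assume "\<And>i. i \<in> I \<Longrightarrow> A i \<in> sets (density (M i) (f i))"
    then have A [measurable]: "\<And>i. i \<in> I \<Longrightarrow> A i \<in> sets (M i)" by simp
    have [measurable]: "Pi\<^sub>E I A \<in> sets (Pi\<^sub>M I M)" using assms(1) by (intro sets_PiM_I_finite) auto
    have "emeasure (density (Pi\<^sub>M I M) (\<lambda>x. \<Prod>i\<in>I. f i (x i))) (Pi\<^sub>E I A) =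
       (\<integral>\<^sup>+x. (\<Prod>i\<in>I. f i (x i)) * indicator (Pi\<^sub>E I A) x \<partial>Pi\<^sub>M I M)"
      by (subst emeasure_density) measurable
    also have "\<dots> = (\<integral>\<^sup>+x. (\<Prod>i\<in>I. f i (x i) * indicator (A i) (x i)) \<partial>Pi\<^sub>M I M)"
    proof (intro nn_integral_cong)
      fix x assume "x \<in> space (Pi\<^sub>M I M)"
      then have "indicator (Pi\<^sub>E I A) x = (\<Prod>i\<in>I. indicator (A i) (x i) :: ennreal)"
        using assms(1) by (auto simp: indicator_def space_PiM PiE_iff prod_zero_iff)
      then show "(\<Prod>i\<in>I. f i (x i)) * indicator (Pi\<^sub>E I A) x = (\<Prod>i\<in>I. f i (x i) * indicator (A i) (x i))"
        by (simp add: prod.distrib)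
    qed
    also have "\<dots> = (\<Prod>i\<in>I. \<integral>\<^sup>+x. f i x * indicator (A i) x \<partial>M i)"
      using assms(1) by (intro N'.product_nn_integral_prod) measurable
    also have "\<dots> = (\<Prod>i\<in>I. emeasure (density (M i) (f i)) (A i))"
      by (intro prod.cong refl) (subst emeasure_density; measurable)
    finally show "emeasure (density (Pi\<^sub>M I M) (\<lambda>x. \<Prod>i\<in>I. f i (x i))) (Pi\<^sub>E I A) =
        (\<Prod>i\<in>I. emeasure (density (M i) (f i)) (A i))" .
  qed (use assms in auto)
qed

section \<open>One coordinate: posterior and Markov property\<close>

lemma process_sigma_measurable:
  "i \<in> I \<Longrightarrow> Z i \<in> borel_measurable (process_sigma \<Omega> Z I)"
  unfolding process_sigma_def by (rule measurableI) (auto simp: space_measure_of_conv)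

lemma space_process_sigma [simp]: "space (process_sigma \<Omega> Z I) = \<Omega>"
  by (simp add: process_sigma_def space_measure_of_conv)

lemma sets_process_sigma:
  "sets (process_sigma \<Omega> Z I) = sigma_sets \<Omega> (\<Union>t\<in>I. {Z t -` B \<inter> \<Omega> |B. B \<in> sets borel})"
  unfolding process_sigma_def by (rule sets_measure_of) auto

text \<open>\<open>standard_brownian_motion\<close> speaks of increments along an infinite monotone
  sequence of times, so a finite set of times has to be embedded in one. Position \<open>m\<close>
  is the present time \<open>T\<close>, and position \<open>Suc m\<close> is the later time that the
  Markov property needs.\<close>

lemma strict_mono_enumeration:
  fixes T :: real
  assumes "finite J" "J \<subseteq> {0..T}" "0 \<le> T" "\<delta> > 0"
  obtains t :: "nat \<Rightarrow> real" and m where "strict_mono t" "t 0 = 0" "t m = T" "t (Suc m) = T + \<delta>"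
    "J \<subseteq> t ` {..m}"
proof -
  define K where "K = insert 0 (insert T J)"
  have K: "finite K" "K \<noteq> {}" "K \<subseteq> {0..T}" using assms by (auto simp: K_def)
  define xs where "xs = sorted_list_of_set K"
  have xs: "set xs = K" "sorted_wrt (<) xs" "xs \<noteq> []"
    using K by (auto simp: xs_def strict_sorted_iff)
  define m where "m = length xs - 1"
  have m: "length xs = Suc m" using xs by (simp add: m_def)
  \<comment> \<open>Past the last listed time the sequence goes on in steps of \<delta>, which keeps
    it strictly increasing and makes \<open>T + \<delta>\<close> the next time after
    \<open>T\<close>.\<close>
  define t where "t j = (if j \<le> m then xs ! j else T + \<delta> * real (j - m))" for j
  have in_K: "xs ! j \<in> {0..T}" if "j \<le> m" for j
    using K(3) xs(1) m that by (metis nth_mem less_Suc_eq_le subsetD)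
  have mono: "xs ! i < xs ! j" if "i < j" "j \<le> m" for i j
    using xs(2) m that by (simp add: sorted_wrt_nth_less)
  obtain i0 where i0: "i0 \<le> m" "xs ! i0 = 0"
    using xs(1) m by (metis K_def in_set_conv_nth insertI1 less_Suc_eq_le)
  obtain iT where iT: "iT \<le> m" "xs ! iT = T"
    using xs(1) m by (metis K_def in_set_conv_nth insertI1 insertI2 less_Suc_eq_le)
  have t0: "t 0 = 0"
    using mono[of 0 i0] in_K[of 0] i0 by (cases "i0 = 0") (auto simp: t_def)
  have tm: "t m = T"
    using mono[of iT m] in_K[of m] iT by (cases "iT = m") (auto simp: t_def)
  have "strict_mono t"
    unfolding strict_mono_Suc_iff
  proof
    fix n
    consider "Suc n \<le> m" | "n = m" | "n > m" by linarith
    then show "t n < t (Suc n)"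
    proof cases
      case 1 then show ?thesis using mono[of n "Suc n"] by (simp add: t_def)
    next
      case 2 then show ?thesis using tm assms(4) by (simp add: t_def)
    next
      case 3 then show ?thesis using assms(4) by (simp add: t_def Suc_diff_le)
    qed
  qed
  moreover have "J \<subseteq> t ` {..m}"
  proof
    fix s assume "s \<in> J"
    then obtain i where "i < length xs" "xs ! i = s" using xs(1) K_def by (metis in_set_conv_nth insertCI)
    then show "s \<in> t ` {..m}" using m by (intro image_eqI[of _ _ i]) (auto simp: t_def)
  qed
  moreover have "t (Suc m) = T + \<delta>" by (simp add: t_def)
  ultimately show ?thesis using t0 tm that by blast
qed

text \<open>Restricted to \<open>{..<m}\<close> so that the value lies in the space of the product
  measure over that index set.\<close>

definition increments :: "(nat \<Rightarrow> real) \<Rightarrow> nat \<Rightarrow> (real \<Rightarrow> 'a \<Rightarrow> real) \<Rightarrow> 'a \<Rightarrow> nat \<Rightarrow> real" where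
  "increments t m X \<omega> = (\<lambda>j\<in>{..<m}. X (t (Suc j)) \<omega> - X (t j) \<omega>)"

text \<open>The transition kernel of a one-dimensional posterior. The next increment
  \<open>z\<close> of the observation has, under the current belief \<open>q\<close>, the driftless
  Gaussian law reweighted by \<open>evidence\<close>.\<close>

definition bayes_step :: "real \<Rightarrow> real \<Rightarrow> (real \<Rightarrow> ennreal) \<Rightarrow> real \<Rightarrow> ennreal" where
  "bayes_step \<mu> \<delta> f q = (\<integral>\<^sup>+z. f (bayes \<mu> \<delta> q z) * ennreal (evidence \<mu> \<delta> q z) \<partial>gauss \<delta>)"

lemma measurable_bayes_step [measurable]:
  assumes "\<delta> > 0" and [measurable]: "f \<in> borel_measurable borel"
  shows "bayes_step \<mu> \<delta> f \<in> borel_measurable borel"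
proof -
  interpret prob_space "gauss \<delta>" by (rule prob_space_gauss) fact
  show ?thesis unfolding bayes_step_def[abs_def] by measurable
qed

lemma standard_brownian_motion_measurable:
  "standard_brownian_motion M B \<Longrightarrow> t \<ge> 0 \<Longrightarrow> B t \<in> borel_measurable M"
  by (auto simp: standard_brownian_motion_def)

text \<open>The exponent is linear in time and increment, so the product telescopes. Only the total
  increment carries information, which is why the posterior depends on the last observation
  alone.\<close>

lemma prod_likelihood_ratio:
  assumes "t 0 = 0"
  shows "(\<Prod>j<m. ennreal (likelihood_ratio c (t (Suc j) - t j) (x j))) =
    ennreal (likelihood_ratio c (t m) (\<Sum>j<m. x j))"
proof (induction m)
  case (Suc m)
  have "likelihood_ratio c (t (Suc m)) (\<Sum>j<Suc m. x j) =
    likelihood_ratio c (t m) (\<Sum>j<m. x j) * likelihood_ratio c (t (Suc m) - t m) (x m)"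
    by (subst likelihood_ratio_add[symmetric]) simp
  then show ?case using Suc by (simp add: ennreal_mult' less_imp_le)
qed (use assms in simp)

text \<open>One coordinate of the model in isolation, under one fixed law; independence later
  assembles the vector-valued statements from it.\<close>

locale noisy_drift = prob_space M for M :: "'a measure" +
  fixes \<mu> p :: real and Y :: "'a \<Rightarrow> real" and B :: "real \<Rightarrow> 'a \<Rightarrow> real"
  assumes brownian: "standard_brownian_motion M B"
    and Y_measurable [measurable]: "Y \<in> borel_measurable M"
    and Y_values: "\<omega> \<in> space M \<Longrightarrow> Y \<omega> \<in> {0, 1}"
    and Y_prior: "prob {\<omega> \<in> space M. Y \<omega> = 1} = p"
    and Y_B_indep: "indep_set (sets (vimage_algebra (space M) Y borel)) (sets (process_sigma (space M) B {0..}))"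
begin

definition X :: "real \<Rightarrow> 'a \<Rightarrow> real" where
  "X t \<omega> = \<mu> * Y \<omega> * t + B t \<omega>"

lemma p_unit: "p \<in> {0..1}"
  using Y_prior by auto

lemma measurable_B: "t \<ge> 0 \<Longrightarrow> B t \<in> borel_measurable M"
  using brownian by (rule standard_brownian_motion_measurable)

lemma measurable_X: "t \<ge> 0 \<Longrightarrow> X t \<in> borel_measurable M"
  using measurable_B[of t] unfolding X_def[abs_def] by measurable

lemma X_0: "AE \<omega> in M. X 0 \<omega> = 0"
  using brownian by (auto simp: standard_brownian_motion_def X_def)

lemma prob_Y: "y \<in> {0, 1} \<Longrightarrow> emeasure M {\<omega> \<in> space M. Y \<omega> = y} = ennreal (if y = 1 then p else 1 - p)"
proof -
  assume "y \<in> {0, 1}"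
  moreover have "{\<omega> \<in> space M. Y \<omega> = 0} = space M - {\<omega> \<in> space M. Y \<omega> = 1}"
    using Y_values by auto
  then have "prob {\<omega> \<in> space M. Y \<omega> = 0} = 1 - p"
    using Y_prior by (simp add: prob_compl)
  ultimately show ?thesis using Y_prior by (auto simp: emeasure_eq_measure)
qed

section \<open>Law of finitely many increments of one observed coordinate\<close>

context
  fixes t :: "nat \<Rightarrow> real" and m :: nat
  assumes t: "strict_mono t" "t 0 = 0"
begin

lemma t_nonneg: "0 \<le> t j"
  using t strict_mono_less_eq[OF t(1), of 0 j] by simp

lemma t_Suc: "t j < t (Suc j)"
  using t by (simp add: strict_mono_Suc_iff)

text \<open>The driftless reference law: with respect to it the increments have an explicit density
  under either hypothesis and under their mixture.\<close>

definition G :: "(nat \<Rightarrow> real) measure" where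
  "G = PiM {..<m} (\<lambda>j. gauss (t (Suc j) - t j))"

lemma sets_G [measurable_cong]: "sets G = sets (PiM {..<m} (\<lambda>_. borel))"
  unfolding G_def by (intro sets_PiM_cong) auto

lemma measurable_increments_X: "increments t m X \<in> M \<rightarrow>\<^sub>M PiM {..<m} (\<lambda>_. borel)"
  unfolding increments_def[abs_def]
  using measurable_X[OF t_nonneg] by measurable

lemma distr_increment_drift:
  "distr M borel (\<lambda>\<omega>. B (t (Suc j)) \<omega> - B (t j) \<omega> + c * (t (Suc j) - t j)) =
    density (gauss (t (Suc j) - t j)) (\<lambda>x. ennreal (likelihood_ratio c (t (Suc j) - t j) x))"
  (is "distr M borel (\<lambda>\<omega>. ?Z \<omega> + c * ?d) = _")
proof -
  note [measurable] = measurable_B[OF t_nonneg]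
  have "distributed M lborel ?Z (normal_density 0 (sqrt ?d))"
    using brownian t_nonneg t_Suc by (simp add: standard_brownian_motion_def)
  then have Z: "distr M borel ?Z = gauss ?d"
    by (simp add: distributed_def gauss_def cong: distr_cong)
  show ?thesis
  proof (rule measure_eqI)
    fix A assume "A \<in> sets (distr M borel (\<lambda>\<omega>. ?Z \<omega> + c * ?d))"
    then have [measurable]: "A \<in> sets borel" by simp
    have "emeasure (distr M borel (\<lambda>\<omega>. ?Z \<omega> + c * ?d)) A = (\<integral>\<^sup>+\<omega>. indicator A (?Z \<omega> + c * ?d) \<partial>M)"
      by (subst nn_integral_indicator[symmetric], simp, subst nn_integral_distr) auto
    also have "\<dots> = (\<integral>\<^sup>+x. indicator A (x + c * ?d) \<partial>gauss ?d)"
      unfolding Z[symmetric] by (subst nn_integral_distr) auto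
    also have "\<dots> = (\<integral>\<^sup>+x. indicator A x * ennreal (likelihood_ratio c ?d x) \<partial>gauss ?d)"
      using t_Suc by (intro nn_integral_gauss_shift) auto
    also have "\<dots> = emeasure (density (gauss ?d) (\<lambda>x. ennreal (likelihood_ratio c ?d x))) A"
      by (subst emeasure_density) (auto simp: mult.commute)
    finally show "emeasure (distr M borel (\<lambda>\<omega>. ?Z \<omega> + c * ?d)) A =
      emeasure (density (gauss ?d) (\<lambda>x. ennreal (likelihood_ratio c ?d x))) A" .
  qed simp
qed

lemma distr_increments_drift:
  "distr M (PiM {..<m} (\<lambda>_. borel)) (increments t m (\<lambda>s \<omega>. B s \<omega> + c * s)) =
    density G (\<lambda>x. ennreal (likelihood_ratio c (t m) (\<Sum>j<m. x j)))"
proof -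
  note [measurable] = measurable_B[OF t_nonneg]
  let ?Z = "\<lambda>j \<omega>. B (t (Suc j)) \<omega> - B (t j) \<omega> + c * (t (Suc j) - t j)"
  let ?D = "\<lambda>j. density (gauss (t (Suc j) - t j)) (\<lambda>x. ennreal (likelihood_ratio c (t (Suc j) - t j) x))"
  have "mono t" using t(1) by (rule strict_mono_mono)
  then have "indep_vars (\<lambda>_. borel) (\<lambda>k \<omega>. B (t (Suc k)) \<omega> - B (t k) \<omega>) {..<m}"
    using brownian t(2) by (auto simp: standard_brownian_motion_def)
  from indep_vars_compose2[OF this, of "\<lambda>j x. x + c * (t (Suc j) - t j)" "\<lambda>_. borel"]
  have indep: "indep_vars (\<lambda>_. borel) ?Z {..<m}" by simp
  have ps: "prob_space (?D j)" for j
    unfolding distr_increment_drift[symmetric] by (rule prob_space_distr) measurable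
  have *: "distr M (PiM {..<m} (\<lambda>_. borel)) (\<lambda>\<omega>. \<lambda>j\<in>{..<m}. ?Z j \<omega>) =
      PiM {..<m} (\<lambda>j. distr M borel (?Z j))"
  \<comment> \<open>The characterization of independence by the product law is applied to a nonempty
    index set. For \<open>m = 0\<close> both measures live on a one-point space and are compared
    directly.\<close>
  proof (cases "m = 0")
    case False
    then show ?thesis
      using indep by (subst indep_vars_iff_distr_eq_PiM'[symmetric]) (auto simp: lessThan_empty_iff)
  next
    case True
    interpret product_sigma_finite "\<lambda>j. distr M borel (?Z j)"
      using ps distr_increment_drift by (simp add: product_sigma_finite_def prob_space_imp_sigma_finite)
    show ?thesis unfolding True
    proof (rule PiM_eqI)
      show "emeasure (distr M (PiM {..<0::nat} (\<lambda>_. borel)) (\<lambda>\<omega>. \<lambda>j\<in>{..<0}. ?Z j \<omega>)) (Pi\<^sub>E {..<0} A) =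
        (\<Prod>i<0. emeasure (distr M borel (?Z i)) (A i))" for A
      proof -
        have "Pi\<^sub>E {..<0::nat} A \<in> sets (PiM {..<0::nat} (\<lambda>_. borel :: real measure))"
          by (intro sets_PiM_I_finite) auto
        then show ?thesis
          by (subst emeasure_distr) (auto simp: emeasure_space_1 restrict_def)
      qed
    qed (auto intro!: sets_PiM_cong)
  qed
  have "increments t m (\<lambda>s \<omega>. B s \<omega> + c * s) = (\<lambda>\<omega>. \<lambda>j\<in>{..<m}. ?Z j \<omega>)"
    by (auto simp: increments_def fun_eq_iff algebra_simps)
  then show ?thesis
    using t_Suc ps unfolding * distr_increment_drift G_def prod_likelihood_ratio[where t=t, OF t(2), symmetric]
    by (simp only: * distr_increment_drift) (rule PiM_density, auto intro!: prob_space_gauss)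
qed

text \<open>On the event \<open>Y = y\<close> the observation is a Brownian motion with the constant
  drift \<open>\<mu> * y\<close>, and that path is independent of \<open>Y\<close>. Restricting to
  the event therefore only multiplies by its prior probability.\<close>

lemma nn_integral_increments_given_Y:
  assumes y: "y \<in> {0, 1}" and [measurable]: "F \<in> borel_measurable (PiM {..<m} (\<lambda>_. borel))"
  shows "(\<integral>\<^sup>+\<omega>. indicator {\<omega>. Y \<omega> = y} \<omega> * F (increments t m X \<omega>) \<partial>M) =
    ennreal (if y = 1 then p else 1 - p) *
      (\<integral>\<^sup>+x. F x * ennreal (likelihood_ratio (\<mu> * y) (t m) (\<Sum>j<m. x j)) \<partial>G)"
proof -
  let ?P = "PiM {..<m} (\<lambda>_. borel :: real measure)"
  let ?Z = "increments t m (\<lambda>s \<omega>. B s \<omega> + \<mu> * y * s)"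
  let ?r = "ennreal (if y = 1 then p else 1 - p)"
  have ZB: "?Z \<in> process_sigma (space M) B {0..} \<rightarrow>\<^sub>M ?P"
  proof -
    have [measurable]: "B (t j) \<in> borel_measurable (process_sigma (space M) B {0..})" for j
      using t_nonneg by (intro process_sigma_measurable) simp
    show ?thesis unfolding increments_def[abs_def] by measurable
  qed
  have sub: "sets (process_sigma (space M) B {0..}) \<subseteq> sets M"
    unfolding sets_process_sigma using measurable_B
    by (intro sets.sigma_sets_subset) (auto intro!: measurable_sets)
  then have [measurable]: "?Z \<in> M \<rightarrow>\<^sub>M ?P"
    using ZB by (auto simp: measurable_def)
  have eq: "distr (density M (indicator {\<omega>. Y \<omega> = y})) ?P ?Z = density (distr M ?P ?Z) (\<lambda>_. ?r)"
  proof (rule measure_eqI)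
    fix C assume "C \<in> sets (distr (density M (indicator {\<omega>. Y \<omega> = y})) ?P ?Z)"
    then have C [measurable]: "C \<in> sets ?P" by simp
    let ?A = "{\<omega> \<in> space M. Y \<omega> = y}" and ?E = "?Z -` C \<inter> space M"
    have A: "?A \<in> sets (vimage_algebra (space M) Y borel)"
      using in_vimage_algebra[of "{y}" borel Y "space M"] by (simp add: vimage_def Int_def conj_commute)
    have E: "?E \<in> sets (process_sigma (space M) B {0..})"
      using measurable_sets[OF ZB C] by simp
    have [measurable]: "?E \<in> sets M" using E sub by auto
    have "emeasure (distr (density M (indicator {\<omega>. Y \<omega> = y})) ?P ?Z) C =
        (\<integral>\<^sup>+\<omega>. indicator (?A \<inter> ?E) \<omega> \<partial>M)"
      by (subst emeasure_distr, simp, simp, subst emeasure_density, simp, simp)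
         (rule nn_integral_cong, simp add: indicator_def)
    also have "\<dots> = emeasure M ?A * emeasure M ?E"
      using indep_setD[OF Y_B_indep A E]
      by (simp add: emeasure_eq_measure ennreal_mult')
    also have "\<dots> = emeasure (density (distr M ?P ?Z) (\<lambda>_. ?r)) C"
      using prob_Y[OF y]
      by (subst emeasure_density, simp, simp, subst nn_integral_cmult_indicator) (auto simp: emeasure_distr)
    finally show "emeasure (distr (density M (indicator {\<omega>. Y \<omega> = y})) ?P ?Z) C =
        emeasure (density (distr M ?P ?Z) (\<lambda>_. ?r)) C" .
  qed simp
  have "(\<integral>\<^sup>+\<omega>. indicator {\<omega>. Y \<omega> = y} \<omega> * F (increments t m X \<omega>) \<partial>M) =
      (\<integral>\<^sup>+\<omega>. indicator {\<omega>. Y \<omega> = y} \<omega> * F (?Z \<omega>) \<partial>M)"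
  proof (intro nn_integral_cong)
    fix \<omega>
    have "Y \<omega> = y \<Longrightarrow> increments t m X \<omega> = ?Z \<omega>"
      by (auto simp: increments_def X_def)
    then show "indicator {\<omega>. Y \<omega> = y} \<omega> * F (increments t m X \<omega>) = indicator {\<omega>. Y \<omega> = y} \<omega> * F (?Z \<omega>)"
      by (auto simp: indicator_def)
  qed
  also have "\<dots> = (\<integral>\<^sup>+x. F x \<partial>distr (density M (indicator {\<omega>. Y \<omega> = y})) ?P ?Z)"
    by (subst nn_integral_distr, simp, simp, subst nn_integral_density) auto
  also have "\<dots> = (\<integral>\<^sup>+x. ?r * F x \<partial>distr M ?P ?Z)"
    unfolding eq by (subst nn_integral_density) auto
  also have "\<dots> = ?r * (\<integral>\<^sup>+x. F x * ennreal (likelihood_ratio (\<mu> * y) (t m) (\<Sum>j<m. x j)) \<partial>G)"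
    unfolding distr_increments_drift
    by (subst nn_integral_cmult, simp, subst nn_integral_density) (auto simp: mult.commute)
  finally show ?thesis .
qed

text \<open>Mixture over the two hypotheses: the driftless law with weight \<open>1 - p\<close> and
  the tilted law with weight \<open>p\<close> add up to the density \<open>evidence\<close>.\<close>

lemma nn_integral_increments:
  assumes [measurable]: "F \<in> borel_measurable (PiM {..<m} (\<lambda>_. borel))"
  shows "(\<integral>\<^sup>+\<omega>. F (increments t m X \<omega>) \<partial>M) =
      (\<integral>\<^sup>+x. F x * ennreal (evidence \<mu> (t m) p (\<Sum>j<m. x j)) \<partial>G)"
proof -
  note [measurable] = measurable_increments_X
  have "(\<integral>\<^sup>+\<omega>. F (increments t m X \<omega>) \<partial>M) =
     (\<integral>\<^sup>+\<omega>. indicator {\<omega>. Y \<omega> = 0} \<omega> * F (increments t m X \<omega>) +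
        indicator {\<omega>. Y \<omega> = 1} \<omega> * F (increments t m X \<omega>) \<partial>M)"
    using Y_values by (intro nn_integral_cong) (auto simp: indicator_def)
  also have "\<dots> = (\<integral>\<^sup>+\<omega>. indicator {\<omega>. Y \<omega> = 0} \<omega> * F (increments t m X \<omega>) \<partial>M) +
     (\<integral>\<^sup>+\<omega>. indicator {\<omega>. Y \<omega> = 1} \<omega> * F (increments t m X \<omega>) \<partial>M)"
    by (subst nn_integral_add) auto
  also have "\<dots> = ennreal (1 - p) * (\<integral>\<^sup>+x. F x \<partial>G) +
     ennreal p * (\<integral>\<^sup>+x. F x * ennreal (likelihood_ratio \<mu> (t m) (\<Sum>j<m. x j)) \<partial>G)"
    by (subst (1 2) nn_integral_increments_given_Y) (auto simp: likelihood_ratio_def)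
  also have "\<dots> = (\<integral>\<^sup>+x. ennreal (1 - p) * F x +
      ennreal p * (F x * ennreal (likelihood_ratio \<mu> (t m) (\<Sum>j<m. x j))) \<partial>G)"
    by (subst nn_integral_add) (auto simp: nn_integral_cmult)
  also have "\<dots> = (\<integral>\<^sup>+x. F x * ennreal (evidence \<mu> (t m) p (\<Sum>j<m. x j)) \<partial>G)"
    using p_unit
    by (intro nn_integral_cong)
       (simp add: evidence_def ennreal_mult' ennreal_plus less_imp_le distrib_left mult_ac)
  finally show ?thesis .
qed

lemma sum_increments:
  assumes "X 0 \<omega> = 0" "j \<le> m"
  shows "(\<Sum>l<j. increments t m X \<omega> l) = X (t j) \<omega>"
proof -
  have "(\<Sum>l<j. increments t m X \<omega> l) = (\<Sum>l<j. X (t (Suc l)) \<omega> - X (t l) \<omega>)"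
    using assms(2) by (intro sum.cong) (auto simp: increments_def)
  also have "\<dots> = X (t j) \<omega>" using assms(1) t(2) by (simp add: sum_lessThan_telescope[of "\<lambda>l. X (t l) \<omega>"])
  finally show ?thesis .
qed

end

text \<open>Events of the path are handled through finitely many increments. The equivalence is only
  almost sure, because the path is recovered by summing increments from \<open>X 0 = 0\<close>,
  which itself holds almost surely.\<close>

lemma cylinder_as_increments:
  assumes "finite J" "J \<subseteq> {0..T}" "0 \<le> T" "\<delta> > 0" and D: "\<And>s. s \<in> J \<Longrightarrow> D s \<in> sets borel"
  obtains t m C where "strict_mono t" "t 0 = 0" "t m = T" "t (Suc m) = T + \<delta>"
    "C \<in> sets (PiM {..<m} (\<lambda>_. borel))"
    "AE \<omega> in M. \<omega> \<in> {\<omega> \<in> space M. \<forall>s\<in>J. X s \<omega> \<in> D s} \<longleftrightarrow> increments t m X \<omega> \<in> C"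
proof -
  obtain t m where t: "strict_mono t" "t 0 = 0" "t m = T" "t (Suc m) = T + \<delta>" "J \<subseteq> t ` {..m}"
    using strict_mono_enumeration[OF assms(1-4)] by blast
  then have "\<forall>s\<in>J. \<exists>j. j \<le> m \<and> t j = s" by auto
  from bchoice[OF this] obtain idx where idx: "\<And>s. s \<in> J \<Longrightarrow> idx s \<le> m \<and> t (idx s) = s" by blast
  let ?P = "PiM {..<m} (\<lambda>_. borel :: real measure)"
  define C where "C = {x \<in> space ?P. \<forall>s\<in>J. (\<Sum>l<idx s. x l) \<in> D s}"
  have "C \<in> sets ?P"
    unfolding C_def
  proof (rule sets.sets_Collect_finite_All[OF _ \<open>finite J\<close>])
    fix s assume s: "s \<in> J"
    note [measurable] = D[OF s]
    have "(\<lambda>x. \<Sum>l<idx s. x l) \<in> borel_measurable ?P"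
      using idx[OF s] by (intro borel_measurable_sum measurable_component_singleton) auto
    then show "{x \<in> space ?P. (\<Sum>l<idx s. x l) \<in> D s} \<in> sets ?P"
      by measurable
  qed
  moreover have "AE \<omega> in M. \<omega> \<in> {\<omega> \<in> space M. \<forall>s\<in>J. X s \<omega> \<in> D s} \<longleftrightarrow> increments t m X \<omega> \<in> C"
    using X_0 AE_space
  proof eventually_elim
    case (elim \<omega>)
    have "increments t m X \<omega> \<in> space ?P" by (auto simp: increments_def space_PiM)
    moreover have "(\<Sum>l<idx s. increments t m X \<omega> l) = X s \<omega>" if "s \<in> J" for s
      using sum_increments[OF t(1,2) elim(1)] idx[OF that] by metis
    ultimately show ?case using elim by (auto simp: C_def)
  qed
  ultimately show ?thesis using t that by blast
qed

text \<open>Bayes' formula: the joint weight \<open>p * likelihood_ratio\<close> of the path and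
  \<open>Y = 1\<close> equals \<open>bayes\<close> times \<open>evidence\<close>. Testing against
  cylinders up to time \<open>T\<close> is what will identify the conditional expectation of
  \<open>Y\<close>.\<close>

lemma posterior_on_cylinder:
  assumes "finite J" "J \<subseteq> {0..T}" "0 \<le> T" and D: "\<And>s. s \<in> J \<Longrightarrow> D s \<in> sets borel"
  defines "A \<equiv> {\<omega> \<in> space M. \<forall>s\<in>J. X s \<omega> \<in> D s}"
  shows "(\<integral>\<^sup>+\<omega>. ennreal (Y \<omega>) * indicator A \<omega> \<partial>M) =
    (\<integral>\<^sup>+\<omega>. ennreal (bayes \<mu> T p (X T \<omega>)) * indicator A \<omega> \<partial>M)"
proof -
  obtain t m C where t: "strict_mono t" "t 0 = 0" "t m = T" "t (Suc m) = T + 1"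
    and C [measurable]: "C \<in> sets (PiM {..<m} (\<lambda>_. borel))"
    and AC: "AE \<omega> in M. \<omega> \<in> A \<longleftrightarrow> increments t m X \<omega> \<in> C"
    unfolding A_def by (rule cylinder_as_increments[OF assms(1-3) zero_less_one D])
  note [measurable_cong] = sets_G[OF t(1,2), of m]
  let ?I = "increments t m X"
  have "(\<integral>\<^sup>+\<omega>. ennreal (Y \<omega>) * indicator A \<omega> \<partial>M) =
      (\<integral>\<^sup>+\<omega>. indicator {\<omega>. Y \<omega> = 1} \<omega> * indicator C (?I \<omega>) \<partial>M)"
  proof (intro nn_integral_cong_AE, use AC AE_space in eventually_elim)
    case (elim \<omega>)
    show ?case using Y_values[OF elim(2)] elim(1) by (auto simp: indicator_def)
  qed
  also have "\<dots> = ennreal p * (\<integral>\<^sup>+x. indicator C x * ennreal (likelihood_ratio \<mu> (t m) (\<Sum>j<m. x j)) \<partial>G t m)"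
    using nn_integral_increments_given_Y[OF t(1,2), of 1 "indicator C" m] by simp
  also have "\<dots> = (\<integral>\<^sup>+x. ennreal (bayes \<mu> (t m) p (\<Sum>j<m. x j)) * indicator C x *
      ennreal (evidence \<mu> (t m) p (\<Sum>j<m. x j)) \<partial>G t m)"
  proof (subst nn_integral_cmult[symmetric])
    show "(\<lambda>x. indicator C x * ennreal (likelihood_ratio \<mu> (t m) (\<Sum>j<m. x j))) \<in> borel_measurable (G t m)"
      by measurable
  next
    show "(\<integral>\<^sup>+x. ennreal p * (indicator C x * ennreal (likelihood_ratio \<mu> (t m) (\<Sum>j<m. x j))) \<partial>G t m) =
      (\<integral>\<^sup>+x. ennreal (bayes \<mu> (t m) p (\<Sum>j<m. x j)) * indicator C x *
        ennreal (evidence \<mu> (t m) p (\<Sum>j<m. x j)) \<partial>G t m)"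
    proof (intro nn_integral_cong)
      fix x :: "nat \<Rightarrow> real"
      let ?S = "\<Sum>j<m. x j"
      have "p * likelihood_ratio \<mu> (t m) ?S = bayes \<mu> (t m) p ?S * evidence \<mu> (t m) p ?S"
        using evidence_pos[OF p_unit, of \<mu> "t m" ?S] by (simp add: bayes_def)
      then show "ennreal p * (indicator C x * ennreal (likelihood_ratio \<mu> (t m) ?S)) =
        ennreal (bayes \<mu> (t m) p ?S) * indicator C x * ennreal (evidence \<mu> (t m) p ?S)"
        using p_unit bayes_in_unit[OF p_unit, of \<mu> "t m" ?S]
        by (cases "x \<in> C") (simp_all flip: ennreal_mult')
    qed
  qed
  also have "\<dots> = (\<integral>\<^sup>+\<omega>. ennreal (bayes \<mu> (t m) p (\<Sum>j<m. ?I \<omega> j)) * indicator C (?I \<omega>) \<partial>M)"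
    by (subst nn_integral_increments[OF t(1,2)]) auto
  also have "\<dots> = (\<integral>\<^sup>+\<omega>. ennreal (bayes \<mu> T p (X T \<omega>)) * indicator A \<omega> \<partial>M)"
  proof (intro nn_integral_cong_AE, use AC X_0 in eventually_elim)
    case (elim \<omega>)
    show ?case
      using sum_increments[OF t(1,2) elim(2), of m m] elim(1) by (simp add: t(3) indicator_def)
  qed
  finally show ?thesis .
qed

text \<open>The last increment is integrated out by Fubini. By \<open>evidence_add\<close> and
  \<open>bayes_add\<close> the inner integral is a \<open>bayes_step\<close> started from the
  posterior at time \<open>s\<close>, weighted by the evidence at time \<open>s\<close>.\<close>

lemma markov_on_cylinder:
  assumes "finite J" "J \<subseteq> {0..s}" "0 \<le> s" "\<delta> > 0" and D: "\<And>r. r \<in> J \<Longrightarrow> D r \<in> sets borel"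
    and [measurable]: "f \<in> borel_measurable borel"
  defines "A \<equiv> {\<omega> \<in> space M. \<forall>r\<in>J. X r \<omega> \<in> D r}"
  shows "(\<integral>\<^sup>+\<omega>. f (bayes \<mu> (s + \<delta>) p (X (s + \<delta>) \<omega>)) * indicator A \<omega> \<partial>M) =
    (\<integral>\<^sup>+\<omega>. bayes_step \<mu> \<delta> f (bayes \<mu> s p (X s \<omega>)) * indicator A \<omega> \<partial>M)"
proof -
  note [measurable] = measurable_bayes_step[OF \<open>\<delta> > 0\<close>]
  obtain t m C where t: "strict_mono t" "t 0 = 0" "t m = s" "t (Suc m) = s + \<delta>"
    and C [measurable]: "C \<in> sets (PiM {..<m} (\<lambda>_. borel))"
    and AC: "AE \<omega> in M. \<omega> \<in> A \<longleftrightarrow> increments t m X \<omega> \<in> C"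
    unfolding A_def by (rule cylinder_as_increments[OF assms(1-4) D])
  note [measurable_cong] = sets_G[OF t(1,2), of m] sets_G[OF t(1,2), of "Suc m"]
  let ?I = "increments t m X" and ?I' = "increments t (Suc m) X"
  \<comment> \<open>A function of all \<open>Suc m\<close> increments: the event \<open>C\<close>
    sees the first \<open>m\<close> of them, the payoff sees their total.\<close>
  define F where "F x = f (bayes \<mu> (s + \<delta>) p (\<Sum>j<Suc m. x j)) * indicator C (restrict x {..<m})" for x
  have [measurable]: "F \<in> borel_measurable (PiM {..<Suc m} (\<lambda>_. borel))"
  proof -
    have [measurable]: "(\<lambda>x. restrict x {..<m}) \<in> PiM {..<Suc m} (\<lambda>_. borel :: real measure) \<rightarrow>\<^sub>M PiM {..<m} (\<lambda>_. borel)"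
      by (rule measurable_restrict_subset) auto
    show ?thesis unfolding F_def[abs_def] by measurable
  qed
  have ins: "{..<Suc m} = insert m {..<m}" by auto
  interpret PS: product_sigma_finite "\<lambda>j. gauss (t (Suc j) - t j)"
    using t_Suc[OF t(1,2)]
    by (auto simp: product_sigma_finite_def intro!: prob_space_imp_sigma_finite prob_space_gauss)
  have Gm: "G t m = PiM {..<m} (\<lambda>j. gauss (t (Suc j) - t j))"
    and GSm: "G t (Suc m) = PiM (insert m {..<m}) (\<lambda>j. gauss (t (Suc j) - t j))"
    by (simp_all add: G_def[OF t(1,2)] ins)
  have "(\<integral>\<^sup>+\<omega>. f (bayes \<mu> (s + \<delta>) p (X (s + \<delta>) \<omega>)) * indicator A \<omega> \<partial>M) =
      (\<integral>\<^sup>+\<omega>. F (?I' \<omega>) \<partial>M)"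
  proof (intro nn_integral_cong_AE, use AC X_0 in eventually_elim)
    case (elim \<omega>)
    have "restrict (?I' \<omega>) {..<m} = ?I \<omega>" by (auto simp: increments_def fun_eq_iff)
    then show ?case
      using elim sum_increments[OF t(1,2) elim(2), of "Suc m" "Suc m"] t(4)
      by (auto simp: F_def indicator_def)
  qed
  also have "\<dots> = (\<integral>\<^sup>+x. F x * ennreal (evidence \<mu> (s + \<delta>) p (\<Sum>j<Suc m. x j)) \<partial>G t (Suc m))"
    using nn_integral_increments[OF t(1,2), of F "Suc m"] by (simp add: t(4))
  also have "\<dots> = (\<integral>\<^sup>+x. \<integral>\<^sup>+y. F (x(m := y)) * ennreal (evidence \<mu> (s + \<delta>) p (\<Sum>j<Suc m. (x(m := y)) j))
      \<partial>gauss \<delta> \<partial>G t m)"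
  proof -
    have "(\<lambda>x. F x * ennreal (evidence \<mu> (s + \<delta>) p (\<Sum>j<Suc m. x j))) \<in> borel_measurable (G t (Suc m))"
      by measurable
    then show ?thesis unfolding GSm Gm
      by (subst PS.product_nn_integral_insert) (simp_all add: t(3,4))
  qed
  also have "\<dots> = (\<integral>\<^sup>+x. bayes_step \<mu> \<delta> f (bayes \<mu> (t m) p (\<Sum>j<m. x j)) * indicator C x *
      ennreal (evidence \<mu> (t m) p (\<Sum>j<m. x j)) \<partial>G t m)"
  proof (intro nn_integral_cong)
    fix x assume "x \<in> space (G t m)"
    then have x: "restrict (x(m := y)) {..<m} = x" for y
      unfolding Gm space_PiM by (auto simp: restrict_def fun_eq_iff PiE_def extensional_def)
    let ?S = "\<Sum>j<m. x j"
    let ?q = "bayes \<mu> s p ?S"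
    have S: "(\<Sum>j<Suc m. (x(m := y)) j) = ?S + y" for y by simp
    have "(\<integral>\<^sup>+y. F (x(m := y)) * ennreal (evidence \<mu> (s + \<delta>) p (\<Sum>j<Suc m. (x(m := y)) j)) \<partial>gauss \<delta>) =
      (\<integral>\<^sup>+y. indicator C x * ennreal (evidence \<mu> s p ?S) *
        (f (bayes \<mu> \<delta> ?q y) * ennreal (evidence \<mu> \<delta> ?q y)) \<partial>gauss \<delta>)"
      unfolding F_def x S bayes_add[OF p_unit] evidence_add[OF p_unit]
      using evidence_pos[OF p_unit, of \<mu> s ?S]
      by (intro nn_integral_cong) (simp add: ennreal_mult' mult_ac)
    also have "\<dots> = indicator C x * ennreal (evidence \<mu> s p ?S) * bayes_step \<mu> \<delta> f ?q"
      unfolding bayes_step_def by (rule nn_integral_cmult) measurable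
    finally show "(\<integral>\<^sup>+y. F (x(m := y)) * ennreal (evidence \<mu> (s + \<delta>) p (\<Sum>j<Suc m. (x(m := y)) j)) \<partial>gauss \<delta>) =
      bayes_step \<mu> \<delta> f (bayes \<mu> (t m) p ?S) * indicator C x * ennreal (evidence \<mu> (t m) p ?S)"
      by (simp add: t(3) mult_ac)
  qed
  also have "\<dots> = (\<integral>\<^sup>+\<omega>. bayes_step \<mu> \<delta> f (bayes \<mu> (t m) p (\<Sum>j<m. ?I \<omega> j)) * indicator C (?I \<omega>) \<partial>M)"
    by (subst nn_integral_increments[OF t(1,2)]) auto
  also have "\<dots> = (\<integral>\<^sup>+\<omega>. bayes_step \<mu> \<delta> f (bayes \<mu> s p (X s \<omega>)) * indicator A \<omega> \<partial>M)"
  proof (intro nn_integral_cong_AE, use AC X_0 in eventually_elim)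
    case (elim \<omega>)
    show ?case
      using sum_increments[OF t(1,2) elim(2), of m m] elim(1) by (simp add: t(3) indicator_def)
  qed
  finally show ?thesis .
qed

end

section \<open>Independence of the coordinates\<close>

lemma borel_measurable_vec_nth [measurable (raw)]:
  fixes f :: "'a \<Rightarrow> real^'n::finite"
  assumes "f \<in> borel_measurable M"
  shows "(\<lambda>x. f x $ i) \<in> borel_measurable M"
  by (rule measurable_compose[OF assms borel_measurable_continuous_onI])
     (intro continuous_on_component continuous_on_id)

lemma borel_measurable_vecI:
  fixes f :: "'a \<Rightarrow> real^'n::finite"
  assumes "\<And>i. (\<lambda>x. f x $ i) \<in> borel_measurable M"
  shows "f \<in> borel_measurable M"
proof (rule borel_measurable_euclidean_space[THEN iffD2], rule ballI)
  fix b :: "real^'n" assume "b \<in> Basis"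
  then obtain i where b: "b = axis i 1" using axis_inverse by blast
  have eq: "f x \<bullet> b = f x $ i" for x
    unfolding b inner_axis by simp
  show "(\<lambda>x. f x \<bullet> b) \<in> borel_measurable M"
    unfolding eq by (rule assms)
qed

lemma borel_measurable_vec_lambda [measurable (raw)]:
  assumes "\<And>i. g i \<in> borel_measurable M"
  shows "(\<lambda>x. (\<chi> i. g i x) :: real^'n::finite) \<in> borel_measurable M"
  by (rule borel_measurable_vecI) (simp add: assms)

text \<open>Given the past, the coordinates of the posterior move independently, so the weights of
  the one-dimensional kernels multiply.\<close>

definition belief_step :: "real \<Rightarrow> real \<Rightarrow> (real^'n::finite \<Rightarrow> ennreal) \<Rightarrow> real^'n \<Rightarrow> ennreal" where
  "belief_step \<mu> \<delta> f p = (\<integral>\<^sup>+z. f (\<chi> i. bayes \<mu> \<delta> (p $ i) (z i)) *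
     (\<Prod>i\<in>UNIV. ennreal (evidence \<mu> \<delta> (p $ i) (z i))) \<partial>PiM UNIV (\<lambda>_. gauss \<delta>))"

lemma product_sigma_finite_gauss: "\<delta> > 0 \<Longrightarrow> product_sigma_finite (\<lambda>_. gauss \<delta>)"
  by (auto simp: product_sigma_finite_def intro!: prob_space_imp_sigma_finite prob_space_gauss)

lemma sets_PiM_gauss [measurable_cong]: "sets (PiM I (\<lambda>_. gauss \<delta>)) = sets (PiM I (\<lambda>_. borel))"
  by (intro sets_PiM_cong) auto

lemma sigma_finite_PiM_gauss:
  assumes "\<delta> > 0"
  shows "sigma_finite_measure (PiM (UNIV :: 'n::finite set) (\<lambda>_. gauss \<delta>))"
proof -
  interpret product_sigma_finite "\<lambda>_::'n. gauss \<delta>" by (rule product_sigma_finite_gauss) fact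
  show ?thesis by (rule sigma_finite) simp
qed

lemma measurable_belief_step [measurable]:
  fixes f :: "real^'n::finite \<Rightarrow> ennreal"
  assumes "\<delta> > 0" and [measurable]: "f \<in> borel_measurable borel"
  shows "belief_step \<mu> \<delta> f \<in> borel_measurable borel"
proof -
  interpret sigma_finite_measure "PiM (UNIV :: 'n set) (\<lambda>_. gauss \<delta>)"
    by (rule sigma_finite_PiM_gauss) fact
  show ?thesis unfolding belief_step_def[abs_def] by measurable
qed

lemma prior_cubeD: "\<pi> \<in> prior_cube \<Longrightarrow> \<pi> $ i \<in> {0..1}"
  by (simp add: prior_cube_def)

lemma closed_prior_cube: "closed (prior_cube :: (real^'n::finite) set)"
proof -
  have *: "prior_cube = (\<Inter>i. {\<pi> :: real^'n. 0 \<le> \<pi> $ i} \<inter> {\<pi>. \<pi> $ i \<le> 1})"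
    by (auto simp: prior_cube_def)
  show ?thesis
    unfolding * by (intro closed_INT ballI closed_Int closed_Collect_le continuous_on_const
      continuous_on_component continuous_on_id)
qed

lemma measurable_prior_cube [measurable]: "(prior_cube :: (real^'n::finite) set) \<in> sets borel"
  using closed_prior_cube by (rule borel_closed)

context sequential_testing
begin

definition observation_cylinders :: "real \<Rightarrow> 'a set set" where
  "observation_cylinders T = {{\<omega> \<in> space S. \<forall>s\<in>J. \<forall>i. observation \<mu> Y W s \<omega> $ i \<in> D s i} | J D.
     finite J \<and> J \<subseteq> {0..T} \<and> (\<forall>s i. D s i \<in> sets (borel :: real measure))}"

text \<open>Signal and noise of coordinate \<open>i\<close> together. These sigma-algebras are
  independent for different \<open>i\<close>, and the \<open>i\<close>-th coordinate of the
  observation is measurable for the \<open>i\<close>-th one.\<close>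

definition coordinate_sigma :: "'n \<Rightarrow> 'a measure" where
  "coordinate_sigma i = sigma (space S)
     (sets (vimage_algebra (space S) (Y i) borel) \<union> sets (process_sigma (space S) (W i) {0..}))"

lemma space_coordinate_sigma [simp]: "space (coordinate_sigma i) = space S"
  by (simp add: coordinate_sigma_def space_measure_of_conv)

lemma sets_coordinate_sigma: "sets (coordinate_sigma i) = sigma_sets (space S)
     (sets (vimage_algebra (space S) (Y i) borel) \<union> sets (process_sigma (space S) (W i) {0..}))"
proof -
  have "sets (vimage_algebra (space S) (Y i) borel) \<subseteq> Pow (space S)"
    using sets.sets_into_space by fastforce
  moreover have "sets (process_sigma (space S) (W i) {0..}) \<subseteq> Pow (space S)"
    using sets.sets_into_space by fastforce
  ultimately show ?thesis unfolding coordinate_sigma_def by (intro sets_measure_of) auto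
qed

lemma measurable_coordinate_Y: "Y i \<in> borel_measurable (coordinate_sigma i)"
proof (rule measurableI)
  fix A :: "real set" assume A: "A \<in> sets borel"
  show "Y i -` A \<inter> space (coordinate_sigma i) \<in> sets (coordinate_sigma i)"
    unfolding sets_coordinate_sigma using in_vimage_algebra[OF A, of "Y i" "space S"]
    by (auto intro: sigma_sets.Basic)
qed simp

lemma measurable_coordinate_W: "t \<ge> 0 \<Longrightarrow> W i t \<in> borel_measurable (coordinate_sigma i)"
proof (rule measurableI)
  fix A :: "real set" assume A: "A \<in> sets borel" and "t \<ge> 0"
  then have "W i t \<in> borel_measurable (process_sigma (space S) (W i) {0..})"
    by (intro process_sigma_measurable) auto
  from measurable_sets[OF this A] show "W i t -` A \<inter> space (coordinate_sigma i) \<in> sets (coordinate_sigma i)"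
    unfolding sets_coordinate_sigma by (auto intro: sigma_sets.Basic)
qed simp

lemma measurable_coordinate_observation:
  assumes "t \<ge> 0"
  shows "(\<lambda>\<omega>. observation \<mu> Y W t \<omega> $ i) \<in> borel_measurable (coordinate_sigma i)"
proof -
  note [measurable] = measurable_coordinate_Y measurable_coordinate_W[OF assms]
  show ?thesis by (simp add: observation_def)
qed

lemma space_FX [simp]: "space (FX t) = space S"
  by (simp add: natural_filtration_def)

lemma FX_eq: "0 \<le> t \<Longrightarrow> FX (ennreal t) = process_sigma (space S) (observation \<mu> Y W) {0..t}"
  unfolding natural_filtration_def by (rule arg_cong[where f="process_sigma _ _"]) auto

lemma sets_FX_mono: "s \<le> t \<Longrightarrow> sets (FX s) \<subseteq> sets (FX t)"
  unfolding natural_filtration_def sets_process_sigma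
  by (intro sigma_sets_mono') (auto intro: order_trans)

lemma observation_cylinders_Pow: "observation_cylinders T \<subseteq> Pow (space S)"
  by (auto simp: observation_cylinders_def)

lemma Int_stable_observation_cylinders: "Int_stable (observation_cylinders T)"
proof (rule Int_stableI)
  fix A A' assume "A \<in> observation_cylinders T" "A' \<in> observation_cylinders T"
  then obtain J D J' D' where
    A: "A = {\<omega> \<in> space S. \<forall>s\<in>J. \<forall>i. observation \<mu> Y W s \<omega> $ i \<in> D s i}"
    and J: "finite J" "J \<subseteq> {0..T}" "\<And>s i. D s i \<in> sets borel"
    and A': "A' = {\<omega> \<in> space S. \<forall>s\<in>J'. \<forall>i. observation \<mu> Y W s \<omega> $ i \<in> D' s i}"
    and J': "finite J'" "J' \<subseteq> {0..T}" "\<And>s i. D' s i \<in> sets borel"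
    unfolding observation_cylinders_def by blast
  define E where "E s i = (if s \<in> J then D s i else UNIV) \<inter> (if s \<in> J' then D' s i else UNIV)" for s i
  have "A \<inter> A' = {\<omega> \<in> space S. \<forall>s\<in>J \<union> J'. \<forall>i. observation \<mu> Y W s \<omega> $ i \<in> E s i}"
    unfolding A A' E_def by auto
  moreover have "finite (J \<union> J')" "J \<union> J' \<subseteq> {0..T}" "\<forall>s i. E s i \<in> sets borel"
    using J J' by (auto simp: E_def)
  ultimately show "A \<inter> A' \<in> observation_cylinders T"
    unfolding observation_cylinders_def by blast
qed

text \<open>Boxes generate the Borel sets of the vector-valued observation. This yields a generator
  that is stable under intersection and whose events factor over the coordinates.\<close>

lemma sets_FX:
  assumes "0 \<le> T"
  shows "sets (FX (ennreal T)) = sigma_sets (space S) (observation_cylinders T)"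
proof
  let ?N = "sigma (space S) (observation_cylinders T)"
  have N: "sets ?N = sigma_sets (space S) (observation_cylinders T)" "space ?N = space S"
    using observation_cylinders_Pow by (simp_all add: space_measure_of_conv)
  have meas: "observation \<mu> Y W s \<in> borel_measurable ?N" if s: "s \<in> {0..T}" for s
  proof (rule borel_measurable_vecI, rule measurableI)
    fix i and B :: "real set" assume B: "B \<in> sets borel"
    have "(\<lambda>\<omega>. observation \<mu> Y W s \<omega> $ i) -` B \<inter> space ?N =
      {\<omega> \<in> space S. \<forall>s\<in>{s}. \<forall>j. observation \<mu> Y W s \<omega> $ j \<in> (if j = i then B else UNIV)}"
      unfolding N by auto
    also have "\<dots> \<in> observation_cylinders T"
      unfolding observation_cylinders_def using B s
      by (intro CollectI exI[of _ "{s}"] exI[of _ "\<lambda>_ j. if j = i then B else UNIV"]) auto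
    finally show "(\<lambda>\<omega>. observation \<mu> Y W s \<omega> $ i) -` B \<inter> space ?N \<in> sets ?N"
      unfolding N by (rule sigma_sets.Basic)
  qed simp
  show "sets (FX (ennreal T)) \<subseteq> sigma_sets (space S) (observation_cylinders T)"
    unfolding FX_eq[OF assms] sets_process_sigma
  proof (rule sigma_sets_mono, safe)
    fix s and B :: "(real^'n) set" assume "s \<in> {0..T}" "B \<in> sets borel"
    then show "observation \<mu> Y W s -` B \<inter> space S \<in> sigma_sets (space S) (observation_cylinders T)"
      using measurable_sets[OF meas, of s B] N by simp
  qed
  show "sigma_sets (space S) (observation_cylinders T) \<subseteq> sets (FX (ennreal T))"
  proof -
    have "observation_cylinders T \<subseteq> sets (FX (ennreal T))"
    proof
      fix A assume "A \<in> observation_cylinders T"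
      then obtain J D where
        A: "A = {\<omega> \<in> space S. \<forall>s\<in>J. \<forall>i. observation \<mu> Y W s \<omega> $ i \<in> D s i}"
        and J: "finite J" "J \<subseteq> {0..T}" and D [measurable]: "\<And>s i. D s i \<in> sets borel"
        unfolding observation_cylinders_def by blast
      have "A = {\<omega> \<in> space (FX (ennreal T)). \<forall>s\<in>J. \<forall>i. observation \<mu> Y W s \<omega> $ i \<in> D s i}"
        unfolding A by simp
      also have "\<dots> \<in> sets (FX (ennreal T))"
      proof (rule sets.sets_Collect_finite_All[OF _ J(1)])
        fix s assume "s \<in> J"
        then have [measurable]: "observation \<mu> Y W s \<in> borel_measurable (FX (ennreal T))"
          unfolding FX_eq[OF assms] using J by (intro process_sigma_measurable) auto
        show "{\<omega> \<in> space (FX (ennreal T)). \<forall>i. observation \<mu> Y W s \<omega> $ i \<in> D s i} \<in> sets (FX (ennreal T))"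
          by measurable
      qed
      finally show "A \<in> sets (FX (ennreal T))" .
    qed
    then show ?thesis using sets.sigma_sets_subset[of _ "FX (ennreal T)"] by simp
  qed
qed

text \<open>The explicit version of the posterior; \<open>post\<close> itself is given only as a
  continuous version of conditional expectations.\<close>

definition filter_process :: "real^'n \<Rightarrow> real \<Rightarrow> 'a \<Rightarrow> real^'n" where
  "filter_process \<pi> t \<omega> = (\<chi> i. bayes \<mu> t (\<pi> $ i) (observation \<mu> Y W t \<omega> $ i))"

context
  fixes \<pi> :: "real^'n" assumes \<pi>: "\<pi> \<in> prior_cube"
begin

lemma space_P: "space (P \<pi>) = space S"
  using sets_P[OF \<pi>] by (rule sets_eq_imp_space_eq)

interpretation prob_space "P \<pi>" by (rule prob_space_P[OF \<pi>])

lemma measurable_W: "t \<ge> 0 \<Longrightarrow> W i t \<in> borel_measurable (P \<pi>)"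
  using W_brownian[OF \<pi>] by (rule standard_brownian_motion_measurable)

lemma measurable_observation: "t \<ge> 0 \<Longrightarrow> observation \<mu> Y W t \<in> borel_measurable (P \<pi>)"
proof (rule borel_measurable_vecI)
  fix i assume "t \<ge> 0"
  note [measurable] = measurable_W[OF this] Y_measurable
  have [measurable_cong]: "sets (P \<pi>) = sets S" by (rule sets_P[OF \<pi>])
  show "(\<lambda>\<omega>. observation \<mu> Y W t \<omega> $ i) \<in> borel_measurable (P \<pi>)"
    by (simp add: observation_def)
qed

lemma sets_FX_subset: "sets (FX t) \<subseteq> sets (P \<pi>)"
  unfolding natural_filtration_def sets_process_sigma space_P[symmetric]
  using measurable_observation by (intro sets.sigma_sets_subset) (auto intro!: measurable_sets)

lemma subalgebra_FX: "subalgebra (P \<pi>) (FX t)"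
  using sets_FX_subset by (simp add: subalgebra_def space_P)

lemma noisy_drift_coordinate: "noisy_drift (P \<pi>) (\<pi> $ i) (Y i) (W i)"
proof (intro noisy_drift.intro noisy_drift_axioms.intro)
  show "prob_space (P \<pi>)" by (rule prob_space_P[OF \<pi>])
  show "standard_brownian_motion (P \<pi>) (W i)" by (rule W_brownian[OF \<pi>])
  show "Y i \<omega> \<in> {0, 1}" if "\<omega> \<in> space (P \<pi>)" for \<omega>
    using Y_values that unfolding space_P .
  show "prob {\<omega> \<in> space (P \<pi>). Y i \<omega> = 1} = \<pi> $ i"
    unfolding space_P by (rule Y_prior[OF \<pi>])
  show "Y i \<in> borel_measurable (P \<pi>)" using Y_measurable sets_P[OF \<pi>] by simp
  let ?E = "case_sum (\<lambda>i. sets (vimage_algebra (space S) (Y i) borel))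
                  (\<lambda>i. sets (process_sigma (space S) (W i) {0..}))"
  have E: "indep_sets ?E UNIV" by (rule independent[OF \<pi>])
  show "indep_set (sets (vimage_algebra (space (P \<pi>)) (Y i) borel))
      (sets (process_sigma (space (P \<pi>)) (W i) {0..}))"
    unfolding space_P
  proof (rule indep_setI)
    have "?E j \<subseteq> events" for j using E by (auto simp: indep_sets_def)
    from this[of "Inl i"] this[of "Inr i"] show
      "sets (vimage_algebra (space S) (Y i) borel) \<subseteq> events"
      "sets (process_sigma (space S) (W i) {0..}) \<subseteq> events"
      by simp_all
    fix a b assume "a \<in> sets (vimage_algebra (space S) (Y i) borel)"
      "b \<in> sets (process_sigma (space S) (W i) {0..})"
    then show "prob (a \<inter> b) = prob a * prob b"
      using indep_setsD[OF E, of "{Inl i, Inr i}" "case_sum (\<lambda>_. a) (\<lambda>_. b)"] by simp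
  qed
qed

lemma observation_coordinate:
  "observation \<mu> Y W t \<omega> $ i = noisy_drift.X \<mu> (Y i) (W i) t \<omega>"
  by (simp add: noisy_drift.X_def[OF noisy_drift_coordinate] observation_def)

text \<open>Independence is assumed for a family over a sum type, signals on the left and noises on
  the right. Grouping \<open>Inl i\<close> with \<open>Inr i\<close> makes the sigma-algebras
  \<open>coordinate_sigma i\<close> independent.\<close>

lemma nn_integral_prod_coordinates:
  fixes Z :: "'n \<Rightarrow> 'a \<Rightarrow> ennreal"
  assumes Z: "\<And>i. Z i \<in> borel_measurable (coordinate_sigma i)"
  shows "(\<integral>\<^sup>+\<omega>. (\<Prod>i\<in>UNIV. Z i \<omega>) \<partial>P \<pi>) = (\<Prod>i\<in>UNIV. \<integral>\<^sup>+\<omega>. Z i \<omega> \<partial>P \<pi>)"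
proof (rule indep_vars_nn_integral)
  let ?E = "case_sum (\<lambda>i. sets (vimage_algebra (space S) (Y i) borel))
                  (\<lambda>i. sets (process_sigma (space S) (W i) {0..}))"
  have "indep_sets (\<lambda>i. sigma_sets (space (P \<pi>)) (\<Union>j\<in>{Inl i, Inr i}. ?E j)) (UNIV :: 'n set)"
  proof (rule indep_sets_collect_sigma)
    show "indep_sets ?E (\<Union>i\<in>UNIV. {Inl i, Inr i})"
      using independent[OF \<pi>] by (rule indep_sets_mono_index[rotated]) auto
    show "Int_stable (?E j)" if "j \<in> {Inl i, Inr i}" for i j
      using that by (auto simp: Int_stable_def)
  qed (auto simp: disjoint_family_on_def)
  then have indep: "indep_sets (\<lambda>i. sets (coordinate_sigma i)) UNIV"
    by (simp add: sets_coordinate_sigma space_P)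
  then have sub: "sets (coordinate_sigma i) \<subseteq> events" for i by (auto simp: indep_sets_def)
  show "indep_vars (\<lambda>_. borel) Z UNIV"
    unfolding indep_vars_def2
  proof safe
    show "Z i \<in> borel_measurable (P \<pi>)" for i
      using Z[of i] sub[of i] by (auto simp: measurable_def space_P)
    show "indep_sets (\<lambda>i. {Z i -` A \<inter> space (P \<pi>) |A. A \<in> sets borel}) UNIV"
      using indep
    proof (rule indep_sets_mono_sets, safe)
      fix i and A :: "ennreal set" assume "A \<in> sets borel"
      from measurable_sets[OF Z this] show "Z i -` A \<inter> space (P \<pi>) \<in> sets (coordinate_sigma i)"
        by (simp add: space_P)
    qed
  qed
qed auto

text \<open>Uniqueness of finite measures on an intersection-stable generator, applied to the
  measures with densities \<open>f\<close> and \<open>g\<close> restricted to the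
  filtration.\<close>

lemma nn_integral_FX_eqI:
  assumes "0 \<le> T" and [measurable]: "f \<in> borel_measurable (P \<pi>)" "g \<in> borel_measurable (P \<pi>)"
    and fin: "(\<integral>\<^sup>+\<omega>. f \<omega> \<partial>P \<pi>) \<noteq> \<infinity>"
    and eq: "\<And>A. A \<in> observation_cylinders T \<Longrightarrow>
      (\<integral>\<^sup>+\<omega>. f \<omega> * indicator A \<omega> \<partial>P \<pi>) = (\<integral>\<^sup>+\<omega>. g \<omega> * indicator A \<omega> \<partial>P \<pi>)"
    and A: "A \<in> sets (FX (ennreal T))"
  shows "(\<integral>\<^sup>+\<omega>. f \<omega> * indicator A \<omega> \<partial>P \<pi>) = (\<integral>\<^sup>+\<omega>. g \<omega> * indicator A \<omega> \<partial>P \<pi>)"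
proof -
  let ?F = "FX (ennreal T)"
  let ?R = "\<lambda>h. restr_to_subalg (density (P \<pi>) h) ?F"
  have sub: "subalgebra (density (P \<pi>) h) ?F" for h
    using sets_FX_subset by (simp add: subalgebra_def space_P)
  have cyl: "B \<in> sets ?F" if "B \<in> observation_cylinders T" for B
    unfolding sets_FX[OF assms(1)] using that by (rule sigma_sets.Basic)
  have em: "emeasure (?R h) B = (\<integral>\<^sup>+\<omega>. h \<omega> * indicator B \<omega> \<partial>P \<pi>)"
    if "h \<in> borel_measurable (P \<pi>)" "B \<in> sets ?F" for h B
  proof -
    have "B \<in> events" using that(2) sets_FX_subset by auto
    then show ?thesis
      using that by (simp add: emeasure_restr_to_subalg[OF sub] emeasure_density)
  qed
  have UN: "space S \<in> observation_cylinders T"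
    unfolding observation_cylinders_def by (intro CollectI exI[of _ "{}"] exI[of _ "\<lambda>_ _. UNIV"]) auto
  have "?R f = ?R g"
  proof (rule measure_eqI_generator_eq[where E="observation_cylinders T" and \<Omega>="space S" and A="\<lambda>_. space S"])
    show "emeasure (?R f) X = emeasure (?R g) X" if "X \<in> observation_cylinders T" for X
      using eq[OF that] cyl[OF that] by (simp add: em)
    show "emeasure (?R f) (space S) \<noteq> \<infinity>"
    proof -
      have "emeasure (?R f) (space S) = (\<integral>\<^sup>+\<omega>. f \<omega> * indicator (space S) \<omega> \<partial>P \<pi>)"
        using cyl[OF UN] by (simp add: em)
      also have "\<dots> = (\<integral>\<^sup>+\<omega>. f \<omega> \<partial>P \<pi>)"
        by (intro nn_integral_cong) (simp add: space_P)
      finally show ?thesis using fin by simp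
    qed
    show "sets (?R f) = sigma_sets (space S) (observation_cylinders T)"
      "sets (?R g) = sigma_sets (space S) (observation_cylinders T)"
      by (simp_all only: sets_restr_to_subalg[OF sub] sets_FX[OF assms(1)])
  qed (use UN in \<open>simp_all add: Int_stable_observation_cylinders observation_cylinders_Pow\<close>)
  then show ?thesis using em[OF assms(2) A] em[OF assms(3) A] by simp
qed

end

end

section \<open>The posterior process\<close>

context sequential_testing
begin

lemma filter_process_nth: "filter_process \<pi> t \<omega> $ i = bayes \<mu> t (\<pi> $ i) (observation \<mu> Y W t \<omega> $ i)"
  by (simp add: filter_process_def)

lemma filter_process_in_cube: "\<pi> \<in> prior_cube \<Longrightarrow> filter_process \<pi> t \<omega> \<in> prior_cube"
  using bayes_in_unit[OF prior_cubeD, of \<pi>]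
  by (subst prior_cube_def) (simp add: filter_process_nth)

lemma measurable_filter_process_FX:
  assumes "0 \<le> t"
  shows "filter_process \<pi> t \<in> borel_measurable (FX (ennreal t))"
proof -
  have [measurable]: "observation \<mu> Y W t \<in> borel_measurable (FX (ennreal t))"
    unfolding FX_eq[OF assms] using assms by (intro process_sigma_measurable) simp
  show ?thesis unfolding filter_process_def[abs_def] by measurable
qed

lemma measurable_coordinate_filter_process:
  assumes "0 \<le> t"
  shows "(\<lambda>\<omega>. filter_process \<pi> t \<omega> $ i) \<in> borel_measurable (coordinate_sigma i)"
proof -
  note [measurable] = measurable_coordinate_observation[OF assms]
  show ?thesis unfolding filter_process_nth by measurable
qed

context
  fixes \<pi> :: "real^'n" assumes \<pi>: "\<pi> \<in> prior_cube"
begin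

interpretation prob_space "P \<pi>" by (rule prob_space_P[OF \<pi>])

lemma measurable_FX_P: "f \<in> borel_measurable (FX t) \<Longrightarrow> f \<in> borel_measurable (P \<pi>)"
  by (rule measurable_from_subalg[OF subalgebra_FX[OF \<pi>]])

lemma measurable_filter_process: "0 \<le> t \<Longrightarrow> filter_process \<pi> t \<in> borel_measurable (P \<pi>)"
  by (rule measurable_FX_P[OF measurable_filter_process_FX])

lemma sets_coordinate_sigma_subset: "sets (coordinate_sigma i) \<subseteq> events"
proof -
  note indep = noisy_drift.Y_B_indep[OF noisy_drift_coordinate[OF \<pi>, of i]]
  show ?thesis
    unfolding sets_coordinate_sigma using indep_setD_ev1[OF indep] indep_setD_ev2[OF indep]
    by (subst space_P[OF \<pi>, symmetric], intro sets.sigma_sets_subset) (simp add: space_P[OF \<pi>])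
qed

lemma measurable_coordinate_P: "f \<in> borel_measurable (coordinate_sigma i) \<Longrightarrow> f \<in> borel_measurable (P \<pi>)"
  by (rule measurable_from_subalg[of "P \<pi>" "coordinate_sigma i"])
     (use sets_coordinate_sigma_subset[of i] in \<open>simp_all add: subalgebra_def space_P[OF \<pi>]\<close>)

text \<open>The coordinates are independent, so identities that hold on each of them multiply up.\<close>

lemma nn_integral_coordinatewise:
  fixes Z Z' :: "'n \<Rightarrow> 'a \<Rightarrow> ennreal"
  assumes "0 \<le> T" and Z: "\<And>i. Z i \<in> borel_measurable (coordinate_sigma i)"
    and Z': "\<And>i. Z' i \<in> borel_measurable (coordinate_sigma i)"
    and le: "\<And>i \<omega>. \<omega> \<in> space S \<Longrightarrow> Z i \<omega> \<le> 1"
    and eq: "\<And>i J D. finite J \<Longrightarrow> J \<subseteq> {0..T} \<Longrightarrow> (\<And>s. D s \<in> sets borel) \<Longrightarrow>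
      (\<integral>\<^sup>+\<omega>. Z i \<omega> * indicator {\<omega> \<in> space S. \<forall>s\<in>J. observation \<mu> Y W s \<omega> $ i \<in> D s} \<omega> \<partial>P \<pi>) =
      (\<integral>\<^sup>+\<omega>. Z' i \<omega> * indicator {\<omega> \<in> space S. \<forall>s\<in>J. observation \<mu> Y W s \<omega> $ i \<in> D s} \<omega> \<partial>P \<pi>)"
    and A: "A \<in> sets (FX (ennreal T))"
  shows "(\<integral>\<^sup>+\<omega>. (\<Prod>i\<in>UNIV. Z i \<omega>) * indicator A \<omega> \<partial>P \<pi>) = (\<integral>\<^sup>+\<omega>. (\<Prod>i\<in>UNIV. Z' i \<omega>) * indicator A \<omega> \<partial>P \<pi>)"
  using \<open>0 \<le> T\<close> _ _ _ _ A
proof (rule nn_integral_FX_eqI[OF \<pi>])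
  note [measurable] = measurable_coordinate_P[OF Z] measurable_coordinate_P[OF Z']
  show "(\<lambda>\<omega>. \<Prod>i\<in>UNIV. Z i \<omega>) \<in> borel_measurable (P \<pi>)" "(\<lambda>\<omega>. \<Prod>i\<in>UNIV. Z' i \<omega>) \<in> borel_measurable (P \<pi>)"
    by measurable
  have "(\<integral>\<^sup>+\<omega>. (\<Prod>i\<in>UNIV. Z i \<omega>) \<partial>P \<pi>) \<le> (\<integral>\<^sup>+\<omega>. 1 \<partial>P \<pi>)"
  proof (rule nn_integral_mono)
    fix \<omega> assume "\<omega> \<in> space (P \<pi>)"
    then have le': "Z i \<omega> \<le> 1" for i using le by (simp add: space_P[OF \<pi>])
    have "(\<Prod>i\<in>I. Z i \<omega>) \<le> 1" if "finite I" for I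
      using that
    proof (induction I)
      case (insert i I)
      then show ?case using mult_mono[OF le'[of i] insert.IH] by simp
    qed simp
    then show "(\<Prod>i\<in>UNIV. Z i \<omega>) \<le> 1" by simp
  qed
  then show "(\<integral>\<^sup>+\<omega>. (\<Prod>i\<in>UNIV. Z i \<omega>) \<partial>P \<pi>) \<noteq> \<infinity>"
    by (auto simp: emeasure_space_1 top_unique)
  fix B assume "B \<in> observation_cylinders T"
  then obtain J D where
    B: "B = {\<omega> \<in> space S. \<forall>s\<in>J. \<forall>i. observation \<mu> Y W s \<omega> $ i \<in> D s i}"
    and J: "finite J" "J \<subseteq> {0..T}" and D: "\<And>s i. D s i \<in> sets borel"
    unfolding observation_cylinders_def by blast
  \<comment> \<open>A cylinder is an intersection of events \<open>Bi i\<close>, one per coordinate,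
    so its indicator is a product and independence applies.\<close>
  define Bi where "Bi i = {\<omega> \<in> space S. \<forall>s\<in>J. observation \<mu> Y W s \<omega> $ i \<in> D s i}" for i
  have ind: "indicator B \<omega> = (\<Prod>i\<in>UNIV. indicator (Bi i) \<omega> :: ennreal)" if "\<omega> \<in> space (P \<pi>)" for \<omega>
  proof (cases "\<omega> \<in> B")
    case True
    then show ?thesis by (simp add: B Bi_def)
  next
    case False
    then obtain i where "\<omega> \<notin> Bi i" using that by (auto simp: B Bi_def space_P[OF \<pi>])
    then have "(\<Prod>i\<in>UNIV. indicator (Bi i) \<omega> :: ennreal) = 0"
      by (intro prod_zero) (auto intro!: exI[of _ i])
    then show ?thesis using False by simp
  qed
  have Bi: "Bi i \<in> sets (coordinate_sigma i)" for i
  proof -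
    have "Bi i = {\<omega> \<in> space (coordinate_sigma i). \<forall>s\<in>J. observation \<mu> Y W s \<omega> $ i \<in> D s i}"
      by (simp add: Bi_def)
    also have "\<dots> \<in> sets (coordinate_sigma i)"
    proof (rule sets.sets_Collect_finite_All[OF _ J(1)])
      fix s assume "s \<in> J"
      then have [measurable]: "(\<lambda>\<omega>. observation \<mu> Y W s \<omega> $ i) \<in> borel_measurable (coordinate_sigma i)"
        using J by (intro measurable_coordinate_observation) auto
      note [measurable] = D
      show "{\<omega> \<in> space (coordinate_sigma i). observation \<mu> Y W s \<omega> $ i \<in> D s i} \<in> sets (coordinate_sigma i)"
        by measurable
    qed
    finally show ?thesis .
  qed
  have factor: "(\<integral>\<^sup>+\<omega>. (\<Prod>i\<in>UNIV. z i \<omega>) * indicator B \<omega> \<partial>P \<pi>) =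
      (\<Prod>i\<in>UNIV. \<integral>\<^sup>+\<omega>. z i \<omega> * indicator (Bi i) \<omega> \<partial>P \<pi>)"
    if z: "\<And>i. z i \<in> borel_measurable (coordinate_sigma i)" for z :: "'n \<Rightarrow> 'a \<Rightarrow> ennreal"
  proof -
    have "(\<integral>\<^sup>+\<omega>. (\<Prod>i\<in>UNIV. z i \<omega>) * indicator B \<omega> \<partial>P \<pi>) =
        (\<integral>\<^sup>+\<omega>. (\<Prod>i\<in>UNIV. z i \<omega> * indicator (Bi i) \<omega>) \<partial>P \<pi>)"
      by (intro nn_integral_cong) (simp add: ind prod.distrib)
    also have "\<dots> = (\<Prod>i\<in>UNIV. \<integral>\<^sup>+\<omega>. z i \<omega> * indicator (Bi i) \<omega> \<partial>P \<pi>)"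
      using Bi z by (intro nn_integral_prod_coordinates[OF \<pi>] borel_measurable_times_ennreal borel_measurable_indicator)
    finally show ?thesis .
  qed
  show "(\<integral>\<^sup>+\<omega>. (\<Prod>i\<in>UNIV. Z i \<omega>) * indicator B \<omega> \<partial>P \<pi>) = (\<integral>\<^sup>+\<omega>. (\<Prod>i\<in>UNIV. Z' i \<omega>) * indicator B \<omega> \<partial>P \<pi>)"
    unfolding factor[OF Z] factor[OF Z'] Bi_def using J D by (intro prod.cong refl eq)
qed

lemma posterior_coordinate:
  fixes i :: 'n
  assumes "finite J" "J \<subseteq> {0..T}" "0 \<le> T" "\<And>s. D s \<in> sets borel"
  defines "A \<equiv> {\<omega> \<in> space S. \<forall>s\<in>J. observation \<mu> Y W s \<omega> $ i \<in> D s}"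
  shows "(\<integral>\<^sup>+\<omega>. ennreal (Y i \<omega>) * indicator A \<omega> \<partial>P \<pi>) =
    (\<integral>\<^sup>+\<omega>. ennreal (filter_process \<pi> T \<omega> $ i) * indicator A \<omega> \<partial>P \<pi>)"
  using noisy_drift.posterior_on_cylinder[OF noisy_drift_coordinate[OF \<pi>, of i] assms(1-4), where \<mu>=\<mu>]
  unfolding A_def space_P[OF \<pi>] observation_coordinate[OF \<pi>, symmetric] filter_process_nth .

lemma markov_coordinate:
  fixes i :: 'n
  assumes "finite J" "J \<subseteq> {0..s}" "0 \<le> s" "\<delta> > 0" "\<And>r. D r \<in> sets borel" "f \<in> borel_measurable borel"
  defines "A \<equiv> {\<omega> \<in> space S. \<forall>r\<in>J. observation \<mu> Y W r \<omega> $ i \<in> D r}"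
  shows "(\<integral>\<^sup>+\<omega>. f (filter_process \<pi> (s + \<delta>) \<omega> $ i) * indicator A \<omega> \<partial>P \<pi>) =
    (\<integral>\<^sup>+\<omega>. bayes_step \<mu> \<delta> f (filter_process \<pi> s \<omega> $ i) * indicator A \<omega> \<partial>P \<pi>)"
  using noisy_drift.markov_on_cylinder[OF noisy_drift_coordinate[OF \<pi>, of i] assms(1-6), where \<mu>=\<mu>]
  unfolding A_def space_P[OF \<pi>] observation_coordinate[OF \<pi>, symmetric] filter_process_nth .

text \<open>Factor \<open>i\<close> is replaced and all other factors are the constant 1: observing
  the other coordinates does not alter the conditional law of \<open>Y i\<close>.\<close>

lemma nn_integral_Y_eq_filter_process:
  assumes "0 \<le> T" "A \<in> sets (FX (ennreal T))"
  shows "(\<integral>\<^sup>+\<omega>. ennreal (Y i \<omega>) * indicator A \<omega> \<partial>P \<pi>) =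
    (\<integral>\<^sup>+\<omega>. ennreal (filter_process \<pi> T \<omega> $ i) * indicator A \<omega> \<partial>P \<pi>)"
proof -
  define Z where "Z j \<omega> = (if j = i then ennreal (Y i \<omega>) else 1)" for j \<omega>
  define Z' where "Z' j \<omega> = (if j = i then ennreal (filter_process \<pi> T \<omega> $ i) else 1)" for j \<omega>
  have "(\<integral>\<^sup>+\<omega>. (\<Prod>j\<in>UNIV. Z j \<omega>) * indicator A \<omega> \<partial>P \<pi>) = (\<integral>\<^sup>+\<omega>. (\<Prod>j\<in>UNIV. Z' j \<omega>) * indicator A \<omega> \<partial>P \<pi>)"
  proof (rule nn_integral_coordinatewise[OF assms(1) _ _ _ _ assms(2)])
    show "Z j \<in> borel_measurable (coordinate_sigma j)" for j
      using measurable_coordinate_Y[of i] by (cases "j = i") (simp_all add: Z_def[abs_def])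
    show "Z' j \<in> borel_measurable (coordinate_sigma j)" for j
      using measurable_coordinate_filter_process[OF assms(1), of \<pi> i] by (cases "j = i") (simp_all add: Z'_def[abs_def])
    show "Z j \<omega> \<le> 1" if "\<omega> \<in> space S" for j \<omega>
      using Y_values[OF that, of i] by (auto simp: Z_def)
    fix j J and D :: "real \<Rightarrow> real set"
    assume J: "finite J" "J \<subseteq> {0..T}" "\<And>s. D s \<in> sets borel"
    show "(\<integral>\<^sup>+\<omega>. Z j \<omega> * indicator {\<omega> \<in> space S. \<forall>s\<in>J. observation \<mu> Y W s \<omega> $ j \<in> D s} \<omega> \<partial>P \<pi>) =
      (\<integral>\<^sup>+\<omega>. Z' j \<omega> * indicator {\<omega> \<in> space S. \<forall>s\<in>J. observation \<mu> Y W s \<omega> $ j \<in> D s} \<omega> \<partial>P \<pi>)"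
      using posterior_coordinate[OF J(1,2) assms(1) J(3), of i] by (cases "j = i") (simp_all add: Z_def Z'_def)
  qed
  then show ?thesis by (simp add: Z_def Z'_def)
qed

text \<open>Both sides are versions of the same conditional expectation. The exceptional null set
  depends on \<open>t\<close>; passing to random times is therefore done through grids and
  continuity.\<close>

lemma post_eq_filter_process:
  assumes "0 \<le> t"
  shows "AE \<omega> in P \<pi>. post \<pi> t \<omega> = filter_process \<pi> t \<omega>"
proof -
  have "AE \<omega> in P \<pi>. post \<pi> t \<omega> $ i = filter_process \<pi> t \<omega> $ i" for i
  proof -
    interpret finite_measure_subalgebra "P \<pi>" "FX (ennreal t)"
      by standard (rule subalgebra_FX[OF \<pi>])
    have Ym [measurable]: "Y i \<in> borel_measurable (P \<pi>)"
      using Y_measurable sets_P[OF \<pi>] by simp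
    have [measurable]: "(\<lambda>\<omega>. filter_process \<pi> t \<omega> $ i) \<in> borel_measurable (P \<pi>)"
      using measurable_filter_process[OF assms] by measurable
    have psi: "filter_process \<pi> t \<omega> $ i \<in> {0..1}" for \<omega>
      using filter_process_in_cube[OF \<pi>] by (rule prior_cubeD)
    have Yb: "Y i \<omega> \<in> {0..1}" if "\<omega> \<in> space (P \<pi>)" for \<omega>
      using Y_values[of \<omega> i] that by (auto simp: space_P[OF \<pi>])
    have "AE \<omega> in P \<pi>. real_cond_exp (P \<pi>) (FX (ennreal t)) (Y i) \<omega> = filter_process \<pi> t \<omega> $ i"
    proof (rule real_cond_exp_charact)
      show "(\<lambda>\<omega>. filter_process \<pi> t \<omega> $ i) \<in> borel_measurable (FX (ennreal t))"
        using measurable_filter_process_FX[OF assms] by measurable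
      show "integrable (P \<pi>) (Y i)" "integrable (P \<pi>) (\<lambda>\<omega>. filter_process \<pi> t \<omega> $ i)"
        using Yb psi by (auto intro!: integrable_const_bound[of _ 1])
      fix A assume A: "A \<in> sets (FX (ennreal t))"
      then have [measurable]: "A \<in> events" using sets_FX_subset[OF \<pi>] by auto
      have *: "(LINT \<omega>:A|P \<pi>. h \<omega>) = enn2real (\<integral>\<^sup>+\<omega>. ennreal (h \<omega>) * indicator A \<omega> \<partial>P \<pi>)"
        if "h \<in> borel_measurable (P \<pi>)" "\<And>\<omega>. \<omega> \<in> space (P \<pi>) \<Longrightarrow> h \<omega> \<ge> 0" for h :: "'a \<Rightarrow> real"
        unfolding set_lebesgue_integral_def using that
        by (subst integral_eq_nn_integral)
           (auto intro!: arg_cong[where f=enn2real] nn_integral_cong simp: indicator_def)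
      show "(LINT \<omega>:A|P \<pi>. Y i \<omega>) = (LINT \<omega>:A|P \<pi>. filter_process \<pi> t \<omega> $ i)"
        using nn_integral_Y_eq_filter_process[OF assms A, of i] Yb psi by (simp add: *)
    qed
    with post_posterior[OF \<pi> assms, of i] show ?thesis by eventually_elim simp
  qed
  then have "AE \<omega> in P \<pi>. \<forall>i. post \<pi> t \<omega> $ i = filter_process \<pi> t \<omega> $ i"
    by (simp add: AE_all_countable)
  then show ?thesis by eventually_elim (simp add: vec_eq_iff)
qed

lemma post_0: "AE \<omega> in P \<pi>. post \<pi> 0 \<omega> = \<pi>"
proof -
  have "AE \<omega> in P \<pi>. \<forall>i. W i 0 \<omega> = 0"
    using W_brownian[OF \<pi>] by (simp add: AE_all_countable standard_brownian_motion_def)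
  with post_eq_filter_process[OF order_refl] show ?thesis
    by eventually_elim (simp add: vec_eq_iff filter_process_nth observation_def)
qed

lemma measurable_post_FX: "0 \<le> t \<Longrightarrow> post \<pi> t \<in> borel_measurable (FX (ennreal t))"
  by (rule post_adapted[OF \<pi>])

lemma measurable_post: "0 \<le> t \<Longrightarrow> post \<pi> t \<in> borel_measurable (P \<pi>)"
  by (rule measurable_FX_P[OF measurable_post_FX])

text \<open>The coordinatewise Markov property covers only products of functions of one coordinate.
  To reach every Borel \<open>f\<close>, both sides are written as integrals against measures
  \<open>L\<close> and \<open>R\<close> on the product space, which agree on boxes and hence
  everywhere.\<close>

lemma markov_filter_process:
  assumes "0 \<le> s" "\<delta> > 0" and A: "A \<in> sets (FX (ennreal s))" and [measurable]: "f \<in> borel_measurable borel"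
  shows "(\<integral>\<^sup>+\<omega>. f (filter_process \<pi> (s + \<delta>) \<omega>) * indicator A \<omega> \<partial>P \<pi>) =
    (\<integral>\<^sup>+\<omega>. belief_step \<mu> \<delta> f (filter_process \<pi> s \<omega>) * indicator A \<omega> \<partial>P \<pi>)"
proof -
  have A' [measurable]: "A \<in> events" using A sets_FX_subset[OF \<pi>] by auto
  have [measurable]: "filter_process \<pi> s \<in> borel_measurable (P \<pi>)" "filter_process \<pi> (s + \<delta>) \<in> borel_measurable (P \<pi>)"
    using assms(1,2) by (auto intro!: measurable_filter_process)
  let ?G = "PiM (UNIV :: 'n set) (\<lambda>_. gauss \<delta>)" and ?B = "PiM (UNIV :: 'n set) (\<lambda>_. borel :: real measure)"
  interpret PS: product_sigma_finite "\<lambda>_::'n. gauss \<delta>" by (rule product_sigma_finite_gauss) fact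
  interpret SG: sigma_finite_measure ?G by (rule sigma_finite_PiM_gauss) fact
  note [measurable_cong] = sets_PiM_gauss
  \<comment> \<open>\<open>L\<close> is the law of the next posterior on \<open>A\<close>;
    \<open>R\<close> below draws it from the kernel started at the current posterior.\<close>
  define L where "L = distr (density (P \<pi>) (indicator A)) ?B (\<lambda>\<omega> i. filter_process \<pi> (s + \<delta>) \<omega> $ i)"
  define w where "w = (\<lambda>(\<omega>, z). indicator A \<omega> * (\<Prod>i\<in>UNIV. ennreal (evidence \<mu> \<delta> (filter_process \<pi> s \<omega> $ i) (z i))))"
  define R where "R = distr (density (P \<pi> \<Otimes>\<^sub>M ?G) w) ?B (\<lambda>(\<omega>, z) i. bayes \<mu> \<delta> (filter_process \<pi> s \<omega> $ i) (z i))"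
  have [measurable]: "w \<in> borel_measurable (P \<pi> \<Otimes>\<^sub>M ?G)"
    unfolding w_def by measurable
  have m1: "(\<lambda>\<omega> i. filter_process \<pi> (s + \<delta>) \<omega> $ i) \<in> P \<pi> \<rightarrow>\<^sub>M ?B"
    by (rule measurable_abs_UNIV) measurable
  have m2: "(\<lambda>(\<omega>, z) i. bayes \<mu> \<delta> (filter_process \<pi> s \<omega> $ i) (z i)) \<in> P \<pi> \<Otimes>\<^sub>M ?G \<rightarrow>\<^sub>M ?B"
    unfolding case_prod_beta' by (rule measurable_abs_UNIV) measurable
  have L: "(\<integral>\<^sup>+x. F x \<partial>L) = (\<integral>\<^sup>+\<omega>. F (\<lambda>i. filter_process \<pi> (s + \<delta>) \<omega> $ i) * indicator A \<omega> \<partial>P \<pi>)"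
    if [measurable]: "F \<in> borel_measurable ?B" for F
  proof -
    note [measurable] = m1
    show ?thesis unfolding L_def
      by (subst nn_integral_distr, simp, simp, subst nn_integral_density) (auto simp: mult.commute)
  qed
  have R: "(\<integral>\<^sup>+x. F x \<partial>R) = (\<integral>\<^sup>+\<omega>. (\<integral>\<^sup>+z. F (\<lambda>i. bayes \<mu> \<delta> (filter_process \<pi> s \<omega> $ i) (z i)) *
      (\<Prod>i\<in>UNIV. ennreal (evidence \<mu> \<delta> (filter_process \<pi> s \<omega> $ i) (z i))) \<partial>?G) * indicator A \<omega> \<partial>P \<pi>)"
    if F [measurable]: "F \<in> borel_measurable ?B" for F
  proof -
    note [measurable] = m2
    have Fm [measurable]: "(\<lambda>(\<omega>, z). F (\<lambda>i. bayes \<mu> \<delta> (filter_process \<pi> s \<omega> $ i) (z i))) \<in> borel_measurable (P \<pi> \<Otimes>\<^sub>M ?G)"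
      using measurable_compose[OF m2 F] by (simp add: case_prod_beta')
    have "(\<integral>\<^sup>+x. F x \<partial>R) = (\<integral>\<^sup>+x. w x * (case x of (\<omega>, z) \<Rightarrow> F (\<lambda>i. bayes \<mu> \<delta> (filter_process \<pi> s \<omega> $ i) (z i))) \<partial>(P \<pi> \<Otimes>\<^sub>M ?G))"
      unfolding R_def
      by (subst nn_integral_distr, simp, simp, subst nn_integral_density) (auto simp: case_prod_beta')
    also have "\<dots> = (\<integral>\<^sup>+\<omega>. \<integral>\<^sup>+z. w (\<omega>, z) * F (\<lambda>i. bayes \<mu> \<delta> (filter_process \<pi> s \<omega> $ i) (z i)) \<partial>?G \<partial>P \<pi>)"
      by (subst SG.nn_integral_fst[symmetric]) auto
    also have "\<dots> = (\<integral>\<^sup>+\<omega>. (\<integral>\<^sup>+z. F (\<lambda>i. bayes \<mu> \<delta> (filter_process \<pi> s \<omega> $ i) (z i)) *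
        (\<Prod>i\<in>UNIV. ennreal (evidence \<mu> \<delta> (filter_process \<pi> s \<omega> $ i) (z i))) \<partial>?G) * indicator A \<omega> \<partial>P \<pi>)"
      by (intro nn_integral_cong) (auto simp: w_def indicator_def mult.commute)
    finally show ?thesis .
  qed
  have "L = R"
  proof (rule measure_eqI_PiM_finite[where I=UNIV and M="\<lambda>_. borel" and A="\<lambda>_. UNIV"])
    fix C :: "'n \<Rightarrow> real set" assume "\<And>i. i \<in> UNIV \<Longrightarrow> C i \<in> sets borel"
    then have C [measurable]: "\<And>i. C i \<in> sets borel" by simp
    have PC [measurable]: "Pi\<^sub>E UNIV C \<in> sets ?B" by (intro sets_PiM_I_finite) auto
    have ind: "indicator (Pi\<^sub>E UNIV C) x = (\<Prod>i\<in>UNIV. indicator (C i) (x i) :: ennreal)" for x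
    proof (cases "x \<in> Pi\<^sub>E UNIV C")
      case True
      then show ?thesis by (auto simp: PiE_iff)
    next
      case False
      then obtain i where "x i \<notin> C i" by (auto simp: PiE_iff)
      then have "(\<Prod>i\<in>UNIV. indicator (C i) (x i) :: ennreal) = 0"
        by (intro prod_zero) (auto intro!: exI[of _ i])
      then show ?thesis using False by simp
    qed
    have "emeasure L (Pi\<^sub>E UNIV C) = (\<integral>\<^sup>+x. indicator (Pi\<^sub>E UNIV C) x \<partial>L)"
      by (simp add: L_def)
    also have "\<dots> = (\<integral>\<^sup>+\<omega>. (\<Prod>i\<in>UNIV. indicator (C i) (filter_process \<pi> (s + \<delta>) \<omega> $ i)) * indicator A \<omega> \<partial>P \<pi>)"
      by (subst L) (simp_all add: ind)
    also have "\<dots> = (\<integral>\<^sup>+\<omega>. (\<Prod>i\<in>UNIV. bayes_step \<mu> \<delta> (indicator (C i)) (filter_process \<pi> s \<omega> $ i)) * indicator A \<omega> \<partial>P \<pi>)"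
    proof (rule nn_integral_coordinatewise[OF assms(1) _ _ _ _ A])
      fix i
      show "(\<lambda>\<omega>. indicator (C i) (filter_process \<pi> (s + \<delta>) \<omega> $ i)) \<in> borel_measurable (coordinate_sigma i)"
        using assms(1,2)
        by (intro measurable_compose[OF measurable_coordinate_filter_process borel_measurable_indicator]) auto
      show "(\<lambda>\<omega>. bayes_step \<mu> \<delta> (indicator (C i)) (filter_process \<pi> s \<omega> $ i)) \<in> borel_measurable (coordinate_sigma i)"
        by (rule measurable_compose[OF measurable_coordinate_filter_process[OF assms(1)] measurable_bayes_step[OF assms(2)]])
           simp
      show "indicator (C i) (filter_process \<pi> (s + \<delta>) \<omega> $ i) \<le> (1::ennreal)" for \<omega>
        by (simp add: indicator_def)
      fix J and D :: "real \<Rightarrow> real set"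
      assume J: "finite J" "J \<subseteq> {0..s}" "\<And>s. D s \<in> sets borel"
      show "(\<integral>\<^sup>+\<omega>. indicator (C i) (filter_process \<pi> (s + \<delta>) \<omega> $ i) *
          indicator {\<omega> \<in> space S. \<forall>s\<in>J. observation \<mu> Y W s \<omega> $ i \<in> D s} \<omega> \<partial>P \<pi>) =
        (\<integral>\<^sup>+\<omega>. bayes_step \<mu> \<delta> (indicator (C i)) (filter_process \<pi> s \<omega> $ i) *
          indicator {\<omega> \<in> space S. \<forall>s\<in>J. observation \<mu> Y W s \<omega> $ i \<in> D s} \<omega> \<partial>P \<pi>)"
        using J by (intro markov_coordinate[OF _ _ assms(1,2)]) auto
    qed
    also have "\<dots> = (\<integral>\<^sup>+x. indicator (Pi\<^sub>E UNIV C) x \<partial>R)"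
    proof (subst R, simp, intro nn_integral_cong arg_cong2[where f="(*)"] refl)
      fix \<omega>
      show "(\<Prod>i\<in>UNIV. bayes_step \<mu> \<delta> (indicator (C i)) (filter_process \<pi> s \<omega> $ i)) =
        (\<integral>\<^sup>+z. indicator (Pi\<^sub>E UNIV C) (\<lambda>i. bayes \<mu> \<delta> (filter_process \<pi> s \<omega> $ i) (z i)) *
          (\<Prod>i\<in>UNIV. ennreal (evidence \<mu> \<delta> (filter_process \<pi> s \<omega> $ i) (z i))) \<partial>?G)"
        unfolding bayes_step_def ind prod.distrib[symmetric]
        by (subst PS.product_nn_integral_prod) auto
    qed
    also have "\<dots> = emeasure R (Pi\<^sub>E UNIV C)" by (simp add: R_def)
    finally show "emeasure L (Pi\<^sub>E UNIV C) = emeasure R (Pi\<^sub>E UNIV C)" .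
  next
    show "range (\<lambda>_::nat. UNIV) \<subseteq> prod_algebra (UNIV :: 'n set) (\<lambda>_. borel :: real measure)"
      using prod_algebraI_finite[of "UNIV :: 'n set" "\<lambda>_. UNIV" "\<lambda>_. borel :: real measure"] by auto
    have "emeasure L UNIV = (\<integral>\<^sup>+x. indicator (space ?B) x \<partial>L)"
      by (subst nn_integral_indicator) (simp_all add: L_def, simp add: space_PiM)
    also have "\<dots> \<le> 1"
      by (subst L) (auto simp: space_PiM intro!: measure_le_1 emeasure_le_1)
    finally show "emeasure L UNIV \<noteq> \<infinity>" by (auto simp: top_unique)
  qed (auto simp: L_def R_def space_PiM)
  have vm [measurable]: "(\<lambda>x. f (\<chi> i. x i)) \<in> borel_measurable ?B"
    by measurable
  have "(\<integral>\<^sup>+\<omega>. f (filter_process \<pi> (s + \<delta>) \<omega>) * indicator A \<omega> \<partial>P \<pi>) = (\<integral>\<^sup>+x. f (\<chi> i. x i) \<partial>L)"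
    by (subst L) simp_all
  also have "\<dots> = (\<integral>\<^sup>+\<omega>. belief_step \<mu> \<delta> f (filter_process \<pi> s \<omega>) * indicator A \<omega> \<partial>P \<pi>)"
    unfolding \<open>L = R\<close> belief_step_def by (subst R) simp_all
  finally show ?thesis .
qed

lemma markov_post:
  assumes "0 \<le> s" "\<delta> > 0" "A \<in> sets (FX (ennreal s))" "f \<in> borel_measurable borel"
  shows "(\<integral>\<^sup>+\<omega>. f (post \<pi> (s + \<delta>) \<omega>) * indicator A \<omega> \<partial>P \<pi>) =
    (\<integral>\<^sup>+\<omega>. belief_step \<mu> \<delta> f (post \<pi> s \<omega>) * indicator A \<omega> \<partial>P \<pi>)"
proof -
  have "(\<integral>\<^sup>+\<omega>. f (post \<pi> (s + \<delta>) \<omega>) * indicator A \<omega> \<partial>P \<pi>) =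
      (\<integral>\<^sup>+\<omega>. f (filter_process \<pi> (s + \<delta>) \<omega>) * indicator A \<omega> \<partial>P \<pi>)"
    by (intro nn_integral_cong_AE,
        use post_eq_filter_process[OF add_nonneg_nonneg[OF assms(1) less_imp_le[OF assms(2)]]] in eventually_elim)
       simp
  also have "\<dots> = (\<integral>\<^sup>+\<omega>. belief_step \<mu> \<delta> f (post \<pi> s \<omega>) * indicator A \<omega> \<partial>P \<pi>)"
    unfolding markov_filter_process[OF assms]
    by (intro nn_integral_cong_AE, use post_eq_filter_process[OF assms(1)] in eventually_elim) simp
  finally show ?thesis .
qed

end

end

section \<open>Reduction to Bellman recursions\<close>

primrec bellman :: "real \<Rightarrow> real \<Rightarrow> real \<Rightarrow> (real^'n::finite \<Rightarrow> ennreal) \<Rightarrow> nat \<Rightarrow> real^'n \<Rightarrow> ennreal" where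
  "bellman \<mu> k \<delta> H 0 = H"
| "bellman \<mu> k \<delta> H (Suc m) = (\<lambda>p. min (H p) (belief_step \<mu> \<delta> (bellman \<mu> k \<delta> H m) p + ennreal (k * \<delta>)))"

text \<open>The infimum over the horizon \<open>m\<close> and the dyadic mesh. Up to
  \<open>enn2real\<close> it is the value over all stopping times, by
  \<open>testing_value_eq_bellman_limit\<close>.\<close>

definition bellman_limit :: "real \<Rightarrow> real \<Rightarrow> (real^'n::finite \<Rightarrow> ennreal) \<Rightarrow> real^'n \<Rightarrow> ennreal" where
  "bellman_limit \<mu> k H p = (INF n. INF m. bellman \<mu> k (1 / 2 ^ n) H m p)"

lemma bellman_le: "bellman \<mu> k \<delta> H m p \<le> H p"
  by (cases m) simp_all

lemma measurable_bellman [measurable]: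
  assumes "\<delta> > 0" and [measurable]: "H \<in> borel_measurable borel"
  shows "bellman \<mu> k \<delta> H m \<in> borel_measurable borel"
proof (induction m)
  case (Suc m)
  note [measurable] = measurable_belief_step[OF \<open>\<delta> > 0\<close> Suc]
  show ?case unfolding bellman.simps by measurable
qed simp

text \<open>Payoffs are continuous on the cube only. Extension by zero makes them Borel on the whole
  space, as the kernel requires, and the posterior stays in the cube almost surely.\<close>

definition on_cube :: "(real^'n::finite \<Rightarrow> real) \<Rightarrow> real^'n \<Rightarrow> ennreal" where
  "on_cube h p = ennreal (h p) * indicator prior_cube p"

lemma on_cube_eq: "p \<in> prior_cube \<Longrightarrow> on_cube h p = ennreal (h p)"
  by (simp add: on_cube_def)

lemma measurable_on_cube [measurable]:
  assumes "continuous_on prior_cube h"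
  shows "on_cube h \<in> borel_measurable borel"
proof -
  have "(\<lambda>p. indicator prior_cube p *\<^sub>R h p) \<in> borel_measurable borel"
    by (rule borel_measurable_continuous_on_indicator) (use assms in auto)
  then have [measurable]: "(\<lambda>p. indicator prior_cube p *\<^sub>R h p) \<in> borel_measurable borel" .
  have "on_cube h = (\<lambda>p. ennreal (indicator prior_cube p *\<^sub>R h p))"
    by (auto simp: on_cube_def indicator_def)
  then show ?thesis by (simp only:) measurable
qed

text \<open>Times are rounded up rather than down, since rounding up preserves the stopping time
  property.\<close>

lemma dyadic_ceiling:
  fixes t :: real
  assumes "0 \<le> t"
  shows "t \<le> real (nat \<lceil>t * 2 ^ n\<rceil>) * (1 / 2 ^ n)" "real (nat \<lceil>t * 2 ^ n\<rceil>) * (1 / 2 ^ n) \<le> t + 1 / 2 ^ n"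
proof -
  have nn: "0 \<le> \<lceil>t * 2 ^ n\<rceil>" using assms by (simp add: less_le_trans[OF _ mult_nonneg_nonneg])
  then have e: "real (nat \<lceil>t * 2 ^ n\<rceil>) = of_int \<lceil>t * 2 ^ n\<rceil>" by simp
  show "t \<le> real (nat \<lceil>t * 2 ^ n\<rceil>) * (1 / 2 ^ n)"
    unfolding e using le_of_int_ceiling[of "t * 2 ^ n"] by (simp add: field_simps)
  show "real (nat \<lceil>t * 2 ^ n\<rceil>) * (1 / 2 ^ n) \<le> t + 1 / 2 ^ n"
    unfolding e using of_int_ceiling_le_add_one[of "t * 2 ^ n"] by (simp add: field_simps)
qed

lemma dyadic_ceiling_tendsto:
  fixes t :: real
  assumes "0 \<le> t"
  shows "(\<lambda>n. real (nat \<lceil>t * 2 ^ n\<rceil>) * (1 / 2 ^ n)) \<longlonglongrightarrow> t"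
proof (rule real_tendsto_sandwich[OF always_eventually always_eventually tendsto_const])
  have "(\<lambda>n. t + (1 / 2) ^ n) \<longlonglongrightarrow> t + 0"
    by (intro tendsto_intros LIMSEQ_power_zero) simp
  then show "(\<lambda>n. t + 1 / 2 ^ n) \<longlonglongrightarrow> t" by (simp add: power_divide)
qed (use dyadic_ceiling[OF assms] in auto)

context sequential_testing
begin

context
  fixes \<pi> :: "real^'n" assumes \<pi>: "\<pi> \<in> prior_cube"
begin

interpretation prob_space "P \<pi>" by (rule prob_space_P[OF \<pi>])

text \<open>The posterior will be evaluated at random times, so one null set must serve all times.
  Countably many dyadic times suffice, because paths are continuous and the cube is closed.\<close>

lemma post_in_cube: "AE \<omega> in P \<pi>. \<forall>t\<ge>0. post \<pi> t \<omega> \<in> prior_cube"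
proof -
  have "AE \<omega> in P \<pi>. \<forall>x. post \<pi> (real (fst x) * (1 / 2 ^ snd x)) \<omega> \<in> prior_cube"
  proof (subst AE_all_countable, rule allI)
    fix x :: "nat \<times> nat"
    show "AE \<omega> in P \<pi>. post \<pi> (real (fst x) * (1 / 2 ^ snd x)) \<omega> \<in> prior_cube"
      using post_eq_filter_process[OF \<pi>, of "real (fst x) * (1 / 2 ^ snd x)"]
      by (simp, elim AE_mp) (simp add: filter_process_in_cube[OF \<pi>])
  qed
  then show ?thesis
    using AE_space
  proof eventually_elim
    case (elim \<omega>)
    show ?case
    proof safe
      fix t :: real assume t: "0 \<le> t"
      have "continuous_on {0..} (\<lambda>t. post \<pi> t \<omega>)"
        using elim(2) by (intro post_continuous[OF \<pi>]) (simp add: space_P[OF \<pi>])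
      from this dyadic_ceiling_tendsto[OF t] have
        "(\<lambda>n. post \<pi> (real (nat \<lceil>t * 2 ^ n\<rceil>) * (1 / 2 ^ n)) \<omega>) \<longlonglongrightarrow> post \<pi> t \<omega>"
        by (rule continuous_on_tendsto_compose)
           (simp add: t, intro always_eventually allI, simp only: atLeast_iff, simp)
      then show "post \<pi> t \<omega> \<in> prior_cube"
        using elim(1)[rule_format, of "(_, _)"]
        by (intro Lim_in_closed_set[OF closed_prior_cube always_eventually]) auto
    qed
  qed
qed

lemma nn_integral_post:
  assumes "t > 0" and [measurable]: "f \<in> borel_measurable borel"
  shows "(\<integral>\<^sup>+\<omega>. f (post \<pi> t \<omega>) \<partial>P \<pi>) = belief_step \<mu> t f \<pi>"
proof -
  have "space S \<in> sets (FX (ennreal 0))" using sets.top[of "FX (ennreal 0)"] by simp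
  from markov_post[OF \<pi> order_refl assms(1) this assms(2)]
  have "(\<integral>\<^sup>+\<omega>. f (post \<pi> t \<omega>) * indicator (space S) \<omega> \<partial>P \<pi>) =
    (\<integral>\<^sup>+\<omega>. belief_step \<mu> t f (post \<pi> 0 \<omega>) * indicator (space S) \<omega> \<partial>P \<pi>)" by simp
  moreover have "(\<integral>\<^sup>+\<omega>. f (post \<pi> t \<omega>) * indicator (space S) \<omega> \<partial>P \<pi>) = (\<integral>\<^sup>+\<omega>. f (post \<pi> t \<omega>) \<partial>P \<pi>)"
    by (intro nn_integral_cong) (simp add: space_P[OF \<pi>])
  moreover have "(\<integral>\<^sup>+\<omega>. belief_step \<mu> t f (post \<pi> 0 \<omega>) * indicator (space S) \<omega> \<partial>P \<pi>) =
      (\<integral>\<^sup>+\<omega>. belief_step \<mu> t f \<pi> \<partial>P \<pi>)"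
    by (intro nn_integral_cong_AE, use post_0[OF \<pi>] AE_space in eventually_elim) (simp add: space_P[OF \<pi>])
  ultimately show ?thesis by (simp add: emeasure_space_1)
qed

text \<open>Chapman-Kolmogorov, obtained by computing one expectation of the posterior at time
  \<open>s + t\<close> in two ways. This bypasses the convolution of Gaussian densities and explains
  why a statement about kernels is proved inside a model.\<close>

lemma belief_step_add:
  assumes "s > 0" "t > 0" and f [measurable]: "f \<in> borel_measurable borel"
  shows "belief_step \<mu> (s + t) f \<pi> = belief_step \<mu> s (belief_step \<mu> t f) \<pi>"
proof -
  have S: "space S \<in> sets (FX (ennreal s))" using sets.top[of "FX (ennreal s)"] by simp
  have *: "(\<integral>\<^sup>+\<omega>. X \<omega> * indicator (space S) \<omega> \<partial>P \<pi>) = (\<integral>\<^sup>+\<omega>. X \<omega> \<partial>P \<pi>)" for X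
    by (intro nn_integral_cong) (simp add: space_P[OF \<pi>])
  have "belief_step \<mu> (s + t) f \<pi> = (\<integral>\<^sup>+\<omega>. f (post \<pi> (s + t) \<omega>) \<partial>P \<pi>)"
    using assms by (subst nn_integral_post) auto
  also have "\<dots> = (\<integral>\<^sup>+\<omega>. belief_step \<mu> t f (post \<pi> s \<omega>) \<partial>P \<pi>)"
    using markov_post[OF \<pi> less_imp_le[OF assms(1)] assms(2) S f] unfolding * .
  also have "\<dots> = belief_step \<mu> s (belief_step \<mu> t f) \<pi>"
    using assms measurable_belief_step[OF assms(2) f] by (subst nn_integral_post) auto
  finally show ?thesis .
qed

section \<open>Expected costs of strategies on a time grid\<close>

context
  fixes k \<delta> :: real and H :: "real^'n \<Rightarrow> ennreal" and N :: "'a \<Rightarrow> nat" and m :: nat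
  assumes k: "k \<ge> 0" and \<delta>: "\<delta> > 0" and H [measurable]: "H \<in> borel_measurable borel"
    and N_meas [measurable]: "N \<in> measurable (P \<pi>) (count_space UNIV)"
    and N_stop: "\<And>j. j < m \<Longrightarrow> {\<omega> \<in> space S. N \<omega> \<le> j} \<in> sets (FX (ennreal (real j * \<delta>)))"
begin

text \<open>\<open>N\<close> counts grid steps. Adaptedness of \<open>N\<close> is asked for only
  before the horizon \<open>m\<close>, so a value beyond \<open>m\<close> can encode that stopping
  has not occurred by then.\<close>

definition stopped_cost :: "'a \<Rightarrow> ennreal" where
  "stopped_cost \<omega> = H (post \<pi> (real (N \<omega>) * \<delta>) \<omega>) + ennreal (k * \<delta> * real (N \<omega>))"

text \<open>Cost of following \<open>N\<close> up to step \<open>j\<close> and acting optimally for the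
  remaining \<open>m - j\<close> steps.\<close>

definition mixed_cost :: "nat \<Rightarrow> 'a \<Rightarrow> ennreal" where
  "mixed_cost j \<omega> = (if N \<omega> \<le> j then stopped_cost \<omega>
     else bellman \<mu> k \<delta> H (m - j) (post \<pi> (real j * \<delta>) \<omega>) + ennreal (k * \<delta> * real j))"

lemma measurable_post_grid: "(\<lambda>\<omega>. post \<pi> (real j * \<delta>) \<omega>) \<in> borel_measurable (P \<pi>)"
  using \<delta> by (intro measurable_post[OF \<pi>]) simp

lemma measurable_stopped_cost [measurable]: "stopped_cost \<in> borel_measurable (P \<pi>)"
proof -
  note [measurable] = measurable_post_grid
  have [measurable]: "(\<lambda>\<omega>. post \<pi> (real (N \<omega>) * \<delta>) \<omega>) \<in> borel_measurable (P \<pi>)"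
    by (rule measurable_compose_countable[OF _ N_meas]) measurable
  show ?thesis unfolding stopped_cost_def[abs_def] by measurable
qed

text \<open>Not having stopped by step \<open>j\<close> is an event known at time
  \<open>j * \<delta>\<close>, so on it the Markov property trades the kernel for the posterior one
  step later; the part already stopped is carried along.\<close>

lemma nn_integral_step:
  assumes "j < m" and w [measurable]: "w \<in> borel_measurable borel"
  shows "(\<integral>\<^sup>+\<omega>. (if N \<omega> \<le> j then stopped_cost \<omega> else belief_step \<mu> \<delta> w (post \<pi> (real j * \<delta>) \<omega>) + a) \<partial>P \<pi>) =
    (\<integral>\<^sup>+\<omega>. (if N \<omega> \<le> j then stopped_cost \<omega> else w (post \<pi> (real (Suc j) * \<delta>) \<omega>) + a) \<partial>P \<pi>)"
proof -
  let ?B = "space S - {\<omega> \<in> space S. N \<omega> \<le> j}"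
  have B: "?B \<in> sets (FX (ennreal (real j * \<delta>)))"
    using sets.compl_sets[OF N_stop[OF assms(1)]] by simp
  have [measurable]: "?B \<in> events" using B sets_FX_subset[OF \<pi>] by auto
  note [measurable] = measurable_post_grid measurable_belief_step[OF \<delta> w]
  have split: "(\<integral>\<^sup>+\<omega>. (if N \<omega> \<le> j then stopped_cost \<omega> else X \<omega> + a) \<partial>P \<pi>) =
      (\<integral>\<^sup>+\<omega>. (if N \<omega> \<le> j then stopped_cost \<omega> else a) \<partial>P \<pi>) + (\<integral>\<^sup>+\<omega>. X \<omega> * indicator ?B \<omega> \<partial>P \<pi>)"
    if [measurable]: "X \<in> borel_measurable (P \<pi>)" for X
  proof -
    have [measurable]: "(\<lambda>\<omega>. X \<omega> * indicator ?B \<omega>) \<in> borel_measurable (P \<pi>)" by measurable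
    show ?thesis
      by (subst nn_integral_add[symmetric], measurable)
         (auto intro!: nn_integral_cong simp: space_P[OF \<pi>] add.commute)
  qed
  have eq: "real (Suc j) * \<delta> = real j * \<delta> + \<delta>" by (simp add: algebra_simps)
  have m1: "(\<lambda>\<omega>. belief_step \<mu> \<delta> w (post \<pi> (real j * \<delta>) \<omega>)) \<in> borel_measurable (P \<pi>)"
    and m2: "(\<lambda>\<omega>. w (post \<pi> (real (Suc j) * \<delta>) \<omega>)) \<in> borel_measurable (P \<pi>)"
    by measurable
  have "0 \<le> real j * \<delta>" using \<delta> by simp
  from markov_post[OF \<pi> this \<delta> B w] show ?thesis
    unfolding split[OF m1] split[OF m2] unfolding eq by simp
qed

lemma mixed_cost_grid_step: "ennreal (k * \<delta>) + ennreal (k * \<delta> * real j) = ennreal (k * \<delta> * real (Suc j))"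
  using k \<delta> by (simp add: ennreal_plus[symmetric] algebra_simps del: ennreal_plus)

text \<open>Following \<open>N\<close> for one more step instead of acting optimally cannot lower
  the expected cost: optional stopping in discrete time.\<close>

lemma mixed_cost_mono:
  assumes "j < m"
  shows "(\<integral>\<^sup>+\<omega>. mixed_cost j \<omega> \<partial>P \<pi>) \<le> (\<integral>\<^sup>+\<omega>. mixed_cost (Suc j) \<omega> \<partial>P \<pi>)"
proof -
  let ?w = "bellman \<mu> k \<delta> H (m - Suc j)"
  have m: "m - j = Suc (m - Suc j)" using assms by simp
  have "(\<integral>\<^sup>+\<omega>. mixed_cost j \<omega> \<partial>P \<pi>) \<le> (\<integral>\<^sup>+\<omega>. (if N \<omega> \<le> j then stopped_cost \<omega>
      else belief_step \<mu> \<delta> ?w (post \<pi> (real j * \<delta>) \<omega>) + ennreal (k * \<delta> * real (Suc j))) \<partial>P \<pi>)"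
    unfolding mixed_cost_def m mixed_cost_grid_step[symmetric] add.assoc[symmetric]
    by (intro nn_integral_mono) (auto intro!: add_right_mono)
  also have "\<dots> = (\<integral>\<^sup>+\<omega>. (if N \<omega> \<le> j then stopped_cost \<omega>
      else ?w (post \<pi> (real (Suc j) * \<delta>) \<omega>) + ennreal (k * \<delta> * real (Suc j))) \<partial>P \<pi>)"
    by (rule nn_integral_step[OF assms measurable_bellman[OF \<delta> H]])
  also have "\<dots> \<le> (\<integral>\<^sup>+\<omega>. mixed_cost (Suc j) \<omega> \<partial>P \<pi>)"
  proof (intro nn_integral_mono)
    fix \<omega>
    consider "N \<omega> \<le> j" | "N \<omega> = Suc j" | "N \<omega> > Suc j" by linarith
    then show "(if N \<omega> \<le> j then stopped_cost \<omega>
      else ?w (post \<pi> (real (Suc j) * \<delta>) \<omega>) + ennreal (k * \<delta> * real (Suc j))) \<le> mixed_cost (Suc j) \<omega>"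
      by cases (auto simp: mixed_cost_def stopped_cost_def intro!: add_right_mono bellman_le)
  qed
  finally show ?thesis .
qed

lemma bellman_le_mixed_cost: "bellman \<mu> k \<delta> H m \<pi> \<le> (\<integral>\<^sup>+\<omega>. mixed_cost m \<omega> \<partial>P \<pi>)"
proof -
  have "bellman \<mu> k \<delta> H m \<pi> = (\<integral>\<^sup>+\<omega>. bellman \<mu> k \<delta> H m \<pi> \<partial>P \<pi>)"
    by (simp add: emeasure_space_1)
  also have "\<dots> \<le> (\<integral>\<^sup>+\<omega>. mixed_cost 0 \<omega> \<partial>P \<pi>)"
    by (intro nn_integral_mono_AE, use post_0[OF \<pi>] in eventually_elim)
       (auto simp: mixed_cost_def stopped_cost_def bellman_le)
  also have "(\<integral>\<^sup>+\<omega>. mixed_cost 0 \<omega> \<partial>P \<pi>) \<le> (\<integral>\<^sup>+\<omega>. mixed_cost j \<omega> \<partial>P \<pi>)" if "j \<le> m" for j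
    using that
  proof (induction j)
    case (Suc j)
    then show ?case using mixed_cost_mono[of j] by (auto intro: order_trans)
  qed simp
  finally show ?thesis by simp
qed

text \<open>The two inequalities in \<open>mixed_cost_mono\<close> become equalities when
  \<open>N\<close> stops only where the remaining value equals the payoff and continues only where
  the minimum is the continuation value.\<close>

lemma stopped_cost_eq_bellman:
  assumes N_le: "\<And>\<omega>. N \<omega> \<le> m"
    and stop: "\<And>\<omega>. bellman \<mu> k \<delta> H (m - N \<omega>) (post \<pi> (real (N \<omega>) * \<delta>) \<omega>) = H (post \<pi> (real (N \<omega>) * \<delta>) \<omega>)"
    and continue: "\<And>\<omega> j. j < N \<omega> \<Longrightarrow> bellman \<mu> k \<delta> H (m - j) (post \<pi> (real j * \<delta>) \<omega>) \<noteq> H (post \<pi> (real j * \<delta>) \<omega>)"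
  shows "(\<integral>\<^sup>+\<omega>. stopped_cost \<omega> \<partial>P \<pi>) = bellman \<mu> k \<delta> H m \<pi>"
proof -
  have step: "(\<integral>\<^sup>+\<omega>. mixed_cost j \<omega> \<partial>P \<pi>) = (\<integral>\<^sup>+\<omega>. mixed_cost (Suc j) \<omega> \<partial>P \<pi>)" if j: "j < m" for j
  proof -
    let ?w = "bellman \<mu> k \<delta> H (m - Suc j)"
    have m: "m - j = Suc (m - Suc j)" using j by simp
    have "(\<integral>\<^sup>+\<omega>. mixed_cost j \<omega> \<partial>P \<pi>) = (\<integral>\<^sup>+\<omega>. (if N \<omega> \<le> j then stopped_cost \<omega>
        else belief_step \<mu> \<delta> ?w (post \<pi> (real j * \<delta>) \<omega>) + ennreal (k * \<delta> * real (Suc j))) \<partial>P \<pi>)"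
    proof (intro nn_integral_cong)
      fix \<omega>
      have "bellman \<mu> k \<delta> H (m - j) (post \<pi> (real j * \<delta>) \<omega>) =
        belief_step \<mu> \<delta> ?w (post \<pi> (real j * \<delta>) \<omega>) + ennreal (k * \<delta>)" if "\<not> N \<omega> \<le> j"
        using continue[of j \<omega>] that unfolding m by (auto simp: min_def split: if_splits)
      then show "mixed_cost j \<omega> = (if N \<omega> \<le> j then stopped_cost \<omega>
        else belief_step \<mu> \<delta> ?w (post \<pi> (real j * \<delta>) \<omega>) + ennreal (k * \<delta> * real (Suc j)))"
        by (simp add: mixed_cost_def mixed_cost_grid_step[symmetric] add.assoc del: of_nat_Suc)
    qed
    also have "\<dots> = (\<integral>\<^sup>+\<omega>. (if N \<omega> \<le> j then stopped_cost \<omega>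
        else ?w (post \<pi> (real (Suc j) * \<delta>) \<omega>) + ennreal (k * \<delta> * real (Suc j))) \<partial>P \<pi>)"
      by (rule nn_integral_step[OF j measurable_bellman[OF \<delta> H]])
    also have "\<dots> = (\<integral>\<^sup>+\<omega>. mixed_cost (Suc j) \<omega> \<partial>P \<pi>)"
    proof (intro nn_integral_cong)
      fix \<omega>
      consider "N \<omega> \<le> j" | "N \<omega> = Suc j" | "N \<omega> > Suc j" by linarith
      then show "(if N \<omega> \<le> j then stopped_cost \<omega>
        else ?w (post \<pi> (real (Suc j) * \<delta>) \<omega>) + ennreal (k * \<delta> * real (Suc j))) = mixed_cost (Suc j) \<omega>"
        using stop[of \<omega>] by cases (auto simp: mixed_cost_def stopped_cost_def)
    qed
    finally show ?thesis .
  qed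
  have "(\<integral>\<^sup>+\<omega>. mixed_cost 0 \<omega> \<partial>P \<pi>) = (\<integral>\<^sup>+\<omega>. mixed_cost j \<omega> \<partial>P \<pi>)" if "j \<le> m" for j
    using that by (induction j) (auto simp: step)
  from this[of m] have "(\<integral>\<^sup>+\<omega>. stopped_cost \<omega> \<partial>P \<pi>) = (\<integral>\<^sup>+\<omega>. mixed_cost 0 \<omega> \<partial>P \<pi>)"
    using N_le by (simp add: mixed_cost_def)
  also have "\<dots> = (\<integral>\<^sup>+\<omega>. bellman \<mu> k \<delta> H m \<pi> \<partial>P \<pi>)"
  proof (intro nn_integral_cong_AE, use post_0[OF \<pi>] in eventually_elim)
    case (elim \<omega>)
    then show ?case using stop[of \<omega>] by (auto simp: mixed_cost_def stopped_cost_def)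
  qed
  finally show ?thesis by (simp add: emeasure_space_1)
qed

end

text \<open>The optimal grid rule, stopping at the first step where the value with the remaining
  steps equals the payoff, is an admissible time whose cost is exactly the recursion.\<close>

lemma inf_le_bellman:
  assumes k: "k \<ge> 0" and \<delta>: "\<delta> > 0" and h: "continuous_on prior_cube h"
  shows "(INF \<tau> \<in> admissible_times \<pi>.
     \<integral>\<^sup>+\<omega>. ennreal (h (post \<pi> (enn2real (\<tau> \<omega>)) \<omega>)) + ennreal k * \<tau> \<omega> \<partial>P \<pi>) \<le> bellman \<mu> k \<delta> (on_cube h) m \<pi>"
proof -
  define H where "H = on_cube h"
  have H [measurable]: "H \<in> borel_measurable borel" unfolding H_def by (rule measurable_on_cube[OF h])
  \<comment> \<open>The disjunct \<open>j \<ge> m\<close> guarantees a least index with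
    \<open>Q\<close>, and that it is at most \<open>m\<close>.\<close>
  define Q where "Q j \<omega> \<longleftrightarrow> j \<ge> m \<or> bellman \<mu> k \<delta> H (m - j) (post \<pi> (real j * \<delta>) \<omega>) = H (post \<pi> (real j * \<delta>) \<omega>)" for j \<omega>
  define N where "N \<omega> = (LEAST j. Q j \<omega>)" for \<omega>
  have Qm: "Q m \<omega>" for \<omega> by (simp add: Q_def)
  have N_le: "N \<omega> \<le> m" for \<omega> unfolding N_def by (rule Least_le[of "\<lambda>j. Q j \<omega>", OF Qm])
  have QN: "Q (N \<omega>) \<omega>" for \<omega> unfolding N_def by (rule LeastI[of "\<lambda>j. Q j \<omega>", OF Qm])
  have notQ: "\<not> Q j \<omega>" if "j < N \<omega>" for j \<omega> using that unfolding N_def by (rule not_less_Least)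
  have N_iff: "N \<omega> \<le> j \<longleftrightarrow> (\<exists>i\<in>{..j}. Q i \<omega>)" for j \<omega>
    using QN[of \<omega>] notQ[of _ \<omega>] by (meson atMost_iff le_trans linorder_not_le)
  have Q_sets: "{\<omega> \<in> space S. Q i \<omega>} \<in> sets (FX (ennreal (real j * \<delta>)))" if "i \<le> j" for i j
  proof -
    have "real i * \<delta> \<le> real j * \<delta>" using that \<delta> by simp
    then have mono: "sets (FX (ennreal (real i * \<delta>))) \<subseteq> sets (FX (ennreal (real j * \<delta>)))"
      by (intro sets_FX_mono ennreal_leI)
    have [measurable]: "post \<pi> (real i * \<delta>) \<in> borel_measurable (FX (ennreal (real i * \<delta>)))"
      using \<delta> by (intro measurable_post_FX[OF \<pi>]) simp
    note [measurable] = measurable_bellman[OF \<delta> H]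
    have "{\<omega> \<in> space (FX (ennreal (real i * \<delta>))). Q i \<omega>} \<in> sets (FX (ennreal (real i * \<delta>)))"
      unfolding Q_def by measurable
    then show ?thesis using mono by auto
  qed
  have N_stop: "{\<omega> \<in> space S. N \<omega> \<le> j} \<in> sets (FX (ennreal (real j * \<delta>)))" for j
  proof -
    have "{\<omega> \<in> space S. N \<omega> \<le> j} = (\<Union>i\<in>{..j}. {\<omega> \<in> space S. Q i \<omega>})"
      unfolding N_iff by auto
    then show ?thesis using Q_sets by auto
  qed
  have N_meas: "N \<in> measurable (P \<pi>) (count_space UNIV)"
  proof -
    have [measurable]: "Measurable.pred (P \<pi>) (Q i)" for i
      using Q_sets[of i i] sets_FX_subset[OF \<pi>] by (auto simp: Measurable.pred_def space_P[OF \<pi>])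
    show ?thesis unfolding N_def by measurable
  qed
  define \<tau> where "\<tau> \<omega> = ennreal (real (N \<omega>) * \<delta>)" for \<omega>
  have "stopping_time FX \<tau>"
  proof
    fix t
    \<comment> \<open>The time takes grid values only, so the event is a countable union of events
      already known at a grid time not exceeding \<open>t\<close>.\<close>
    have "{\<omega> \<in> space (FX t). \<tau> \<omega> \<le> t} = (\<Union>j\<in>{j. ennreal (real j * \<delta>) \<le> t}. {\<omega> \<in> space S. N \<omega> \<le> j})"
    proof safe
      fix \<omega> assume "\<omega> \<in> space (FX t)" "\<tau> \<omega> \<le> t"
      then show "\<omega> \<in> (\<Union>j\<in>{j. ennreal (real j * \<delta>) \<le> t}. {\<omega> \<in> space S. N \<omega> \<le> j})"
        by (intro UN_I[of "N \<omega>"]) (auto simp: \<tau>_def)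
    next
      fix \<omega> j assume j: "ennreal (real j * \<delta>) \<le> t" "N \<omega> \<le> j"
      have "\<tau> \<omega> \<le> ennreal (real j * \<delta>)"
        unfolding \<tau>_def using j \<delta> by (intro ennreal_leI) simp
      then show "\<tau> \<omega> \<le> t" using j by (auto intro: order_trans)
    qed simp_all
    also have "\<dots> \<in> sets (FX t)"
      using N_stop sets_FX_mono by (intro sets.countable_UN') (auto simp: subset_eq)
    finally show "Measurable.pred (FX t) (\<lambda>\<omega>. \<tau> \<omega> \<le> t)" by (simp add: Measurable.pred_def)
  qed
  then have "\<tau> \<in> admissible_times \<pi>" by (simp add: admissible_times_def \<tau>_def)
  then have "(INF \<tau> \<in> admissible_times \<pi>.
     \<integral>\<^sup>+\<omega>. ennreal (h (post \<pi> (enn2real (\<tau> \<omega>)) \<omega>)) + ennreal k * \<tau> \<omega> \<partial>P \<pi>) \<le>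
     (\<integral>\<^sup>+\<omega>. ennreal (h (post \<pi> (enn2real (\<tau> \<omega>)) \<omega>)) + ennreal k * \<tau> \<omega> \<partial>P \<pi>)"
    by (rule INF_lower)
  also have "\<dots> = (\<integral>\<^sup>+\<omega>. stopped_cost k \<delta> H N \<omega> \<partial>P \<pi>)"
  proof (intro nn_integral_cong_AE, use post_in_cube in eventually_elim)
    case (elim \<omega>)
    have "0 \<le> real (N \<omega>) * \<delta>" using \<delta> by simp
    with elim k show ?case
      unfolding stopped_cost_def[OF k \<delta> H N_meas N_stop]
      by (simp add: \<tau>_def H_def on_cube_eq ennreal_mult'[symmetric] mult_ac)
  qed
  also have "\<dots> = bellman \<mu> k \<delta> H m \<pi>"
  proof (intro stopped_cost_eq_bellman[OF k \<delta> H N_meas N_stop] N_le)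
    show "bellman \<mu> k \<delta> H (m - N \<omega>) (post \<pi> (real (N \<omega>) * \<delta>) \<omega>) = H (post \<pi> (real (N \<omega>) * \<delta>) \<omega>)" for \<omega>
      using QN[of \<omega>] unfolding Q_def by auto
    show "bellman \<mu> k \<delta> H (m - j) (post \<pi> (real j * \<delta>) \<omega>) \<noteq> H (post \<pi> (real j * \<delta>) \<omega>)" if "j < N \<omega>" for \<omega> j
      using notQ[OF that] unfolding Q_def by simp
  qed
  finally show ?thesis by (simp add: H_def)
qed

text \<open>An arbitrary stopping time is rounded up to mesh \<open>1 / 2 ^ n\<close> and cut off
  after \<open>m\<close> steps. The error is at most \<open>k / 2 ^ n\<close> of running cost, plus
  \<open>C\<close> on the event that the cutoff acts. First \<open>m\<close>, then \<open>n\<close>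
  tends to infinity, using finiteness of the time and then continuity of paths and payoff.\<close>

lemma bellman_limit_le_cost:
  assumes k: "k > 0" and h: "continuous_on prior_cube h" and C: "\<And>p. p \<in> prior_cube \<Longrightarrow> h p \<le> C"
    and \<tau>: "\<tau> \<in> admissible_times \<pi>"
  shows "bellman_limit \<mu> k (on_cube h) \<pi> \<le>
    (\<integral>\<^sup>+\<omega>. ennreal (h (post \<pi> (enn2real (\<tau> \<omega>)) \<omega>)) + ennreal k * \<tau> \<omega> \<partial>P \<pi>)"
proof -
  define H where "H = on_cube h"
  have H [measurable]: "H \<in> borel_measurable borel" unfolding H_def by (rule measurable_on_cube[OF h])
  have HC: "H p \<le> ennreal C" for p
    using C[of p] by (cases "p \<in> prior_cube") (simp_all add: H_def on_cube_def ennreal_leI)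
  have stop: "stopping_time FX \<tau>" and fin: "AE \<omega> in P \<pi>. \<tau> \<omega> < \<infinity>"
    using \<tau> by (auto simp: admissible_times_def)
  have \<tau>_le: "{\<omega> \<in> space S. \<tau> \<omega> \<le> t} \<in> sets (FX t)" for t
    using stopping_timeD[OF stop, of t] by (simp add: Measurable.pred_def)
  have [measurable]: "\<tau> \<in> borel_measurable (P \<pi>)"
    by (rule measurable_stopping_time[OF stop sets_FX_subset[OF \<pi>]]) (simp add: space_P[OF \<pi>])
  define \<sigma> where "\<sigma> n \<omega> = real (nat \<lceil>enn2real (\<tau> \<omega>) * 2 ^ n\<rceil>) * (1 / 2 ^ n)" for n \<omega>
  have post_\<sigma> [measurable]: "(\<lambda>\<omega>. post \<pi> (\<sigma> n \<omega>) \<omega>) \<in> borel_measurable (P \<pi>)" for n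
    unfolding \<sigma>_def
  proof (rule measurable_compose_countable[where g="\<lambda>\<omega>. nat \<lceil>enn2real (\<tau> \<omega>) * 2 ^ n\<rceil>"])
    show "(\<lambda>\<omega>. nat \<lceil>enn2real (\<tau> \<omega>) * 2 ^ n\<rceil>) \<in> measurable (P \<pi>) (count_space UNIV)"
      by measurable
    show "(\<lambda>\<omega>. post \<pi> (real i * (1 / 2 ^ n)) \<omega>) \<in> borel_measurable (P \<pi>)" for i
      by (rule measurable_post[OF \<pi>]) simp
  qed
  have grid_bound: "bellman \<mu> k (1 / 2 ^ n) H m \<pi> \<le>
      (\<integral>\<^sup>+\<omega>. H (post \<pi> (\<sigma> n \<omega>) \<omega>) + ennreal k * \<tau> \<omega> + ennreal (k / 2 ^ n) +
        ennreal C * indicator {\<omega> \<in> space S. ennreal (real m / 2 ^ n) < \<tau> \<omega>} \<omega> \<partial>P \<pi>)" for n m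
  proof -
    let ?\<delta> = "1 / 2 ^ n :: real"
    have \<delta>: "?\<delta> > 0" by simp
    \<comment> \<open>\<open>Suc m\<close> signals that the horizon comes first;
      \<open>mixed_cost\<close> at step \<open>m\<close> then charges the payoff at the
      horizon.\<close>
    define N where "N \<omega> = (if \<tau> \<omega> \<le> ennreal (real m * ?\<delta>) then nat \<lceil>enn2real (\<tau> \<omega>) * 2 ^ n\<rceil> else Suc m)" for \<omega>
    have N_meas: "N \<in> measurable (P \<pi>) (count_space UNIV)" unfolding N_def by measurable
    have N_iff: "N \<omega> \<le> j \<longleftrightarrow> \<tau> \<omega> \<le> ennreal (real j * ?\<delta>)" if "j \<le> m" for j \<omega>
    proof (cases "\<tau> \<omega> \<le> ennreal (real m * ?\<delta>)")
      case True
      then have "\<tau> \<omega> < \<top>" using ennreal_less_top le_less_trans by blast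
      then obtain t where t: "\<tau> \<omega> = ennreal t" "0 \<le> t" by (cases "\<tau> \<omega>") auto
      have "N \<omega> \<le> j \<longleftrightarrow> \<lceil>t * 2 ^ n\<rceil> \<le> int j" using True t by (simp add: N_def nat_le_iff)
      also have "\<dots> \<longleftrightarrow> t * 2 ^ n \<le> real j" by (simp add: ceiling_le_iff)
      also have "\<dots> \<longleftrightarrow> t \<le> real j * ?\<delta>" by (simp add: field_simps)
      finally show ?thesis using t by (simp add: ennreal_le_iff)
    next
      case False
      moreover have "ennreal (real j * ?\<delta>) \<le> ennreal (real m * ?\<delta>)"
        using that by (intro ennreal_leI mult_right_mono) auto
      ultimately have "\<not> \<tau> \<omega> \<le> ennreal (real j * ?\<delta>)" by (metis order_trans)
      then show ?thesis using that False by (simp add: N_def)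
    qed
    have N_stop: "{\<omega> \<in> space S. N \<omega> \<le> j} \<in> sets (FX (ennreal (real j * ?\<delta>)))" if "j < m" for j
      using \<tau>_le N_iff[of j] that by simp
    have stopped: "stopped_cost k ?\<delta> H N \<omega> = H (post \<pi> (real (N \<omega>) * ?\<delta>) \<omega>) + ennreal (k * ?\<delta> * real (N \<omega>))" for \<omega>
      by (rule stopped_cost_def[OF less_imp_le[OF k] \<delta> H N_meas N_stop])
    have mixed: "mixed_cost k ?\<delta> H N m m \<omega> = (if N \<omega> \<le> m then stopped_cost k ?\<delta> H N \<omega>
        else bellman \<mu> k ?\<delta> H (m - m) (post \<pi> (real m * ?\<delta>) \<omega>) + ennreal (k * ?\<delta> * real m))" for \<omega>
      by (rule mixed_cost_def[OF less_imp_le[OF k] \<delta> H N_meas N_stop])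
    have "bellman \<mu> k ?\<delta> H m \<pi> \<le> (\<integral>\<^sup>+\<omega>. mixed_cost k ?\<delta> H N m m \<omega> \<partial>P \<pi>)"
      by (rule bellman_le_mixed_cost[OF less_imp_le[OF k] \<delta> H N_meas N_stop])
    also have "\<dots> \<le> (\<integral>\<^sup>+\<omega>. H (post \<pi> (\<sigma> n \<omega>) \<omega>) + ennreal k * \<tau> \<omega> + ennreal (k / 2 ^ n) +
        ennreal C * indicator {\<omega> \<in> space S. ennreal (real m / 2 ^ n) < \<tau> \<omega>} \<omega> \<partial>P \<pi>)"
    proof (rule nn_integral_mono)
      fix \<omega> assume w: "\<omega> \<in> space (P \<pi>)"
      show "mixed_cost k ?\<delta> H N m m \<omega> \<le> H (post \<pi> (\<sigma> n \<omega>) \<omega>) + ennreal k * \<tau> \<omega> + ennreal (k / 2 ^ n) +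
        ennreal C * indicator {\<omega> \<in> space S. ennreal (real m / 2 ^ n) < \<tau> \<omega>} \<omega>"
      proof (cases "N \<omega> \<le> m")
        case True
        then have le: "\<tau> \<omega> \<le> ennreal (real m * ?\<delta>)" using N_iff[of m] by simp
        then have "\<tau> \<omega> < \<top>" using ennreal_less_top le_less_trans by blast
        then obtain t where t: "\<tau> \<omega> = ennreal t" "0 \<le> t" by (cases "\<tau> \<omega>") auto
        have N\<sigma>: "real (N \<omega>) * ?\<delta> = \<sigma> n \<omega>" using le by (simp add: N_def \<sigma>_def)
        have "\<sigma> n \<omega> \<le> t + 1 / 2 ^ n" using dyadic_ceiling(2)[OF t(2), of n] t by (simp add: \<sigma>_def)
        then have "k * ?\<delta> * real (N \<omega>) \<le> k * t + k / 2 ^ n"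
          using k mult_left_mono[of "\<sigma> n \<omega>" "t + 1 / 2 ^ n" k]
          by (simp add: N\<sigma>[symmetric] distrib_left)
        then have "ennreal (k * ?\<delta> * real (N \<omega>)) \<le> ennreal k * \<tau> \<omega> + ennreal (k / 2 ^ n)"
          using k t by (simp add: ennreal_mult'[symmetric] ennreal_plus[symmetric] ennreal_leI del: ennreal_plus)
        then have "stopped_cost k ?\<delta> H N \<omega> \<le> H (post \<pi> (\<sigma> n \<omega>) \<omega>) + ennreal k * \<tau> \<omega> + ennreal (k / 2 ^ n)"
          unfolding stopped N\<sigma> add.assoc by (rule add_left_mono)
        then show ?thesis using True unfolding mixed by (simp add: add_increasing2)
      next
        case False
        then have less: "ennreal (real m * ?\<delta>) < \<tau> \<omega>" using N_iff[of m] by simp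
        then have "ennreal (k * ?\<delta> * real m) \<le> ennreal k * \<tau> \<omega>"
          using k mult_left_mono[OF less_imp_le[OF less], of "ennreal k"]
          by (simp add: ennreal_mult'[symmetric] mult_ac)
        then have "ennreal (k * ?\<delta> * real m) + H (post \<pi> (real m * ?\<delta>) \<omega>) \<le> ennreal k * \<tau> \<omega> + ennreal C"
          using HC by (intro add_mono)
        also have "\<dots> \<le> H (post \<pi> (\<sigma> n \<omega>) \<omega>) + ennreal k * \<tau> \<omega> + ennreal (k / 2 ^ n) + ennreal C"
          by (intro add_right_mono) (simp add: add_increasing add_increasing2)
        finally show ?thesis using False less w
          unfolding mixed by (simp add: space_P[OF \<pi>] add.commute)
      qed
    qed
    finally show ?thesis .
  qed
  let ?I = "\<lambda>n. \<integral>\<^sup>+\<omega>. H (post \<pi> (\<sigma> n \<omega>) \<omega>) \<partial>P \<pi>" and ?K = "\<integral>\<^sup>+\<omega>. ennreal k * \<tau> \<omega> \<partial>P \<pi>"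
  \<comment> \<open>Horizon to infinity at a fixed mesh: as the time is almost surely finite, the
    events where the cutoff acts decrease to a null set.\<close>
  have bound_n: "bellman_limit \<mu> k H \<pi> \<le> ?I n + ?K + ennreal (k / 2 ^ n)" for n
  proof (rule LIMSEQ_le_const)
    let ?A = "\<lambda>m. {\<omega> \<in> space (P \<pi>). ennreal (real m / 2 ^ n) < \<tau> \<omega>}"
    have [measurable]: "?A m \<in> events" for m by measurable
    have "(\<lambda>m. emeasure (P \<pi>) (?A m)) \<longlonglongrightarrow> emeasure (P \<pi>) (\<Inter>m. ?A m)"
    proof (rule Lim_emeasure_decseq)
      show "decseq ?A"
      proof (rule decseq_SucI, safe)
        fix m \<omega> assume "ennreal (real (Suc m) / 2 ^ n) < \<tau> \<omega>"
        moreover have "ennreal (real m / 2 ^ n) \<le> ennreal (real (Suc m) / 2 ^ n)"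
          by (intro ennreal_leI divide_right_mono) auto
        ultimately show "ennreal (real m / 2 ^ n) < \<tau> \<omega>" by (rule le_less_trans[rotated])
      qed
    qed (auto simp: emeasure_eq_measure)
    moreover have "emeasure (P \<pi>) (\<Inter>m. ?A m) = emeasure (P \<pi>) {}"
    proof (rule emeasure_eq_AE, use fin in eventually_elim)
      case (elim \<omega>)
      then obtain t where t: "\<tau> \<omega> = ennreal t" "0 \<le> t" by (cases "\<tau> \<omega>") auto
      obtain m :: nat where "t * 2 ^ n \<le> real m" using real_arch_simple by blast
      then have "\<tau> \<omega> \<le> ennreal (real m / 2 ^ n)"
        using t by (simp add: field_simps ennreal_leI)
      then show ?case by (auto simp: not_less)
    qed auto
    ultimately have "(\<lambda>m. emeasure (P \<pi>) (?A m)) \<longlonglongrightarrow> 0" by simp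
    from tendsto_add[OF tendsto_const ennreal_tendsto_cmult[OF ennreal_less_top this]]
    show "(\<lambda>m. (?I n + ?K + ennreal (k / 2 ^ n)) + ennreal C * emeasure (P \<pi>) (?A m)) \<longlonglongrightarrow> ?I n + ?K + ennreal (k / 2 ^ n)"
      by fastforce
    have "bellman_limit \<mu> k H \<pi> \<le> ?I n + ?K + ennreal (k / 2 ^ n) + ennreal C * emeasure (P \<pi>) (?A m)" for m
    proof -
      have "bellman_limit \<mu> k H \<pi> \<le> bellman \<mu> k (1 / 2 ^ n) H m \<pi>"
        unfolding bellman_limit_def by (intro INF_lower2[of n] INF_lower2[of m]) auto
      also note grid_bound
      also have "(\<integral>\<^sup>+\<omega>. H (post \<pi> (\<sigma> n \<omega>) \<omega>) + ennreal k * \<tau> \<omega> + ennreal (k / 2 ^ n) +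
          ennreal C * indicator {\<omega> \<in> space S. ennreal (real m / 2 ^ n) < \<tau> \<omega>} \<omega> \<partial>P \<pi>) =
          ?I n + ?K + ennreal (k / 2 ^ n) + ennreal C * emeasure (P \<pi>) (?A m)"
        unfolding space_P[OF \<pi>, symmetric]
        by (simp add: nn_integral_add nn_integral_cmult_indicator emeasure_space_1)
      finally show ?thesis .
    qed
    then show "\<exists>M. \<forall>m\<ge>M. bellman_limit \<mu> k H \<pi> \<le> ?I n + ?K + ennreal (k / 2 ^ n) + ennreal C * emeasure (P \<pi>) (?A m)"
      by blast
  qed
  \<comment> \<open>A measurable event of full probability on which the time is finite and the path
    stays in the cube. On it the stopped payoff is a pointwise limit of measurable functions, which
    is how its measurability is obtained.\<close>
  obtain E where E: "E \<in> events" "AE \<omega> in P \<pi>. \<omega> \<in> E"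
    "\<And>\<omega>. \<omega> \<in> E \<Longrightarrow> \<tau> \<omega> < \<infinity> \<and> (\<forall>t\<ge>0. post \<pi> t \<omega> \<in> prior_cube)"
  proof -
    have "AE \<omega> in P \<pi>. \<tau> \<omega> < \<infinity> \<and> (\<forall>t\<ge>0. post \<pi> t \<omega> \<in> prior_cube)"
      using fin post_in_cube by eventually_elim simp
    then obtain N0 where "N0 \<in> null_sets (P \<pi>)"
      "{\<omega> \<in> space (P \<pi>). \<not> (\<tau> \<omega> < \<infinity> \<and> (\<forall>t\<ge>0. post \<pi> t \<omega> \<in> prior_cube))} \<subseteq> N0"
      by (auto simp: eventually_ae_filter)
    then show ?thesis
      by (intro that[of "space (P \<pi>) - N0"]) (auto intro: AE_not_in[THEN AE_mp] sets.Diff)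
  qed
  note [measurable] = E(1)
  have conv: "(\<lambda>n. H (post \<pi> (\<sigma> n \<omega>) \<omega>) * indicator E \<omega>) \<longlonglongrightarrow>
      ennreal (h (post \<pi> (enn2real (\<tau> \<omega>)) \<omega>)) * indicator E \<omega>" if w: "\<omega> \<in> space (P \<pi>)" for \<omega>
  proof (cases "\<omega> \<in> E")
    case True
    have cube: "post \<pi> t \<omega> \<in> prior_cube" if "t \<ge> 0" for t using E(3)[OF True] that by blast
    have \<sigma>: "\<sigma> n \<omega> \<ge> 0" for n
      unfolding \<sigma>_def by (rule mult_nonneg_nonneg[OF of_nat_0_le_iff]) simp
    have "continuous_on {0..} (\<lambda>t. post \<pi> t \<omega>)"
      using w by (intro post_continuous[OF \<pi>]) (simp add: space_P[OF \<pi>])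
    moreover have "(\<lambda>n. \<sigma> n \<omega>) \<longlonglongrightarrow> enn2real (\<tau> \<omega>)"
      unfolding \<sigma>_def by (rule dyadic_ceiling_tendsto) simp
    ultimately have "(\<lambda>n. post \<pi> (\<sigma> n \<omega>) \<omega>) \<longlonglongrightarrow> post \<pi> (enn2real (\<tau> \<omega>)) \<omega>"
      by (rule continuous_on_tendsto_compose) (simp_all add: \<sigma>)
    then have "(\<lambda>n. h (post \<pi> (\<sigma> n \<omega>) \<omega>)) \<longlonglongrightarrow> h (post \<pi> (enn2real (\<tau> \<omega>)) \<omega>)"
      by (rule continuous_on_tendsto_compose[OF h]) (simp_all add: cube \<sigma>)
    then show ?thesis using True by (simp add: H_def on_cube_eq cube \<sigma> tendsto_ennrealI)
  qed simp
  have meas_lim [measurable]: "(\<lambda>\<omega>. ennreal (h (post \<pi> (enn2real (\<tau> \<omega>)) \<omega>)) * indicator E \<omega>) \<in> borel_measurable (P \<pi>)"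
    by (rule borel_measurable_LIMSEQ_order[OF conv]) measurable
  let ?I' = "\<integral>\<^sup>+\<omega>. ennreal (h (post \<pi> (enn2real (\<tau> \<omega>)) \<omega>)) * indicator E \<omega> \<partial>P \<pi>"
  have "(\<lambda>n. \<integral>\<^sup>+\<omega>. H (post \<pi> (\<sigma> n \<omega>) \<omega>) * indicator E \<omega> \<partial>P \<pi>) \<longlonglongrightarrow> ?I'"
  proof (rule nn_integral_dominated_convergence[where w="\<lambda>_. ennreal C"])
    show "AE \<omega> in P \<pi>. H (post \<pi> (\<sigma> n \<omega>) \<omega>) * indicator E \<omega> \<le> ennreal C" for n
      using HC by (intro always_eventually) (simp add: indicator_def)
  qed (use conv in \<open>auto simp: emeasure_space_1\<close>)
  moreover have "?I n = (\<integral>\<^sup>+\<omega>. H (post \<pi> (\<sigma> n \<omega>) \<omega>) * indicator E \<omega> \<partial>P \<pi>)" for n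
    by (intro nn_integral_cong_AE, use E(2) in eventually_elim) simp
  ultimately have I: "?I \<longlonglongrightarrow> ?I'" by simp
  have "(\<lambda>n. k * (1 / 2) ^ n) \<longlonglongrightarrow> k * 0" by (intro tendsto_intros LIMSEQ_power_zero) simp
  then have "(\<lambda>n. ennreal (k / 2 ^ n)) \<longlonglongrightarrow> 0"
    using tendsto_ennrealI by (fastforce simp: power_divide)
  from tendsto_add[OF tendsto_add[OF I tendsto_const[of ?K]] this]
  have "bellman_limit \<mu> k H \<pi> \<le> ?I' + ?K"
    using bound_n by (intro LIMSEQ_le_const) auto
  also have "?I' + ?K = (\<integral>\<^sup>+\<omega>. ennreal (h (post \<pi> (enn2real (\<tau> \<omega>)) \<omega>)) * indicator E \<omega> + ennreal k * \<tau> \<omega> \<partial>P \<pi>)"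
    by (subst nn_integral_add) auto
  also have "\<dots> = (\<integral>\<^sup>+\<omega>. ennreal (h (post \<pi> (enn2real (\<tau> \<omega>)) \<omega>)) + ennreal k * \<tau> \<omega> \<partial>P \<pi>)"
    by (intro nn_integral_cong_AE, use E(2) in eventually_elim) simp
  finally show ?thesis by (simp add: H_def)
qed

text \<open>The two bounds combined. The right-hand side refers to the kernel only, so from here on
  values from different models can be compared.\<close>

lemma testing_value_eq_bellman_limit:
  assumes k: "k > 0" and h: "continuous_on prior_cube h" and C: "\<And>p. p \<in> prior_cube \<Longrightarrow> h p \<le> C"
  shows "testing_value k h \<pi> = enn2real (bellman_limit \<mu> k (on_cube h) \<pi>)"
proof -
  let ?V = "INF \<tau> \<in> admissible_times \<pi>.
     \<integral>\<^sup>+\<omega>. ennreal (h (post \<pi> (enn2real (\<tau> \<omega>)) \<omega>)) + ennreal k * \<tau> \<omega> \<partial>P \<pi>"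
  have "?V \<le> bellman_limit \<mu> k (on_cube h) \<pi>"
    unfolding bellman_limit_def using k by (intro INF_greatest inf_le_bellman h) auto
  moreover have "bellman_limit \<mu> k (on_cube h) \<pi> \<le> ?V"
    by (intro INF_greatest bellman_limit_le_cost[OF k h C])
  ultimately show ?thesis by (simp add: testing_value_def)
qed

end

end

section \<open>Concavity, reflection and refinement of the recursions\<close>

lemma bayes_vec_in_cube: "p \<in> prior_cube \<Longrightarrow> (\<chi> i. bayes \<mu> \<delta> (p $ i) (z i)) \<in> prior_cube"
  using bayes_in_unit[OF prior_cubeD, of p] by (subst prior_cube_def) simp

lemma belief_step_mono:
  assumes "p \<in> prior_cube" "\<And>q. q \<in> prior_cube \<Longrightarrow> f q \<le> g q"
  shows "belief_step \<mu> \<delta> f p \<le> belief_step \<mu> \<delta> g p"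
  unfolding belief_step_def
  by (intro nn_integral_mono mult_right_mono assms(2) bayes_vec_in_cube assms(1)) simp

lemma belief_step_const:
  fixes p :: "real^'n::finite"
  assumes "\<delta> > 0" "p \<in> prior_cube"
  shows "belief_step \<mu> \<delta> (\<lambda>_. c) p = c"
proof -
  interpret product_sigma_finite "\<lambda>_::'n. gauss \<delta>" by (rule product_sigma_finite_gauss) fact
  have "belief_step \<mu> \<delta> (\<lambda>_. c) p =
      c * (\<integral>\<^sup>+z. (\<Prod>i\<in>UNIV. ennreal (evidence \<mu> \<delta> (p $ i) (z i))) \<partial>PiM UNIV (\<lambda>_. gauss \<delta>))"
    unfolding belief_step_def by (rule nn_integral_cmult) measurable
  also have "\<dots> = c"
    using nn_integral_evidence[OF assms(1) prior_cubeD[OF assms(2)]]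
    by (subst product_nn_integral_prod) auto
  finally show ?thesis .
qed

lemma belief_step_add_const:
  assumes "\<delta> > 0" "p \<in> prior_cube" and [measurable]: "f \<in> borel_measurable borel"
  shows "belief_step \<mu> \<delta> (\<lambda>q. f q + c) p = belief_step \<mu> \<delta> f p + c"
proof -
  have "belief_step \<mu> \<delta> (\<lambda>q. f q + c) p = belief_step \<mu> \<delta> f p + belief_step \<mu> \<delta> (\<lambda>_. c) p"
    unfolding belief_step_def distrib_right by (rule nn_integral_add) measurable
  then show ?thesis using belief_step_const[OF assms(1,2)] by simp
qed

lemma bellman_antimono:
  assumes "p \<in> prior_cube"
  shows "bellman \<mu> k \<delta> H (Suc m) p \<le> bellman \<mu> k \<delta> H m p"
  using assms
proof (induction m arbitrary: p)
  case (Suc m)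
  have "belief_step \<mu> \<delta> (bellman \<mu> k \<delta> H (Suc m)) p \<le> belief_step \<mu> \<delta> (bellman \<mu> k \<delta> H m) p"
    using Suc by (intro belief_step_mono) auto
  then show ?case unfolding bellman.simps(2)[of _ _ _ _ "Suc m"] bellman.simps(2)[of _ _ _ _ m]
    by (intro min.mono add_right_mono order_refl)
qed simp

lemma bellman_antimono':
  assumes "p \<in> prior_cube" "m \<le> m'"
  shows "bellman \<mu> k \<delta> H m' p \<le> bellman \<mu> k \<delta> H m p"
  using assms(2)
proof (induction rule: dec_induct)
  case (step n)
  show ?case by (rule order_trans[OF bellman_antimono[OF assms(1)] step(3)])
qed simp

lemma bellman_limit_le_bellman: "bellman_limit \<mu> k H p \<le> bellman \<mu> k (1 / 2 ^ n) H m p"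
  unfolding bellman_limit_def by (intro INF_lower2[of n] INF_lower2[of m]) auto

lemma bellman_limit_le: "bellman_limit \<mu> k H p \<le> H p"
  using bellman_limit_le_bellman[of \<mu> k H p 0 0] by simp

section \<open>Reflection of one coordinate of the prior\<close>

definition reflect :: "'n \<Rightarrow> real^'n \<Rightarrow> real^'n::finite" where
  "reflect i p = (\<chi> j. if j = i then 1 - p $ j else p $ j)"

lemma reflect_in_cube: "p \<in> prior_cube \<Longrightarrow> reflect i p \<in> prior_cube"
  by (simp add: prior_cube_def reflect_def)

text \<open>Fubini isolates the increment of coordinate \<open>i\<close>; the identity
  \<open>nn_integral_gauss_reflect\<close> is then applied to the inner integral, with the other
  increments held fixed.\<close>

lemma belief_step_reflect:
  fixes f :: "real^'n::finite \<Rightarrow> ennreal"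
  assumes "\<delta> > 0" "p \<in> prior_cube" and [measurable]: "f \<in> borel_measurable borel"
    and sym: "\<And>q. q \<in> prior_cube \<Longrightarrow> f (reflect i q) = f q"
  shows "belief_step \<mu> \<delta> f (reflect i p) = belief_step \<mu> \<delta> f p"
proof -
  interpret product_sigma_finite "\<lambda>_::'n. gauss \<delta>" by (rule product_sigma_finite_gauss) fact
  define R where "R x = (\<Prod>j\<in>UNIV - {i}. ennreal (evidence \<mu> \<delta> (p $ j) (x j)))" for x :: "'n \<Rightarrow> real"
  define F where "F x b = f (\<chi> j. if j = i then b else bayes \<mu> \<delta> (p $ j) (x j))" for x :: "'n \<Rightarrow> real" and b
  have Fm: "F x \<in> borel_measurable borel" for x
  proof -
    have [measurable]: "(\<lambda>b. \<chi> j. if j = i then b else bayes \<mu> \<delta> (p $ j) (x j)) \<in> borel_measurable borel"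
      by (rule borel_measurable_vecI) (simp split: if_split)
    show ?thesis unfolding F_def[abs_def] by measurable
  qed
  have fold: "belief_step \<mu> \<delta> f q =
      (\<integral>\<^sup>+x. R x * (\<integral>\<^sup>+y. F x (bayes \<mu> \<delta> (q $ i) y) * ennreal (evidence \<mu> \<delta> (q $ i) y) \<partial>gauss \<delta>)
        \<partial>PiM (UNIV - {i}) (\<lambda>_. gauss \<delta>))"
    if q: "\<And>j. j \<noteq> i \<Longrightarrow> q $ j = p $ j" for q
  proof -
    have U: "UNIV = insert i (UNIV - {i})" by auto
    let ?h = "\<lambda>z. f (\<chi> i. bayes \<mu> \<delta> (q $ i) (z i)) * (\<Prod>i\<in>UNIV. ennreal (evidence \<mu> \<delta> (q $ i) (z i)))"
    have "?h \<in> borel_measurable (PiM UNIV (\<lambda>_. gauss \<delta>))" by measurable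
    then have hm: "?h \<in> borel_measurable (PiM (insert i (UNIV - {i})) (\<lambda>_. gauss \<delta>))" by (simp add: U[symmetric])
    have "belief_step \<mu> \<delta> f q = (\<integral>\<^sup>+z. ?h z \<partial>PiM (insert i (UNIV - {i})) (\<lambda>_. gauss \<delta>))"
      unfolding belief_step_def U[symmetric] ..
    also have "\<dots> = (\<integral>\<^sup>+x. \<integral>\<^sup>+y. ?h (x(i := y)) \<partial>gauss \<delta> \<partial>PiM (UNIV - {i}) (\<lambda>_. gauss \<delta>))"
      by (rule product_nn_integral_insert[OF _ _ hm]) auto
    also have "\<dots> = (\<integral>\<^sup>+x. \<integral>\<^sup>+y. R x * (F x (bayes \<mu> \<delta> (q $ i) y) * ennreal (evidence \<mu> \<delta> (q $ i) y))
        \<partial>gauss \<delta> \<partial>PiM (UNIV - {i}) (\<lambda>_. gauss \<delta>))"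
    proof (intro nn_integral_cong)
      fix x :: "'n \<Rightarrow> real" and y
      have "f (\<chi> j. bayes \<mu> \<delta> (q $ j) ((x(i := y)) j)) = F x (bayes \<mu> \<delta> (q $ i) y)"
        unfolding F_def by (rule arg_cong[where f=f]) (simp add: vec_eq_iff q)
      moreover have "(\<Prod>j\<in>UNIV. ennreal (evidence \<mu> \<delta> (q $ j) ((x(i := y)) j))) =
          ennreal (evidence \<mu> \<delta> (q $ i) y) * R x"
        unfolding R_def by (subst prod.remove[of UNIV i]) (auto intro!: arg_cong2[where f="(*)"] prod.cong simp: q)
      ultimately show "?h (x(i := y)) = R x * (F x (bayes \<mu> \<delta> (q $ i) y) * ennreal (evidence \<mu> \<delta> (q $ i) y))"
        by (simp add: mult_ac)
    qed
    also have "\<dots> = (\<integral>\<^sup>+x. R x * (\<integral>\<^sup>+y. F x (bayes \<mu> \<delta> (q $ i) y) * ennreal (evidence \<mu> \<delta> (q $ i) y) \<partial>gauss \<delta>)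
        \<partial>PiM (UNIV - {i}) (\<lambda>_. gauss \<delta>))"
    proof (intro nn_integral_cong nn_integral_cmult)
      fix x :: "'n \<Rightarrow> real"
      note [measurable] = Fm[of x]
      show "(\<lambda>y. F x (bayes \<mu> \<delta> (q $ i) y) * ennreal (evidence \<mu> \<delta> (q $ i) y)) \<in> borel_measurable (gauss \<delta>)"
        by measurable
    qed
    finally show ?thesis .
  qed
  have pi: "p $ i \<in> {0..1}" by (rule prior_cubeD) fact
  have F_sym: "F x (1 - bayes \<mu> \<delta> (p $ i) y) = F x (bayes \<mu> \<delta> (p $ i) y)" for x y
  proof -
    let ?q = "\<chi> j. if j = i then bayes \<mu> \<delta> (p $ i) y else bayes \<mu> \<delta> (p $ j) (x j)"
    have "?q \<in> prior_cube"
      using bayes_in_unit[OF prior_cubeD[OF assms(2)]] by (subst prior_cube_def) simp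
    then have "f (reflect i ?q) = f ?q" by (rule sym)
    moreover have "reflect i ?q = (\<chi> j. if j = i then 1 - bayes \<mu> \<delta> (p $ i) y else bayes \<mu> \<delta> (p $ j) (x j))"
      by (simp add: reflect_def vec_eq_iff)
    ultimately show ?thesis by (simp add: F_def)
  qed
  have "belief_step \<mu> \<delta> f (reflect i p) =
      (\<integral>\<^sup>+x. R x * (\<integral>\<^sup>+y. F x (bayes \<mu> \<delta> (1 - p $ i) y) * ennreal (evidence \<mu> \<delta> (1 - p $ i) y) \<partial>gauss \<delta>)
        \<partial>PiM (UNIV - {i}) (\<lambda>_. gauss \<delta>))"
    by (subst fold) (simp_all add: reflect_def)
  also have "\<dots> = belief_step \<mu> \<delta> f p"
    by (subst fold) (simp_all add: nn_integral_gauss_reflect[OF assms(1) pi Fm] F_sym)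
  finally show ?thesis .
qed

lemma bellman_limit_reflect:
  assumes [measurable]: "H \<in> borel_measurable borel"
    and sym: "\<And>q. q \<in> prior_cube \<Longrightarrow> H (reflect i q) = H q" and "p \<in> prior_cube"
  shows "bellman_limit \<mu> k H (reflect i p) = bellman_limit \<mu> k H p"
proof -
  have "bellman \<mu> k (1 / 2 ^ n) H m (reflect i p) = bellman \<mu> k (1 / 2 ^ n) H m p" for n m
    using assms(3)
  proof (induction m arbitrary: p)
    case (Suc m)
    then show ?case
      by (simp add: sym belief_step_reflect[OF _ _ measurable_bellman])
  qed (simp add: sym)
  then show ?thesis by (simp add: bellman_limit_def)
qed

text \<open>Concavity along one axis only, which suits the kernel: the product of weights in
  \<open>belief_step\<close> is affine in each coordinate of the prior separately.\<close>

definition coordinate_concave :: "'n \<Rightarrow> (real^'n::finite \<Rightarrow> ennreal) \<Rightarrow> bool" where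
  "coordinate_concave i f \<longleftrightarrow> (\<forall>p\<in>prior_cube. \<forall>q\<in>prior_cube. \<forall>t\<in>{0..1}. (\<forall>j. j \<noteq> i \<longrightarrow> p $ j = q $ j) \<longrightarrow>
     ennreal (1 - t) * f p + ennreal t * f q \<le> f ((1 - t) *\<^sub>R p + t *\<^sub>R q))"

lemma coordinate_concaveD:
  "coordinate_concave i f \<Longrightarrow> p \<in> prior_cube \<Longrightarrow> q \<in> prior_cube \<Longrightarrow> t \<in> {0..1} \<Longrightarrow>
    (\<And>j. j \<noteq> i \<Longrightarrow> p $ j = q $ j) \<Longrightarrow>
    ennreal (1 - t) * f p + ennreal t * f q \<le> f ((1 - t) *\<^sub>R p + t *\<^sub>R q)"
  unfolding coordinate_concave_def by blast

lemma coordinate_concave_min: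
  assumes "coordinate_concave i f" "coordinate_concave i g"
  shows "coordinate_concave i (\<lambda>p. min (f p) (g p))"
  unfolding coordinate_concave_def
proof (intro ballI impI)
  fix p q :: "real^'a" and t :: real
  assume *: "p \<in> prior_cube" "q \<in> prior_cube" "t \<in> {0..1}" "\<forall>j. j \<noteq> i \<longrightarrow> p $ j = q $ j"
  have "ennreal (1 - t) * min (f p) (g p) + ennreal t * min (f q) (g q) \<le> ennreal (1 - t) * f p + ennreal t * f q"
    by (intro add_mono mult_left_mono) auto
  also have "\<dots> \<le> f ((1 - t) *\<^sub>R p + t *\<^sub>R q)" using * by (intro coordinate_concaveD[OF assms(1)]) auto
  finally have f: "ennreal (1 - t) * min (f p) (g p) + ennreal t * min (f q) (g q) \<le> f ((1 - t) *\<^sub>R p + t *\<^sub>R q)" .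
  have "ennreal (1 - t) * min (f p) (g p) + ennreal t * min (f q) (g q) \<le> ennreal (1 - t) * g p + ennreal t * g q"
    by (intro add_mono mult_left_mono) auto
  also have "\<dots> \<le> g ((1 - t) *\<^sub>R p + t *\<^sub>R q)" using * by (intro coordinate_concaveD[OF assms(2)]) auto
  finally show "ennreal (1 - t) * min (f p) (g p) + ennreal t * min (f q) (g q) \<le>
      min (f ((1 - t) *\<^sub>R p + t *\<^sub>R q)) (g ((1 - t) *\<^sub>R p + t *\<^sub>R q))"
    using f by simp
qed

lemma coordinate_concave_add_const:
  assumes "coordinate_concave i f"
  shows "coordinate_concave i (\<lambda>p. f p + c)"
  unfolding coordinate_concave_def
proof (intro ballI impI)
  fix p q :: "real^'a" and t :: real
  assume *: "p \<in> prior_cube" "q \<in> prior_cube" "t \<in> {0..1}" "\<forall>j. j \<noteq> i \<longrightarrow> p $ j = q $ j"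
  have "c = (ennreal (1 - t) + ennreal t) * c" using *(3) by (simp flip: ennreal_plus)
  then have "ennreal (1 - t) * (f p + c) + ennreal t * (f q + c) = (ennreal (1 - t) * f p + ennreal t * f q) + c"
    by (simp add: distrib_left distrib_right add_ac)
  also have "\<dots> \<le> f ((1 - t) *\<^sub>R p + t *\<^sub>R q) + c"
    using * by (intro add_right_mono coordinate_concaveD[OF assms]) auto
  finally show "ennreal (1 - t) * (f p + c) + ennreal t * (f q + c) \<le> f ((1 - t) *\<^sub>R p + t *\<^sub>R q) + c" .
qed

text \<open>The integrand \<open>evidence * f (bayes \<dots>)\<close> is the perspective of a concave function,
  composed with an affine map of the prior.\<close>

lemma coordinate_concave_belief_step:
  fixes f :: "real^'n::finite \<Rightarrow> ennreal"
  assumes f: "coordinate_concave i f" and [measurable]: "f \<in> borel_measurable borel"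
  shows "coordinate_concave i (belief_step \<mu> \<delta> f)"
  unfolding coordinate_concave_def
proof (intro ballI impI)
  fix p q :: "real^'n" and t :: real
  assume p: "p \<in> prior_cube" and q: "q \<in> prior_cube" and t: "t \<in> {0..1}" and pq: "\<forall>j. j \<noteq> i \<longrightarrow> p $ j = q $ j"
  let ?r = "(1 - t) *\<^sub>R p + t *\<^sub>R q"
  let ?h = "\<lambda>p z. f (\<chi> i. bayes \<mu> \<delta> (p $ i) (z i)) * (\<Prod>i\<in>UNIV. ennreal (evidence \<mu> \<delta> (p $ i) (z i)))"
  have r: "?r $ j = p $ j" if "j \<noteq> i" for j using pq that by (simp add: algebra_simps)
  have "ennreal (1 - t) * ?h p z + ennreal t * ?h q z \<le> ?h ?r z" for z
  proof -
    define R where "R = (\<Prod>j\<in>UNIV - {i}. ennreal (evidence \<mu> \<delta> (p $ j) (z j)))"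
    define e where "e = (\<lambda>x :: real^'n. evidence \<mu> \<delta> (x $ i) (z i))"
    define b where "b = (\<lambda>x :: real^'n. \<chi> j. bayes \<mu> \<delta> (x $ j) (z j))"
    have e_pos: "e p > 0" "e q > 0" unfolding e_def using p q by (auto intro!: evidence_pos prior_cubeD)
    have er: "e ?r = (1 - t) * e p + t * e q" by (simp add: e_def evidence_def algebra_simps)
    then have er_pos: "e ?r > 0"
      using e_pos t by (cases "t = 0") (auto intro: add_nonneg_pos)
    \<comment> \<open>The mixture of the priors \<open>p\<close> and \<open>q\<close> updates to a
      mixture of their posteriors in coordinate \<open>i\<close>, and the weight \<open>t\<close> of
      \<open>q\<close> is revised to its share \<open>s\<close> of the evidence. This is the
      identity behind the perspective.\<close>
    define s where "s = t * e q / e ?r"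
    have s1: "s * e ?r = t * e q" using er_pos by (simp add: s_def)
    have s2: "(1 - s) * e ?r = (1 - t) * e p"
      using s1 er left_diff_distrib[of 1 s "e ?r"] by linarith
    have s: "s \<in> {0..1}"
      using er_pos e_pos t er by (auto simp: s_def divide_le_eq_1)
    have be: "(b x $ i) * e x = x $ i * likelihood_ratio \<mu> \<delta> (z i)" if "e x > 0" for x
      using that by (simp add: b_def e_def bayes_def)
    have "(b ?r $ i) * e ?r = ((1 - s) * b p $ i + s * b q $ i) * e ?r"
    proof -
      have "((1 - s) * b p $ i + s * b q $ i) * e ?r = b p $ i * ((1 - s) * e ?r) + b q $ i * (s * e ?r)"
        by (simp add: algebra_simps)
      also have "\<dots> = (1 - t) * (b p $ i * e p) + t * (b q $ i * e q)"
        unfolding s1 s2 by (simp add: algebra_simps)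
      finally show ?thesis unfolding be[OF er_pos] be[OF e_pos(1)] be[OF e_pos(2)] by (simp add: algebra_simps)
    qed
    then have bi: "b ?r $ i = (1 - s) * b p $ i + s * b q $ i" using er_pos by simp
    have br: "b ?r = (1 - s) *\<^sub>R b p + s *\<^sub>R b q"
      unfolding vec_eq_iff
    proof
      fix j
      show "b ?r $ j = ((1 - s) *\<^sub>R b p + s *\<^sub>R b q) $ j"
      proof (cases "j = i")
        case False
        then have "b ?r $ j = b p $ j" "b q $ j = b p $ j" using r[OF False] pq by (simp_all add: b_def)
        then show ?thesis by (simp add: algebra_simps)
      qed (simp add: bi)
    qed
    have conc: "ennreal (1 - s) * f (b p) + ennreal s * f (b q) \<le> f (b ?r)"
      unfolding br using p q s pq
      by (intro coordinate_concaveD[OF f]) (auto simp: b_def bayes_vec_in_cube)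
    have prod: "(\<Prod>j\<in>UNIV. ennreal (evidence \<mu> \<delta> (x $ j) (z j))) = ennreal (e x) * R"
      if "\<And>j. j \<noteq> i \<Longrightarrow> x $ j = p $ j" for x
      unfolding R_def e_def by (subst prod.remove[of UNIV i]) (auto intro!: arg_cong2[where f="(*)"] prod.cong simp: that)
    have hx: "?h x z = f (b x) * (ennreal (e x) * R)" if "\<And>j. j \<noteq> i \<Longrightarrow> x $ j = p $ j" for x
      using prod[of x] that by (simp add: b_def)
    have "ennreal (1 - t) * ?h p z + ennreal t * ?h q z =
        R * (f (b p) * ennreal ((1 - t) * e p) + f (b q) * ennreal (t * e q))"
      using pq t e_pos by (subst (1 2) hx) (auto simp: ennreal_mult' distrib_left mult_ac)
    also have "\<dots> = (ennreal (1 - s) * f (b p) + ennreal s * f (b q)) * (ennreal (e ?r) * R)"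
      unfolding s1[symmetric] s2[symmetric] using s er_pos
      by (simp add: ennreal_mult' distrib_left distrib_right mult_ac)
    also have "\<dots> \<le> f (b ?r) * (ennreal (e ?r) * R)" by (intro mult_right_mono conc) simp
    also have "\<dots> = ?h ?r z" using r by (subst hx) auto
    finally show ?thesis .
  qed
  then have "(\<integral>\<^sup>+z. ennreal (1 - t) * ?h p z + ennreal t * ?h q z \<partial>PiM UNIV (\<lambda>_. gauss \<delta>)) \<le> belief_step \<mu> \<delta> f ?r"
    unfolding belief_step_def by (rule nn_integral_mono)
  moreover have "(\<integral>\<^sup>+z. ennreal (1 - t) * ?h p z + ennreal t * ?h q z \<partial>PiM UNIV (\<lambda>_. gauss \<delta>)) =
      ennreal (1 - t) * belief_step \<mu> \<delta> f p + ennreal t * belief_step \<mu> \<delta> f q"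
    unfolding belief_step_def by (subst nn_integral_add) (auto simp: nn_integral_cmult)
  ultimately show "ennreal (1 - t) * belief_step \<mu> \<delta> f p + ennreal t * belief_step \<mu> \<delta> f q \<le> belief_step \<mu> \<delta> f ?r"
    by simp
qed

lemma coordinate_concave_bellman_limit:
  fixes H :: "real^'n::finite \<Rightarrow> ennreal"
  assumes "coordinate_concave i H" and [measurable]: "H \<in> borel_measurable borel"
  shows "coordinate_concave i (bellman_limit \<mu> k H)"
proof -
  have bell: "coordinate_concave i (bellman \<mu> k (1 / 2 ^ n) H m)" for n m
  proof (induction m)
    case (Suc m)
    then show ?case unfolding bellman.simps
      by (intro coordinate_concave_min assms(1) coordinate_concave_add_const
          coordinate_concave_belief_step measurable_bellman) auto
  qed (simp add: assms)
  show ?thesis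
    unfolding coordinate_concave_def
  proof (intro ballI impI)
    fix p q :: "real^'n" and t :: real
    assume *: "p \<in> prior_cube" "q \<in> prior_cube" "t \<in> {0..1}" "\<forall>j. j \<noteq> i \<longrightarrow> p $ j = q $ j"
    show "ennreal (1 - t) * bellman_limit \<mu> k H p + ennreal t * bellman_limit \<mu> k H q
        \<le> bellman_limit \<mu> k H ((1 - t) *\<^sub>R p + t *\<^sub>R q)"
      unfolding bellman_limit_def[of _ _ _ "(1 - t) *\<^sub>R p + t *\<^sub>R q"]
    proof (intro INF_greatest)
      fix n m
      have "ennreal (1 - t) * bellman_limit \<mu> k H p + ennreal t * bellman_limit \<mu> k H q \<le>
          ennreal (1 - t) * bellman \<mu> k (1 / 2 ^ n) H m p + ennreal t * bellman \<mu> k (1 / 2 ^ n) H m q"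
        by (intro add_mono mult_left_mono bellman_limit_le_bellman) auto
      also have "\<dots> \<le> bellman \<mu> k (1 / 2 ^ n) H m ((1 - t) *\<^sub>R p + t *\<^sub>R q)"
        using * by (intro coordinate_concaveD[OF bell]) auto
      finally show "ennreal (1 - t) * bellman_limit \<mu> k H p + ennreal t * bellman_limit \<mu> k H q
          \<le> bellman \<mu> k (1 / 2 ^ n) H m ((1 - t) *\<^sub>R p + t *\<^sub>R q)" .
    qed
  qed
qed

section \<open>From grid recursions to the one-step inequality for their limit\<close>

context sequential_testing
begin

text \<open>The finer grid can imitate the coarser one by declining to stop at odd steps; two half
  steps of the kernel make a full one by \<open>belief_step_add\<close>.\<close>

lemma bellman_halve:
  fixes H :: "real^'n \<Rightarrow> ennreal"
  assumes "\<delta> > 0" "k \<ge> 0" "p \<in> prior_cube" and H [measurable]: "H \<in> borel_measurable borel"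
  shows "bellman \<mu> k (\<delta> / 2) H (2 * m) p \<le> bellman \<mu> k \<delta> H m p"
  using assms(3)
proof (induction m arbitrary: p)
  case (Suc m)
  let ?b = "bellman \<mu> k (\<delta> / 2) H" and ?c = "ennreal (k * (\<delta> / 2))" and ?Q = "belief_step \<mu> (\<delta> / 2)"
  have d2: "\<delta> / 2 > 0" using assms by simp
  note bm = measurable_bellman[OF d2 H] measurable_bellman[OF assms(1) H] measurable_belief_step[OF d2]
  have "?b (2 * Suc m) p \<le> ?Q (?b (Suc (2 * m))) p + ?c" by simp
  also have "\<dots> \<le> ?Q (\<lambda>q. ?Q (?b (2 * m)) q + ?c) p + ?c"
    using Suc.prems by (intro add_right_mono belief_step_mono) auto
  also have "\<dots> = ?Q (?Q (?b (2 * m))) p + (?c + ?c)"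
    by (subst belief_step_add_const[OF d2 Suc.prems]) (auto intro: bm simp: add.assoc)
  also have "\<dots> \<le> ?Q (?Q (bellman \<mu> k \<delta> H m)) p + (?c + ?c)"
    by (intro add_right_mono belief_step_mono Suc)
  also have "\<dots> = belief_step \<mu> \<delta> (bellman \<mu> k \<delta> H m) p + ennreal (k * \<delta>)"
  proof -
    have "belief_step \<mu> (\<delta> / 2 + \<delta> / 2) (bellman \<mu> k \<delta> H m) p = ?Q (?Q (bellman \<mu> k \<delta> H m)) p"
      by (rule belief_step_add[OF Suc.prems d2 d2 measurable_bellman[OF assms(1) H]])
    moreover have "?c + ?c = ennreal (k * \<delta>)"
      using assms by (subst ennreal_plus[symmetric]) auto
    ultimately show ?thesis by simp
  qed
  finally have "?b (2 * Suc m) p \<le> belief_step \<mu> \<delta> (bellman \<mu> k \<delta> H m) p + ennreal (k * \<delta>)" .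
  then show ?case using bellman_le[of \<mu> k "\<delta> / 2" H "2 * Suc m" p] by simp
qed simp

lemma bellman_refine:
  fixes H :: "real^'n \<Rightarrow> ennreal"
  assumes "k \<ge> 0" "p \<in> prior_cube" "H \<in> borel_measurable borel"
  shows "bellman \<mu> k (1 / 2 ^ (n + d)) H (2 ^ d * m) p \<le> bellman \<mu> k (1 / 2 ^ n) H m p"
proof (induction d)
  case (Suc d)
  have "bellman \<mu> k (1 / 2 ^ (n + Suc d)) H (2 ^ Suc d * m) p =
      bellman \<mu> k (1 / 2 ^ (n + d) / 2) H (2 * (2 ^ d * m)) p" by (simp add: mult_ac)
  also have "\<dots> \<le> bellman \<mu> k (1 / 2 ^ (n + d)) H (2 ^ d * m) p"
    using assms by (intro bellman_halve) auto
  finally show ?case using Suc by (rule order_trans)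
qed simp

text \<open>Never stopping during the first \<open>Suc j\<close> steps is one of the strategies over
  which the recursion minimizes.\<close>

lemma bellman_le_belief_step:
  fixes H :: "real^'n \<Rightarrow> ennreal"
  assumes "\<delta> > 0" "k \<ge> 0" "p \<in> prior_cube" and H: "H \<in> borel_measurable borel"
  shows "bellman \<mu> k \<delta> H (m + Suc j) p \<le>
    belief_step \<mu> (real (Suc j) * \<delta>) (bellman \<mu> k \<delta> H m) p + ennreal (k * (real (Suc j) * \<delta>))"
  using assms(3)
proof (induction j arbitrary: p)
  case (Suc j)
  let ?b = "bellman \<mu> k \<delta> H" and ?t = "real (Suc j) * \<delta>"
  have t: "?t > 0" using assms(1) by simp
  have "?b (m + Suc (Suc j)) p \<le> belief_step \<mu> \<delta> (?b (m + Suc j)) p + ennreal (k * \<delta>)" by simp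
  also have "\<dots> \<le> belief_step \<mu> \<delta> (\<lambda>q. belief_step \<mu> ?t (?b m) q + ennreal (k * ?t)) p + ennreal (k * \<delta>)"
    by (intro add_right_mono belief_step_mono Suc)
  also have "\<dots> = belief_step \<mu> \<delta> (belief_step \<mu> ?t (?b m)) p + (ennreal (k * ?t) + ennreal (k * \<delta>))"
    by (subst belief_step_add_const[OF assms(1) Suc.prems measurable_belief_step[OF t measurable_bellman[OF assms(1) H]]])
       (rule add.assoc)
  also have "\<dots> = belief_step \<mu> (real (Suc (Suc j)) * \<delta>) (?b m) p + ennreal (k * (real (Suc (Suc j)) * \<delta>))"
  proof -
    have "belief_step \<mu> (\<delta> + ?t) (?b m) p = belief_step \<mu> \<delta> (belief_step \<mu> ?t (?b m)) p"
      by (rule belief_step_add[OF Suc.prems assms(1) t measurable_bellman[OF assms(1) H]])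
    moreover have "\<delta> + ?t = real (Suc (Suc j)) * \<delta>" by (simp add: algebra_simps)
    moreover have "ennreal (k * ?t) + ennreal (k * \<delta>) = ennreal (k * (real (Suc (Suc j)) * \<delta>))"
      using assms t by (subst ennreal_plus[symmetric]) (auto simp: algebra_simps)
    ultimately show ?thesis by simp
  qed
  finally show ?case .
qed simp

text \<open>The submartingale inequality for the value: waiting for a dyadic time and acting
  optimally afterwards is one strategy among all. The difficulty is to pull the infimum through the
  integral, for which it is realized along one decreasing sequence.\<close>

lemma bellman_limit_le_belief_step:
  fixes H :: "real^'n \<Rightarrow> ennreal"
  assumes k: "k \<ge> 0" and p: "p \<in> prior_cube" and H [measurable]: "H \<in> borel_measurable borel"
    and C: "\<And>q. q \<in> prior_cube \<Longrightarrow> H q \<le> ennreal C"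
  shows "bellman_limit \<mu> k H p \<le> belief_step \<mu> (1 / 2 ^ n) (bellman_limit \<mu> k H) p + ennreal (k * (1 / 2 ^ n))"
proof -
  let ?\<delta> = "1 / 2 ^ n :: real"
  \<comment> \<open>Mesh \<open>1 / 2 ^ (i + n)\<close> with \<open>4 ^ (i + n)\<close> steps
    reaches time \<open>2 ^ (i + n)\<close>, so mesh and horizon improve together. The offset
    \<open>n\<close> makes \<open>1 / 2 ^ n\<close> a multiple of every mesh used.\<close>
  define w where "w i = bellman \<mu> k (1 / 2 ^ (i + n)) H (4 ^ (i + n))" for i :: nat
  have wm [measurable]: "w i \<in> borel_measurable borel" for i
    unfolding w_def by (rule measurable_bellman) auto
  have w_dec: "w (Suc i) q \<le> w i q" if q: "q \<in> prior_cube" for i q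
  proof -
    have "w (Suc i) q \<le> bellman \<mu> k (1 / 2 ^ (i + n + 1)) H (2 ^ 1 * 4 ^ (i + n)) q"
      unfolding w_def by (simp del: bellman.simps) (rule bellman_antimono'[OF q], simp)
    also have "\<dots> \<le> w i q" unfolding w_def by (rule bellman_refine[OF k q H])
    finally show ?thesis .
  qed
  have w_inf: "(INF i. w i q) = bellman_limit \<mu> k H q" if q: "q \<in> prior_cube" for q
  proof (rule antisym)
    show "(INF i. w i q) \<le> bellman_limit \<mu> k H q"
      unfolding bellman_limit_def
    proof (intro INF_greatest)
      fix a m :: nat
      \<comment> \<open>At this index the mesh is \<open>1 / 2 ^ (a + (m + n))\<close>, so
        \<open>m\<close> steps of mesh \<open>1 / 2 ^ a\<close> take \<open>2 ^ (m + n) * m\<close>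
        fine steps, and \<open>4 ^ (?i + n)\<close> covers them.\<close>
      let ?i = "a + m"
      have "(2::nat) ^ (m + n) * m \<le> 2 ^ (m + n) * 2 ^ m" by (intro mult_left_mono) (auto intro: less_imp_le less_exp)
      also have "\<dots> \<le> 2 ^ (?i + n) * 2 ^ (?i + n)" by (intro mult_mono power_increasing) auto
      also have "\<dots> = 4 ^ (?i + n)" by (simp flip: power_mult_distrib)
      finally have le: "(2::nat) ^ (m + n) * m \<le> 4 ^ (?i + n)" .
      have "(INF i. w i q) \<le> w ?i q" by (rule INF_lower) simp
      also have "\<dots> \<le> bellman \<mu> k (1 / 2 ^ (a + (m + n))) H (2 ^ (m + n) * m) q"
        unfolding w_def add.assoc using le by (intro bellman_antimono' q) (simp add: add.assoc)
      also have "\<dots> \<le> bellman \<mu> k (1 / 2 ^ a) H m q" by (rule bellman_refine[OF k q H])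
      finally show "(INF i. w i q) \<le> bellman \<mu> k (1 / 2 ^ a) H m q" .
    qed
    show "bellman_limit \<mu> k H q \<le> (INF i. w i q)"
      unfolding w_def by (intro INF_greatest bellman_limit_le_bellman)
  qed
  have bound: "bellman_limit \<mu> k H p \<le> belief_step \<mu> ?\<delta> (w i) p + ennreal (k * ?\<delta>)" for i
  proof -
    \<comment> \<open>Exactly \<open>2 ^ i\<close> steps of the fine mesh fill the time
      \<open>1 / 2 ^ n\<close>.\<close>
    have "Suc (2 ^ i - 1) = (2::nat) ^ i" by simp
    then have eq: "real (Suc (2 ^ i - 1)) * (1 / 2 ^ (i + n)) = ?\<delta>"
      by (simp only: of_nat_power of_nat_numeral) (simp add: power_add)
    have "bellman_limit \<mu> k H p \<le> bellman \<mu> k (1 / 2 ^ (i + n)) H (4 ^ (i + n) + Suc (2 ^ i - 1)) p"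
      by (rule bellman_limit_le_bellman)
    also have "\<dots> \<le> belief_step \<mu> (real (Suc (2 ^ i - 1)) * (1 / 2 ^ (i + n))) (w i) p +
        ennreal (k * (real (Suc (2 ^ i - 1)) * (1 / 2 ^ (i + n))))"
      unfolding w_def by (rule bellman_le_belief_step[OF _ k p H]) simp
    finally show ?thesis unfolding eq .
  qed
  have \<delta>: "?\<delta> > 0" by simp
  let ?G = "PiM (UNIV :: 'n set) (\<lambda>_. gauss ?\<delta>)"
  let ?F = "\<lambda>i z. w i (\<chi> j. bayes \<mu> ?\<delta> (p $ j) (z j)) * (\<Prod>j\<in>UNIV. ennreal (evidence \<mu> ?\<delta> (p $ j) (z j)))"
  \<comment> \<open>Monotone convergence from above requires a finite integral to start from; the
    bound \<open>C\<close> on the payoff supplies it.\<close>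
  have int: "(INF i. belief_step \<mu> ?\<delta> (w i) p) = (\<integral>\<^sup>+z. (INF i. ?F i z) \<partial>?G)"
    unfolding belief_step_def
  proof (rule nn_integral_monotone_convergence_INF_AE'[symmetric])
    show "AE z in ?G. ?F (Suc i) z \<le> ?F i z" for i
      by (intro always_eventually allI mult_right_mono w_dec bayes_vec_in_cube p) simp
    show "?F i \<in> borel_measurable ?G" for i by measurable
    have "(\<integral>\<^sup>+z. ?F 0 z \<partial>?G) = belief_step \<mu> ?\<delta> (w 0) p" by (simp add: belief_step_def)
    also have "\<dots> \<le> belief_step \<mu> ?\<delta> (\<lambda>_. ennreal C) p"
      using p by (rule belief_step_mono) (auto simp: w_def intro: order_trans[OF bellman_le C])
    also have "\<dots> = ennreal C" by (rule belief_step_const[OF \<delta> p])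
    also have "\<dots> < \<infinity>" by simp
    finally show "(\<integral>\<^sup>+z. ?F 0 z \<partial>?G) < \<infinity>" .
  qed
  also have "\<dots> = belief_step \<mu> ?\<delta> (bellman_limit \<mu> k H) p"
    unfolding belief_step_def
  proof (intro nn_integral_cong)
    fix z :: "'n \<Rightarrow> real"
    let ?q = "\<chi> j. bayes \<mu> ?\<delta> (p $ j) (z j)" and ?e = "\<Prod>j\<in>UNIV. ennreal (evidence \<mu> ?\<delta> (p $ j) (z j))"
    have q: "?q \<in> prior_cube" by (rule bayes_vec_in_cube[OF p])
    \<comment> \<open>Finiteness of the weight lets it be moved across the infimum.\<close>
    have e: "?e < \<top>" by (simp add: ennreal_prod_eq_top less_top[symmetric])
    have "decseq (\<lambda>i. w i ?q)" by (intro decseq_SucI w_dec q)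
    from LIMSEQ_INF[OF this] have "(\<lambda>i. ?e * w i ?q) \<longlonglongrightarrow> ?e * (INF i. w i ?q)"
      by (rule ennreal_tendsto_cmult[OF e])
    moreover have "decseq (\<lambda>i. ?e * w i ?q)" by (intro decseq_SucI mult_left_mono w_dec q) simp
    from LIMSEQ_INF[OF this] have "(\<lambda>i. ?e * w i ?q) \<longlonglongrightarrow> (INF i. ?e * w i ?q)" .
    ultimately have "(INF i. ?e * w i ?q) = ?e * (INF i. w i ?q)" by (intro LIMSEQ_unique)
    then show "(INF i. ?F i z) = bellman_limit \<mu> k H ?q * ?e" by (simp add: w_inf[OF q] mult.commute)
  qed
  finally have inf: "(INF i. belief_step \<mu> ?\<delta> (w i) p) = belief_step \<mu> ?\<delta> (bellman_limit \<mu> k H) p" .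
  have "decseq (\<lambda>i. belief_step \<mu> ?\<delta> (w i) p)"
    by (intro decseq_SucI belief_step_mono p w_dec)
  from tendsto_add[OF LIMSEQ_INF[OF this] tendsto_const[of "ennreal (k * ?\<delta>)"]] show ?thesis
    unfolding inf using bound by (intro LIMSEQ_le_const) auto
qed

end

section \<open>The free boundary\<close>

lemma concave_on_unitD:
  fixes f :: "real \<Rightarrow> real"
  assumes "concave_on {0..1} f" "x \<in> {0..1}" "y \<in> {0..1}" "t \<in> {0..1}"
  shows "(1 - t) * f x + t * f y \<le> f ((1 - t) * x + t * y)"
  using concave_onD[OF assms(1), of t x y] assms(2-4) by simp

lemma concave_on_unit_cong:
  fixes f g :: "real \<Rightarrow> real"
  assumes "concave_on {0..1} f" and eq: "\<And>x. x \<in> {0..1} \<Longrightarrow> g x = f x"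
  shows "concave_on {0..1} g"
  unfolding concave_on_iff
proof (intro conjI ballI allI impI)
  fix x y s t :: real
  assume *: "x \<in> {0..1}" "y \<in> {0..1}" "0 \<le> s" "0 \<le> t" "s + t = 1"
  then have s: "s = 1 - t" and t: "t \<in> {0..1}" by auto
  have "s *\<^sub>R x + t *\<^sub>R y \<in> {0..1}"
    using * by (intro convexD[OF convex_real_interval(5)]) auto
  from eq[OF this] concave_on_unitD[OF assms(1) *(1,2) t]
  show "s * g x + t * g y \<le> g (s *\<^sub>R x + t *\<^sub>R y)"
    unfolding eq[OF *(1)] eq[OF *(2)] by (simp add: s)
qed simp

text \<open>The chord from \<open>y\<close> to the endpoint on the side of \<open>x\<close>, where
  \<open>f\<close> is nonnegative, limits how far \<open>f\<close> can drop. With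
  \<open>K = 1\<close> this makes \<open>u\<close> 1-Lipschitz; with \<open>K = C / \<eta>\<close>
  it makes bounded concave functions Lipschitz away from the endpoints.\<close>

lemma concave_on_unit_increment:
  fixes f :: "real \<Rightarrow> real"
  assumes f: "concave_on {0..1} f" and nonneg: "\<And>x. x \<in> {0..1} \<Longrightarrow> 0 \<le> f x"
    and x: "x \<in> {0..1}" and y: "y \<in> {0..1}" and "f y \<le> K * y" "f y \<le> K * (1 - y)"
  shows "f y - f x \<le> K * \<bar>x - y\<bar>"
proof (cases x y rule: linorder_cases)
  case less
  define s where "s = (y - x) / y"
  have y0: "y > 0" using x less by simp
  have s: "0 \<le> s" "0 \<le> 1 - s" using x less y0 by (simp_all add: s_def divide_le_eq_1)
  have "(1 - s) * y + s * 0 = x" using y0 by (simp add: s_def field_simps)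
  then have "(1 - s) * f y + s * f 0 \<le> f x"
    using concave_on_unitD[OF f y, of 0 s] s by simp
  moreover have "0 \<le> s * f 0" using nonneg[of 0] s by simp
  ultimately have "f y - f x \<le> s * f y" by (simp add: algebra_simps)
  also have "\<dots> \<le> s * (K * y)" using assms(5) s by (intro mult_left_mono)
  also have "\<dots> = K * \<bar>x - y\<bar>" using y0 less by (simp add: s_def)
  finally show ?thesis .
next
  case greater
  define s where "s = (x - y) / (1 - y)"
  have y1: "1 - y > 0" using x greater by simp
  have s: "0 \<le> s" "0 \<le> 1 - s" using x greater y1 by (simp_all add: s_def divide_le_eq_1)
  have "(1 - s) * y + s * 1 = y + s * (1 - y)" by (simp add: algebra_simps)
  also have "\<dots> = x" using y1 by (simp add: s_def)
  finally have "(1 - s) * f y + s * f 1 \<le> f x"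
    using concave_on_unitD[OF f y, of 1 s] s by simp
  moreover have "0 \<le> s * f 1" using nonneg[of 1] s by simp
  ultimately have "f y - f x \<le> s * f y" by (simp add: algebra_simps)
  also have "\<dots> \<le> s * (K * (1 - y))" using assms(6) s by (intro mult_left_mono)
  also have "\<dots> = K * \<bar>x - y\<bar>" using y1 greater by (simp add: s_def)
  finally show ?thesis .
qed simp

lemma concave_on_interior_lipschitz:
  fixes f :: "real \<Rightarrow> real"
  assumes f: "concave_on {0..1} f" and bounds: "\<And>x. x \<in> {0..1} \<Longrightarrow> 0 \<le> f x" "\<And>x. x \<in> {0..1} \<Longrightarrow> f x \<le> C"
    and "\<eta> > 0" "x \<in> {\<eta>..1 - \<eta>}" "y \<in> {\<eta>..1 - \<eta>}"
  shows "\<bar>f x - f y\<bar> \<le> C / \<eta> * \<bar>x - y\<bar>"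
proof -
  have C: "C \<ge> 0" using bounds[of 0] by simp
  have *: "f z \<le> C / \<eta> * z" "f z \<le> C / \<eta> * (1 - z)" "z \<in> {0..1}" if z: "z \<in> {\<eta>..1 - \<eta>}" for z
  proof -
    show "z \<in> {0..1}" using z \<open>\<eta> > 0\<close> by auto
    have "C = C / \<eta> * \<eta>" using \<open>\<eta> > 0\<close> by simp
    moreover have "C / \<eta> * \<eta> \<le> C / \<eta> * z" "C / \<eta> * \<eta> \<le> C / \<eta> * (1 - z)"
      using z divide_nonneg_pos[OF C \<open>\<eta> > 0\<close>] by (auto simp only: atLeastAtMost_iff intro!: mult_left_mono)
    ultimately show "f z \<le> C / \<eta> * z" "f z \<le> C / \<eta> * (1 - z)" using bounds(2)[OF \<open>z \<in> {0..1}\<close>] by linarith+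
  qed
  have "f y - f x \<le> C / \<eta> * \<bar>x - y\<bar>" "f x - f y \<le> C / \<eta> * \<bar>y - x\<bar>"
    by (rule concave_on_unit_increment[OF f bounds(1) *(3)[OF assms(5)] *(3)[OF assms(6)] *(1,2)[OF assms(6)]],
        simp, rule concave_on_unit_increment[OF f bounds(1) *(3)[OF assms(6)] *(3)[OF assms(5)] *(1,2)[OF assms(5)]])
       simp
  then show ?thesis by (simp add: abs_le_iff abs_minus_commute)
qed

text \<open>The purely analytic part, with \<open>v p q\<close> in the role of \<open>V\<close> at
  the point \<open>(p, q)\<close>. It rests on two properties of the contact set: its section over
  each \<open>p\<close> is an interval starting at 0, and it is closed at positive heights.\<close>

lemma free_boundary:
  fixes u :: "real \<Rightarrow> real" and v :: "real \<Rightarrow> real \<Rightarrow> real"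
  assumes u_cont: "continuous_on {0..1} u" and u_sym: "\<And>p. p \<in> {0..1} \<Longrightarrow> u (1 - p) = u p"
    and conc1: "\<And>q. q \<in> {0..1} \<Longrightarrow> concave_on {0..1} (\<lambda>p. v p q)"
    and conc2: "\<And>p. p \<in> {0..1} \<Longrightarrow> concave_on {0..1} (v p)"
    and bounds: "\<And>p q. p \<in> {0..1} \<Longrightarrow> q \<in> {0..1} \<Longrightarrow> 0 \<le> v p q" "\<And>p q. p \<in> {0..1} \<Longrightarrow> q \<in> {0..1} \<Longrightarrow> v p q \<le> C"
    and v_le: "\<And>p q. p \<in> {0..1} \<Longrightarrow> 0 \<le> q \<Longrightarrow> q \<le> min p (1 - p) \<Longrightarrow> v p q \<le> u p + q"
    and v_0: "\<And>p. p \<in> {0..1} \<Longrightarrow> v p 0 = u p"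
    and v_sym: "\<And>p q. p \<in> {0..1} \<Longrightarrow> q \<in> {0..1} \<Longrightarrow> v (1 - p) q = v p q"
  shows "\<exists>b. b \<in> {0..1} \<rightarrow> {0..1/2} \<and> upper_semicontinuous_on {0..1} b \<and>
    (\<forall>p\<in>{0..1}. b p \<le> min p (1 - p)) \<and>
    (\<forall>p\<in>{0..1}. \<forall>q. 0 \<le> q \<and> q \<le> min p (1 - p) \<longrightarrow> (v p q = u p + q \<longleftrightarrow> q \<le> b p)) \<and>
    (\<forall>p\<in>{0..1}. b p = b (1 - p))"
proof -
  define D where "D p = {q. 0 \<le> q \<and> q \<le> min p (1 - p) \<and> v p q = u p + q}" for p
  define b where "b p = Sup (D p)" for p
  have D_0: "0 \<in> D p" if "p \<in> {0..1}" for p using that v_0 by (auto simp: D_def)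
  have D_bdd: "bdd_above (D p)" for p by (rule bdd_aboveI[of _ "min p (1 - p)"]) (simp add: D_def)
  \<comment> \<open>The upper bound is affine in the height and is attained at 0 and at
    \<open>q\<close>, so concavity forces equality in between.\<close>
  have D_down: "q' \<in> D p" if p: "p \<in> {0..1}" and q: "q \<in> D p" "0 \<le> q'" "q' \<le> q" for p q q'
  proof (cases "q = 0")
    case False
    define t where "t = q' / q"
    have q0: "q > 0" "q \<in> {0..1}" using q False p by (auto simp: D_def)
    have t: "0 \<le> t" "0 \<le> 1 - t" using q q0 by (simp_all add: t_def)
    have "(1 - t) * 0 + t * q = q'" using q0 by (simp add: t_def)
    then have "(1 - t) * v p 0 + t * v p q \<le> v p q'"
      using concave_on_unitD[OF conc2[OF p], of 0 q t] t q0 by simp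
    moreover have "(1 - t) * v p 0 + t * v p q = u p + q'"
      using v_0[OF p] q q0 by (simp add: D_def t_def algebra_simps)
    moreover have "v p q' \<le> u p + q'" using p q by (intro v_le) (auto simp: D_def)
    ultimately show ?thesis using q by (auto simp: D_def)
  qed (use q in auto)
  \<comment> \<open>As \<open>q > 0\<close> and heights stay below the tent, the limit lies in the
    open square, where separate concavity gives a Lipschitz bound in each variable. Height 0 is
    covered by \<open>D_0\<close>.\<close>
  have D_closed: "q \<in> D p"
    if lim: "x \<longlonglongrightarrow> p" "y \<longlonglongrightarrow> q" and x: "\<And>n. x n \<in> {0..1}" and y: "\<And>n. y n \<in> D (x n)" and q: "q > 0"
    for x y :: "nat \<Rightarrow> real" and p q
  proof -
    have y_min: "y n \<le> min (x n) (1 - x n)" and v_xy: "v (x n) (y n) = u (x n) + y n" for n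
      using y[of n] by (auto simp: D_def)
    have "q \<le> min p (1 - p)"
      by (rule LIMSEQ_le[OF lim(2) tendsto_min[OF lim(1) tendsto_diff[OF tendsto_const lim(1)]]])
         (use y_min in auto)
    then have q_min: "q \<le> p" "q \<le> 1 - p" by auto
    have p: "p \<in> {0..1}" using q_min q by auto
    \<comment> \<open>The limit has distance at least \<open>q\<close> from every edge, so half of
      it still leaves room for the tail of the sequence.\<close>
    define \<eta> where "\<eta> = q / 2"
    have \<eta>: "\<eta> > 0" "\<eta> < p" "p < 1 - \<eta>" "\<eta> < q" "q < 1 - \<eta>" using q q_min by (auto simp: \<eta>_def)
    have ev: "eventually (\<lambda>n. \<eta> < x n \<and> x n < 1 - \<eta> \<and> \<eta> < y n \<and> y n < 1 - \<eta>) sequentially"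
      using order_tendstoD[OF lim(1)] order_tendstoD[OF lim(2)] \<eta> by (intro eventually_conj) auto
    have "(\<lambda>n. C / \<eta> * \<bar>x n - p\<bar> + C / \<eta> * \<bar>y n - q\<bar>) \<longlonglongrightarrow> C / \<eta> * \<bar>p - p\<bar> + C / \<eta> * \<bar>q - q\<bar>"
      by (intro tendsto_intros lim)
    then have zero: "(\<lambda>n. C / \<eta> * \<bar>x n - p\<bar> + C / \<eta> * \<bar>y n - q\<bar>) \<longlonglongrightarrow> 0" by simp
    have "(\<lambda>n. v (x n) (y n) - v p q) \<longlonglongrightarrow> 0"
      using _ zero
    proof (rule Lim_null_comparison)
      show "eventually (\<lambda>n. norm (v (x n) (y n) - v p q) \<le> C / \<eta> * \<bar>x n - p\<bar> + C / \<eta> * \<bar>y n - q\<bar>) sequentially"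
        using ev
      proof eventually_elim
        case (elim n)
        then have in01: "y n \<in> {0..1}" using \<eta>(1) by auto
        have "\<bar>v (x n) (y n) - v p (y n)\<bar> \<le> C / \<eta> * \<bar>x n - p\<bar>"
          using elim \<eta> in01 by (intro concave_on_interior_lipschitz[OF conc1[OF in01]] bounds) auto
        moreover have "\<bar>v p (y n) - v p q\<bar> \<le> C / \<eta> * \<bar>y n - q\<bar>"
          using elim \<eta> p by (intro concave_on_interior_lipschitz[OF conc2[OF p]] bounds) auto
        ultimately show ?case by simp
      qed
    qed
    from tendsto_add[OF this tendsto_const[of "v p q"]] have "(\<lambda>n. v (x n) (y n)) \<longlonglongrightarrow> v p q" by simp
    moreover have "(\<lambda>n. v (x n) (y n)) \<longlonglongrightarrow> u p + q"
      unfolding v_xy using x p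
      by (intro tendsto_add lim(2) continuous_on_tendsto_compose[OF u_cont lim(1)]) auto
    ultimately have "v p q = u p + q" by (rule LIMSEQ_unique)
    then show ?thesis using q q_min by (simp add: D_def)
  qed
  have b_nonneg: "0 \<le> b p" if "p \<in> {0..1}" for p
    unfolding b_def using D_0[OF that] D_bdd by (rule cSup_upper)
  have b_le: "b p \<le> min p (1 - p)" if "p \<in> {0..1}" for p
    unfolding b_def
  proof (rule cSup_least)
    show "D p \<noteq> {}" using D_0[OF that] by blast
  qed (simp add: D_def)
  have b_in: "b p \<in> D p" if p: "p \<in> {0..1}" for p
  proof (cases "b p = 0")
    case False
    then have b: "b p > 0" using b_nonneg[OF p] by simp
    \<comment> \<open>Heights strictly below the supremum belong to \<open>D p\<close> by downward
      closure; closedness then shows that the supremum is attained.\<close>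
    define y where "y n = b p * (1 - inverse (real (Suc n)))" for n
    have "(\<lambda>n. b p * (1 - inverse (real (Suc n)))) \<longlonglongrightarrow> b p * (1 - 0)"
      by (intro tendsto_intros LIMSEQ_inverse_real_of_nat)
    then have "y \<longlonglongrightarrow> b p" by (simp add: y_def[abs_def])
    moreover have "y n \<in> D p" for n
    proof -
      have "b p * (1 - inverse (real (Suc n))) < b p * 1"
        using b by (intro mult_strict_left_mono) simp_all
      then have "y n < b p" by (simp add: y_def)
      then obtain q where q: "q \<in> D p" "y n < q"
        unfolding b_def using D_0[OF p] less_cSupD[of "D p" "y n"] by blast
      moreover have "inverse (real (Suc n)) \<le> 1" by (simp add: field_simps)
      then have "0 \<le> y n" using b by (simp add: y_def)
      ultimately show ?thesis using D_down[OF p q(1), of "y n"] by simp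
    qed
    ultimately show ?thesis using D_closed[of "\<lambda>_. p" p y "b p"] p b by simp
  qed (use D_0[OF p] in simp)
  have D_iff: "q \<in> D p \<longleftrightarrow> q \<le> b p" if "p \<in> {0..1}" "0 \<le> q" for p q
  proof
    show "q \<le> b p" if "q \<in> D p" unfolding b_def using that D_bdd by (rule cSup_upper)
    show "q \<in> D p" if "q \<le> b p" using D_down[OF \<open>p \<in> {0..1}\<close> b_in[OF \<open>p \<in> {0..1}\<close>] \<open>0 \<le> q\<close>] that .
  qed
  have "upper_semicontinuous_on {0..1} b"
    unfolding upper_semicontinuous_on_def
  proof (intro ballI allI impI)
    fix p y assume p: "p \<in> {0..1}" and y: "b p < y"
    have y0: "y > 0" using b_nonneg[OF p] y by simp
    \<comment> \<open>Otherwise some sequence tending to \<open>p\<close> has a subsequence along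
      which \<open>b\<close> is at least \<open>y\<close>. The constant height \<open>y\<close> then
      lies in all those sections, and closedness puts it into \<open>D p\<close>, against
      \<open>b p < y\<close>.\<close>
    show "\<forall>\<^sub>F z in at p within {0..1}. b z < y"
    proof (rule sequentially_imp_eventually_within, intro allI impI, rule ccontr)
      fix f assume f: "(\<forall>n. f n \<in> {0..1} \<and> f n \<noteq> p) \<and> f \<longlonglongrightarrow> p"
        and "\<not> (\<forall>\<^sub>F n in sequentially. b (f n) < y)"
      then obtain r :: "nat \<Rightarrow> nat" where r: "strict_mono r" "\<And>n. \<not> b (f (r n)) < y"
        using not_eventually_sequentiallyD by blast
      have "(f \<circ> r) \<longlonglongrightarrow> p" using f r(1) by (intro LIMSEQ_subseq_LIMSEQ) auto
      moreover have "y \<in> D ((f \<circ> r) n)" for n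
      proof -
        have "f (r n) \<in> {0..1}" using f by blast
        then show ?thesis using r(2)[of n] y0 D_iff[of "f (r n)" y] by simp
      qed
      ultimately have "y \<in> D p" using D_closed[of "f \<circ> r" p "\<lambda>_. y" y] f y0 by simp
      then show False using D_iff[OF p, of y] y0 y by simp
    qed
  qed
  moreover have "D (1 - p) = D p" if "p \<in> {0..1}" for p
  proof -
    have eq: "min (1 - p) (1 - (1 - p)) = min p (1 - p)" by (simp add: min.commute)
    have "v (1 - p) q = u (1 - p) + q \<longleftrightarrow> v p q = u p + q" if "0 \<le> q" "q \<le> min p (1 - p)" for q
      using v_sym[OF \<open>p \<in> {0..1}\<close>, of q] u_sym[OF \<open>p \<in> {0..1}\<close>] that \<open>p \<in> {0..1}\<close> by simp
    then show ?thesis unfolding D_def eq by blast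
  qed
  then have "b p = b (1 - p)" if "p \<in> {0..1}" for p using that by (simp add: b_def)
  moreover have "b \<in> {0..1} \<rightarrow> {0..1/2}"
  proof (rule Pi_I)
    fix p :: real assume p: "p \<in> {0..1}"
    have "b p \<le> p" "b p \<le> 1 - p" using b_le[OF p] by simp_all
    then show "b p \<in> {0..1/2}" using b_nonneg[OF p] by simp
  qed
  moreover have "v p q = u p + q \<longleftrightarrow> q \<le> b p" if "p \<in> {0..1}" "0 \<le> q" "q \<le> min p (1 - p)" for p q
    unfolding D_iff[OF that(1,2), symmetric] using that(2,3) by (simp add: D_def)
  ultimately show ?thesis using b_le by (intro exI[of _ b] conjI ballI allI impI) blast+
qed

lemma measurable_bellman_limit [measurable]:
  assumes [measurable]: "H \<in> borel_measurable borel"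
  shows "bellman_limit \<mu> k H \<in> borel_measurable borel"
proof -
  have [measurable]: "bellman \<mu> k (1 / 2 ^ n) H m \<in> borel_measurable borel" for n m
    by (rule measurable_bellman) auto
  show ?thesis unfolding bellman_limit_def[abs_def] by measurable
qed

section \<open>The two-dimensional recursion on the edge of the square\<close>

lemma nn_integral_PiM_gauss_component:
  fixes i :: "'n::finite"
  assumes "\<delta> > 0" and [measurable]: "f \<in> borel_measurable borel"
  shows "(\<integral>\<^sup>+z. f (z i) \<partial>PiM UNIV (\<lambda>_. gauss \<delta>)) = (\<integral>\<^sup>+y. f y \<partial>gauss \<delta>)"
proof -
  have "(\<integral>\<^sup>+y. f y \<partial>gauss \<delta>) = (\<integral>\<^sup>+y. f y \<partial>distr (PiM UNIV (\<lambda>_::'n. gauss \<delta>)) (gauss \<delta>) (\<lambda>z. z i))"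
    by (subst distr_PiM_component) (auto intro: prob_space_gauss assms)
  also have "\<dots> = (\<integral>\<^sup>+z. f (z i) \<partial>PiM UNIV (\<lambda>_. gauss \<delta>))"
    by (rule nn_integral_distr) (auto simp: measurable_component_singleton)
  finally show ?thesis by simp
qed

lemma belief_step_vec:
  fixes f :: "real^1 \<Rightarrow> ennreal"
  assumes "\<delta> > 0" and [measurable]: "f \<in> borel_measurable borel"
  shows "belief_step \<mu> \<delta> f (vec p) = bayes_step \<mu> \<delta> (\<lambda>x. f (vec x)) p"
proof -
  have [measurable]: "(\<lambda>x::real. vec x :: real^1) \<in> borel_measurable borel"
    by (rule borel_measurable_vecI) simp
  have "belief_step \<mu> \<delta> f (vec p) =
      (\<integral>\<^sup>+z. f (vec (bayes \<mu> \<delta> p (z 1))) * ennreal (evidence \<mu> \<delta> p (z 1)) \<partial>PiM (UNIV :: 1 set) (\<lambda>_. gauss \<delta>))"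
    unfolding belief_step_def
    by (intro nn_integral_cong arg_cong2[where f="(*)"] arg_cong[where f=f]) (auto simp: vec_eq_iff UNIV_1)
  also have "\<dots> = bayes_step \<mu> \<delta> (\<lambda>x. f (vec x)) p"
    unfolding bayes_step_def
    using nn_integral_PiM_gauss_component[OF assms(1), of "\<lambda>y. f (vec (bayes \<mu> \<delta> p y)) * ennreal (evidence \<mu> \<delta> p y)" "1::1"]
    by simp
  finally show ?thesis .
qed

text \<open>A prior of 0 is never revised and has evidence 1, so on the edge the two-dimensional
  kernel acts as the one-dimensional one. With \<open>belief_step_vec\<close> this is the bridge
  between the two models.\<close>

lemma belief_step_vector_0:
  fixes f :: "real^2 \<Rightarrow> ennreal"
  assumes "\<delta> > 0" and [measurable]: "f \<in> borel_measurable borel"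
  shows "belief_step \<mu> \<delta> f (vector [p, 0]) = bayes_step \<mu> \<delta> (\<lambda>x. f (vector [x, 0])) p"
proof -
  have [measurable]: "(\<lambda>x::real. vector [x, 0] :: real^2) \<in> borel_measurable borel"
  proof (rule borel_measurable_vecI)
    show "(\<lambda>x. (vector [x, 0] :: real^2) $ i) \<in> borel_measurable borel" for i
      using exhaust_2[of i] by auto
  qed
  have "belief_step \<mu> \<delta> f (vector [p, 0]) =
      (\<integral>\<^sup>+z. f (vector [bayes \<mu> \<delta> p (z 1), 0]) * ennreal (evidence \<mu> \<delta> p (z 1)) \<partial>PiM (UNIV :: 2 set) (\<lambda>_. gauss \<delta>))"
    unfolding belief_step_def
    by (intro nn_integral_cong arg_cong2[where f="(*)"] arg_cong[where f=f]) (auto simp: vec_eq_iff forall_2 UNIV_2)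
  also have "\<dots> = bayes_step \<mu> \<delta> (\<lambda>x. f (vector [x, 0])) p"
    unfolding bayes_step_def
    using nn_integral_PiM_gauss_component[OF assms(1), of "\<lambda>y. f (vector [bayes \<mu> \<delta> p y, 0]) * ennreal (evidence \<mu> \<delta> p y)" "1::2"]
    by simp
  finally show ?thesis .
qed

lemma bayes_step_mono:
  "p \<in> {0..1} \<Longrightarrow> (\<And>x. x \<in> {0..1} \<Longrightarrow> f x \<le> g x) \<Longrightarrow> bayes_step \<mu> \<delta> f p \<le> bayes_step \<mu> \<delta> g p"
  unfolding bayes_step_def using bayes_in_unit by (intro nn_integral_mono mult_right_mono) auto

text \<open>Comparison by induction on the horizon: the one-step inequality for \<open>U\<close>
  with the smaller running cost \<open>k\<close> implies the one with \<open>c\<close>, so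
  \<open>U\<close> stays below every recursion that starts from a larger payoff.\<close>

lemma subsolution_le_bellman_limit_edge:
  fixes U :: "real^1 \<Rightarrow> ennreal" and G :: "real^2 \<Rightarrow> ennreal"
  assumes [measurable]: "U \<in> borel_measurable borel" "G \<in> borel_measurable borel" and "k \<le> c"
    and U: "\<And>p n. p \<in> {0..1} \<Longrightarrow> U (vec p) \<le> belief_step \<mu> (1 / 2 ^ n) U (vec p) + ennreal (k * (1 / 2 ^ n))"
    and G: "\<And>p. p \<in> {0..1} \<Longrightarrow> U (vec p) \<le> G (vector [p, 0])"
    and p: "p \<in> {0..1}"
  shows "U (vec p) \<le> bellman_limit \<mu> c G (vector [p, 0])"
  unfolding bellman_limit_def
proof (intro INF_greatest)
  fix n m
  let ?\<delta> = "1 / 2 ^ n :: real"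
  have \<delta>: "?\<delta> > 0" by simp
  show "U (vec p) \<le> bellman \<mu> c ?\<delta> G m (vector [p, 0])"
    using p
  proof (induction m arbitrary: p)
    case (Suc m)
    have "U (vec p) \<le> bayes_step \<mu> ?\<delta> (\<lambda>x. U (vec x)) p + ennreal (k * ?\<delta>)"
      using U[OF Suc.prems, of n] by (simp add: belief_step_vec[OF \<delta>])
    also have "\<dots> \<le> bayes_step \<mu> ?\<delta> (\<lambda>x. bellman \<mu> c ?\<delta> G m (vector [x, 0])) p + ennreal (c * ?\<delta>)"
      using \<open>k \<le> c\<close> by (intro add_mono bayes_step_mono Suc ennreal_leI mult_right_mono) auto
    also have "\<dots> = belief_step \<mu> ?\<delta> (bellman \<mu> c ?\<delta> G m) (vector [p, 0]) + ennreal (c * ?\<delta>)"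
      using measurable_bellman[OF \<delta> assms(2)] by (simp add: belief_step_vector_0[OF \<delta>])
    finally show ?case using G[OF Suc.prems] by simp
  qed (simp add: G)
qed

lemma coordinate_concave_on_cube:
  fixes h :: "real^'n::finite \<Rightarrow> real"
  assumes "\<And>p. p \<in> prior_cube \<Longrightarrow> 0 \<le> h p"
    and "\<And>p q t. p \<in> prior_cube \<Longrightarrow> q \<in> prior_cube \<Longrightarrow> t \<in> {0..1} \<Longrightarrow> (\<And>j. j \<noteq> i \<Longrightarrow> p $ j = q $ j) \<Longrightarrow>
      (1 - t) * h p + t * h q \<le> h ((1 - t) *\<^sub>R p + t *\<^sub>R q)"
  shows "coordinate_concave i (on_cube h)"
  unfolding coordinate_concave_def
proof (intro ballI impI)
  fix p q :: "real^'n" and t :: real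
  assume *: "p \<in> prior_cube" "q \<in> prior_cube" "t \<in> {0..1}" "\<forall>j. j \<noteq> i \<longrightarrow> p $ j = q $ j"
  have "(1 - t) *\<^sub>R p + t *\<^sub>R q \<in> prior_cube"
    using *(1-3) by (auto simp: prior_cube_def intro!: convex_bound_le add_nonneg_nonneg)
  moreover have "ennreal (1 - t) * ennreal (h p) + ennreal t * ennreal (h q) = ennreal ((1 - t) * h p + t * h q)"
    using * assms(1) by (simp add: ennreal_mult'[symmetric] ennreal_plus[symmetric] del: ennreal_plus)
  ultimately show "ennreal (1 - t) * on_cube h p + ennreal t * on_cube h q \<le> on_cube h ((1 - t) *\<^sub>R p + t *\<^sub>R q)"
    using * assms(2)[of p q t] by (simp add: on_cube_eq ennreal_leI)
qed

text \<open>The map \<open>l\<close> parametrizes a segment of the cube parallel to axis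
  \<open>i\<close>; finiteness permits the passage from \<open>ennreal\<close> to real
  concavity.\<close>

lemma coordinate_concave_enn2real:
  fixes F :: "real^'n::finite \<Rightarrow> ennreal"
  assumes F: "coordinate_concave i F" and fin: "\<And>p. p \<in> prior_cube \<Longrightarrow> F p < \<top>"
    and line: "\<And>x. x \<in> {0..1} \<Longrightarrow> l x \<in> prior_cube" "\<And>x y j. j \<noteq> i \<Longrightarrow> l x $ j = l y $ j"
      "\<And>x y t. l ((1 - t) * x + t * y) = (1 - t) *\<^sub>R l x + t *\<^sub>R l y"
  shows "concave_on {0..1} (\<lambda>x. enn2real (F (l x)))"
  unfolding concave_on_iff
proof (intro conjI ballI allI impI)
  fix x y s t :: real assume *: "x \<in> {0..1}" "y \<in> {0..1}" "0 \<le> s" "0 \<le> t" "s + t = 1"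
  then have s: "s = 1 - t" and t: "t \<in> {0..1}" by auto
  obtain a b c where abc: "F (l x) = ennreal a" "0 \<le> a" "F (l y) = ennreal b" "0 \<le> b"
    "F (l (s *\<^sub>R x + t *\<^sub>R y)) = ennreal c" "0 \<le> c"
  proof -
    have "s *\<^sub>R x + t *\<^sub>R y \<in> {0..1}"
      using * by (intro convexD[OF convex_real_interval(5)]) auto
    then have "F (l x) < \<top>" "F (l y) < \<top>" "F (l (s *\<^sub>R x + t *\<^sub>R y)) < \<top>"
      using * by (auto intro!: fin line(1))
    then show ?thesis using that by (metis ennreal_cases less_irrefl)
  qed
  have "ennreal s * F (l x) + ennreal t * F (l y) \<le> F (l (s *\<^sub>R x + t *\<^sub>R y))"
    using * t line(1,2) coordinate_concaveD[OF F, of "l x" "l y" t] by (simp add: line(3) s)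
  then have "ennreal (s * a + t * b) \<le> ennreal c"
    using * abc by (simp add: ennreal_mult'[symmetric] ennreal_plus[symmetric] del: ennreal_plus)
  then show "s * enn2real (F (l x)) + t * enn2real (F (l y)) \<le> enn2real (F (l (s *\<^sub>R x + t *\<^sub>R y)))"
    using abc by simp
qed simp

lemma vector_eq_2: "(x :: real^2) = vector [x $ 1, x $ 2]"
  by (simp add: vec_eq_iff forall_2)

lemma vector_in_prior_cube: "vector [p, q] \<in> (prior_cube :: (real^2) set) \<longleftrightarrow> p \<in> {0..1} \<and> q \<in> {0..1}"
  by (auto simp: prior_cube_def forall_2)

lemma vec_in_prior_cube: "vec p \<in> (prior_cube :: (real^1) set) \<longleftrightarrow> p \<in> {0..1}"
  by (auto simp: prior_cube_def)

lemma concave_on_tent: "concave_on {0..1} (\<lambda>p::real. min p (1 - p))"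
  unfolding concave_on_iff
proof (intro conjI ballI allI impI)
  fix x y s t :: real assume *: "0 \<le> s" "0 \<le> t" "s + t = 1"
  have "s * min x (1 - x) + t * min y (1 - y) \<le> s * x + t * y"
    using * by (intro add_mono mult_left_mono) auto
  moreover have "s * min x (1 - x) + t * min y (1 - y) \<le> s * (1 - x) + t * (1 - y)"
    using * by (intro add_mono mult_left_mono) auto
  moreover have "s * (1 - x) + t * (1 - y) = 1 - (s * x + t * y)"
    using *(3) by (simp add: algebra_simps)
  ultimately show "s * min x (1 - x) + t * min y (1 - y) \<le> min (s *\<^sub>R x + t *\<^sub>R y) (1 - (s *\<^sub>R x + t *\<^sub>R y))"
    by simp
qed simp

theorem proposition4p5:
  fixes \<mu> c \<gamma> :: real
    and S1 :: "'a measure" and P1 :: "real^1 \<Rightarrow> 'a measure"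
    and Y1 :: "1 \<Rightarrow> 'a \<Rightarrow> real" and W1 :: "1 \<Rightarrow> real \<Rightarrow> 'a \<Rightarrow> real"
    and post1 :: "real^1 \<Rightarrow> real \<Rightarrow> 'a \<Rightarrow> real^1"
    and S2 :: "'b measure" and P2 :: "real^2 \<Rightarrow> 'b measure"
    and Y2 :: "2 \<Rightarrow> 'b \<Rightarrow> real" and W2 :: "2 \<Rightarrow> real \<Rightarrow> 'b \<Rightarrow> real"
    and post2 :: "real^2 \<Rightarrow> real \<Rightarrow> 'b \<Rightarrow> real^2"
    and u :: "real \<Rightarrow> real" and g V :: "real^2 \<Rightarrow> real" and D T :: "(real^2) set"
  assumes "\<mu> > 0" and "c > 0" and "0 < \<gamma>" and "\<gamma> < 1"
    and model1: "sequential_testing S1 \<mu> P1 Y1 W1 post1"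
    and model2: "sequential_testing S2 \<mu> P2 Y2 W2 post2"
    and u: "u = (\<lambda>p. sequential_testing.testing_value S1 \<mu> P1 Y1 W1 post1 (c * (1 - \<gamma>))
                   (\<lambda>q. min (q $ 1) (1 - q $ 1)) (vec p))"
    and g: "g = (\<lambda>\<pi>. min (min (\<pi> $ 1) (1 - \<pi> $ 1) + u (\<pi> $ 2))
                          (u (\<pi> $ 1) + min (\<pi> $ 2) (1 - \<pi> $ 2)))"
    and V: "V = sequential_testing.testing_value S2 \<mu> P2 Y2 W2 post2 c g"
    and D: "D = {\<pi> \<in> prior_cube. V \<pi> = g \<pi>}"
    and T: "T = {\<pi> \<in> prior_cube. 0 \<le> \<pi> $ 2 \<and> \<pi> $ 2 \<le> min (\<pi> $ 1) (1 - \<pi> $ 1)}"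
  shows "\<exists>b :: real \<Rightarrow> real.
           b \<in> {0..1} \<rightarrow> {0..1/2} \<and>
           upper_semicontinuous_on {0..1} b \<and>
           (\<forall>p\<in>{0..1}. b p \<le> min p (1 - p)) \<and>
           D \<inter> T = {\<pi> \<in> T. \<pi> $ 2 \<le> b (\<pi> $ 1)} \<and>
           (\<forall>p\<in>{0..1}. b p = b (1 - p))"
proof -
  interpret M1: sequential_testing S1 \<mu> P1 Y1 W1 post1 by (rule model1)
  interpret M2: sequential_testing S2 \<mu> P2 Y2 W2 post2 by (rule model2)
  define k where "k = c * (1 - \<gamma>)"
  \<comment> \<open>The assumptions on \<gamma> enter here: \<open>k > 0\<close> makes the
    one-dimensional value a Bellman limit, and \<open>k \<le> c\<close> serves the comparison on the
    edge.\<close>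
  have k: "k > 0" "k \<le> c" using \<open>c > 0\<close> \<open>0 < \<gamma>\<close> \<open>\<gamma> < 1\<close> by (simp_all add: k_def mult_le_cancel_left1)
  define h where "h = (\<lambda>q :: real^1. min (q $ 1) (1 - q $ 1))"
  have h_cont: "continuous_on prior_cube h"
    unfolding h_def by (intro continuous_intros)
  have h_bounds: "0 \<le> h q" "h q \<le> 1" if "q \<in> prior_cube" for q
    using prior_cubeD[OF that, of 1] by (auto simp: h_def)
  have H_meas [measurable]: "on_cube h \<in> borel_measurable borel" by (rule measurable_on_cube[OF h_cont])
  define U where "U = bellman_limit \<mu> k (on_cube h)"
  have U_le: "U q \<le> ennreal (h q)" if "q \<in> prior_cube" for q
    using bellman_limit_le[of \<mu> k "on_cube h" q] that by (simp add: U_def on_cube_eq)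
  have U_fin: "U q < \<top>" if "q \<in> prior_cube" for q
    using U_le[OF that] ennreal_less_top by (rule le_less_trans)
  have u_eq: "u p = enn2real (U (vec p))" if "p \<in> {0..1}" for p
    unfolding u U_def k_def[symmetric] h_def[symmetric]
    using that h_bounds(2) by (intro M1.testing_value_eq_bellman_limit k h_cont) (auto simp: vec_in_prior_cube)
  have U_eq: "U (vec p) = ennreal (u p)" if "p \<in> {0..1}" for p
    using U_fin[of "vec p"] that by (simp add: u_eq vec_in_prior_cube)
  have u_nonneg: "0 \<le> u p" if "p \<in> {0..1}" for p using that by (simp add: u_eq)
  have u_le: "u p \<le> min p (1 - p)" if "p \<in> {0..1}" for p
    using U_le[of "vec p"] that by (simp add: U_eq vec_in_prior_cube h_def)
  note tent = concave_on_unitD[OF concave_on_tent]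
  have "coordinate_concave 1 (on_cube h)"
    by (rule coordinate_concave_on_cube[OF h_bounds(1)])
       (use tent in \<open>simp_all only: h_def vector_add_component vector_scaleR_component real_scaleR_def prior_cubeD\<close>)
  then have "coordinate_concave 1 U" unfolding U_def by (rule coordinate_concave_bellman_limit) measurable
  then have "concave_on {0..1} (\<lambda>x. enn2real (U (vec x)))"
  proof (rule coordinate_concave_enn2real[OF _ U_fin])
    show "vec ((1 - t) * x + t * y) = (1 - t) *\<^sub>R vec x + t *\<^sub>R (vec y :: real^1)" for x y t :: real
      by (simp add: vec_eq_iff)
  qed (simp_all add: vec_in_prior_cube)
  then have u_conc: "concave_on {0..1} u"
    using u_eq by (rule concave_on_unit_cong)
  have u_sym: "u (1 - p) = u p" if p: "p \<in> {0..1}" for p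
  proof -
    have "U (reflect 1 (vec p)) = U (vec p)"
      unfolding U_def
    proof (rule bellman_limit_reflect[OF H_meas])
      show "on_cube h (reflect 1 q) = on_cube h q" if "q \<in> prior_cube" for q
        using reflect_in_cube[OF that, of 1] that
        by (simp add: on_cube_eq h_def reflect_def min.commute)
    qed (use p in \<open>simp add: vec_in_prior_cube\<close>)
    moreover have "reflect 1 (vec p :: real^1) = vec (1 - p)"
      by (simp add: reflect_def vec_eq_iff)
    ultimately show ?thesis using p by (simp add: u_eq)
  qed
  \<comment> \<open>The tent that bounds \<open>u\<close> from above has slope 1, hence
    \<open>K = 1\<close>.\<close>
  have u_lip: "u y - u x \<le> \<bar>x - y\<bar>" if "x \<in> {0..1}" "y \<in> {0..1}" for x y
    using concave_on_unit_increment[OF u_conc u_nonneg that, of 1] u_le[OF that(2)] by simp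
  have u_cont: "continuous_on {0..1} u"
  proof (rule continuous_onI)
    fix x e :: real assume "x \<in> {0..1}" "e > 0"
    show "\<exists>d>0. \<forall>x'\<in>{0..1}. dist x' x < d \<longrightarrow> dist (u x') (u x) \<le> e"
    proof (intro exI[of _ e] conjI ballI impI \<open>e > 0\<close>)
      fix x' :: real assume "x' \<in> {0..1}" "dist x' x < e"
      then show "dist (u x') (u x) \<le> e"
        using u_lip[OF \<open>x \<in> {0..1}\<close>, of x'] u_lip[OF _ \<open>x \<in> {0..1}\<close>, of x']
        by (simp add: dist_real_def abs_le_iff)
    qed
  qed
  have g_cont: "continuous_on prior_cube g"
  proof -
    have "continuous_on prior_cube (\<lambda>x :: real^2. u (x $ i))" for i
      by (rule continuous_on_compose2[OF u_cont]) (auto intro!: continuous_intros dest: prior_cubeD)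
    then show ?thesis unfolding g by (intro continuous_intros)
  qed
  \<comment> \<open>A crude constant: any finite bound serves both the cutoff estimate and the
    interior Lipschitz bound.\<close>
  have g_bounds: "0 \<le> g q" "g q \<le> 2" if "q \<in> prior_cube" for q
  proof -
    have q: "q $ 1 \<in> {0..1}" "q $ 2 \<in> {0..1}" using that prior_cubeD by blast+
    show "0 \<le> g q" "g q \<le> 2" using q u_nonneg[OF q(1)] u_nonneg[OF q(2)] u_le[OF q(1)] by (auto simp: g)
  qed
  have G_meas [measurable]: "on_cube g \<in> borel_measurable borel" by (rule measurable_on_cube[OF g_cont])
  define F where "F = bellman_limit \<mu> c (on_cube g)"
  have F_le: "F q \<le> ennreal (g q)" if "q \<in> prior_cube" for q
    using bellman_limit_le[of \<mu> c "on_cube g" q] that by (simp add: F_def on_cube_eq)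
  have F_fin: "F q < \<top>" if "q \<in> prior_cube" for q
    using F_le[OF that] ennreal_less_top by (rule le_less_trans)
  have V_eq: "V q = enn2real (F q)" if "q \<in> prior_cube" for q
    unfolding V F_def using that g_bounds(2) by (intro M2.testing_value_eq_bellman_limit \<open>c > 0\<close> g_cont)
  have V_le: "V q \<le> g q" if "q \<in> prior_cube" for q
    unfolding V_eq[OF that] by (rule enn2real_leI[OF g_bounds(1)[OF that] F_le[OF that]])
  note u_conc' = concave_on_unitD[OF u_conc]
  have G_conc: "coordinate_concave i (on_cube g)" for i
  proof (rule coordinate_concave_on_cube[OF g_bounds(1)])
    fix p q :: "real^2" and t :: real
    assume *: "p \<in> prior_cube" "q \<in> prior_cube" "t \<in> {0..1}" "\<And>j. j \<noteq> i \<Longrightarrow> p $ j = q $ j"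
    have unit: "p $ j \<in> {0..1}" "q $ j \<in> {0..1}" for j using * prior_cubeD by blast+
    note t12 = tent[OF unit(1)[of 1] unit(2)[of 1] *(3)] tent[OF unit(1)[of 2] unit(2)[of 2] *(3)]
      u_conc'[OF unit(1)[of 1] unit(2)[of 1] *(3)] u_conc'[OF unit(1)[of 2] unit(2)[of 2] *(3)]
    have ge: "(1 - t) * g p \<le> (1 - t) * (min (p $ 1) (1 - p $ 1) + u (p $ 2))"
      "(1 - t) * g p \<le> (1 - t) * (u (p $ 1) + min (p $ 2) (1 - p $ 2))"
      "t * g q \<le> t * (min (q $ 1) (1 - q $ 1) + u (q $ 2))"
      "t * g q \<le> t * (u (q $ 1) + min (q $ 2) (1 - q $ 2))"
      using *(3) by (auto simp: g intro!: mult_left_mono)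
    have "(1 - t) * g p + t * g q \<le>
        min ((1 - t) * p $ 1 + t * q $ 1) (1 - ((1 - t) * p $ 1 + t * q $ 1)) + u ((1 - t) * p $ 2 + t * q $ 2)"
      using ge(1,3) t12(1,4) unfolding distrib_left by linarith
    moreover have "(1 - t) * g p + t * g q \<le>
        u ((1 - t) * p $ 1 + t * q $ 1) + min ((1 - t) * p $ 2 + t * q $ 2) (1 - ((1 - t) * p $ 2 + t * q $ 2))"
      using ge(2,4) t12(2,3) unfolding distrib_left by linarith
    ultimately show "(1 - t) * g p + t * g q \<le> g ((1 - t) *\<^sub>R p + t *\<^sub>R q)"
      unfolding g by simp
  qed
  have F_conc: "coordinate_concave i F" for i
    unfolding F_def by (rule coordinate_concave_bellman_limit[OF G_conc G_meas])
  define v where "v p q = V (vector [p, q])" for p q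
  \<comment> \<open>By symmetry \<open>u p\<close> is the value of \<open>u\<close> at the smaller
    of \<open>p\<close> and \<open>1 - p\<close>. The Lipschitz bound between that point and
    \<open>q\<close> then shows that the second term of \<open>g\<close> attains the
    minimum.\<close>
  have g_T: "g (vector [p, q]) = u p + q" if p: "p \<in> {0..1}" and q: "0 \<le> q" "q \<le> min p (1 - p)" for p q
  proof -
    let ?m = "min p (1 - p)"
    have m: "?m \<in> {0..1}" "q \<in> {0..1}" using p q by auto
    have "u p = u ?m" using u_sym[OF p] by (simp add: min_def)
    then have "u p + q \<le> ?m + u q" using u_lip[of q ?m] m q by simp
    moreover have "min q (1 - q) = q" using q by auto
    ultimately show ?thesis by (simp add: g)
  qed
  have u_0: "u 0 = 0" using u_nonneg[of 0] u_le[of 0] by simp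
  obtain b where b: "b \<in> {0..1} \<rightarrow> {0..1/2}" "upper_semicontinuous_on {0..1} b"
    "\<forall>p\<in>{0..1}. b p \<le> min p (1 - p)"
    "\<forall>p\<in>{0..1}. \<forall>q. 0 \<le> q \<and> q \<le> min p (1 - p) \<longrightarrow> (v p q = u p + q \<longleftrightarrow> q \<le> b p)"
    "\<forall>p\<in>{0..1}. b p = b (1 - p)"
  proof -
    have "\<exists>b. b \<in> {0..1} \<rightarrow> {0..1/2} \<and> upper_semicontinuous_on {0..1} b \<and>
      (\<forall>p\<in>{0..1}. b p \<le> min p (1 - p)) \<and>
      (\<forall>p\<in>{0..1}. \<forall>q. 0 \<le> q \<and> q \<le> min p (1 - p) \<longrightarrow> (v p q = u p + q \<longleftrightarrow> q \<le> b p)) \<and>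
      (\<forall>p\<in>{0..1}. b p = b (1 - p))"
    proof (rule free_boundary[OF u_cont u_sym, where C=2])
      show "concave_on {0..1} (\<lambda>p. v p q)" if q: "q \<in> {0..1}" for q
      proof -
        have "concave_on {0..1} (\<lambda>p. enn2real (F (vector [p, q])))"
        proof (rule coordinate_concave_enn2real[OF F_conc[of 1] F_fin])
          show "(vector [x, q] :: real^2) $ j = vector [y, q] $ j" if "j \<noteq> 1" for x y j
            using exhaust_2[of j] that by auto
          show "vector [(1 - t) * x + t * y, q] = (1 - t) *\<^sub>R vector [x, q] + t *\<^sub>R (vector [y, q] :: real^2)" for x y t
            by (simp add: vec_eq_iff forall_2 algebra_simps)
        qed (use q in \<open>simp_all add: vector_in_prior_cube\<close>)
        then show ?thesis
          by (rule concave_on_unit_cong) (use q in \<open>simp add: v_def V_eq vector_in_prior_cube\<close>)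
      qed
      show "concave_on {0..1} (v p)" if p: "p \<in> {0..1}" for p
      proof -
        have "concave_on {0..1} (\<lambda>q. enn2real (F (vector [p, q])))"
        proof (rule coordinate_concave_enn2real[OF F_conc[of 2] F_fin])
          show "(vector [p, x] :: real^2) $ j = vector [p, y] $ j" if "j \<noteq> 2" for x y j
            using exhaust_2[of j] that by auto
          show "vector [p, (1 - t) * x + t * y] = (1 - t) *\<^sub>R vector [p, x] + t *\<^sub>R (vector [p, y] :: real^2)" for x y t
            by (simp add: vec_eq_iff forall_2 algebra_simps)
        qed (use p in \<open>simp_all add: vector_in_prior_cube\<close>)
        then show ?thesis
          by (rule concave_on_unit_cong) (use p in \<open>simp add: v_def V_eq vector_in_prior_cube\<close>)
      qed
      show "v p q \<le> u p + q" if "p \<in> {0..1}" "0 \<le> q" "q \<le> min p (1 - p)" for p q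
      proof -
        have "vector [p, q] \<in> (prior_cube :: (real^2) set)" using that by (auto simp: vector_in_prior_cube)
        from V_le[OF this] show ?thesis by (simp only: v_def g_T[OF that])
      qed
      show "0 \<le> v p q" "v p q \<le> 2" if "p \<in> {0..1}" "q \<in> {0..1}" for p q
        using that V_eq[of "vector [p, q]"] V_le[of "vector [p, q]"] g_bounds(2)[of "vector [p, q]"]
        by (auto simp: v_def vector_in_prior_cube)
      show "v (1 - p) q = v p q" if "p \<in> {0..1}" "q \<in> {0..1}" for p q
      proof -
        have pq: "vector [p, q] \<in> (prior_cube :: (real^2) set)" using that by (simp add: vector_in_prior_cube)
        have sym: "on_cube g (reflect 1 x) = on_cube g x" if x: "x \<in> prior_cube" for x
          using reflect_in_cube[OF x, of 1] x u_sym[OF prior_cubeD[OF x, of 1]]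
          by (simp add: on_cube_eq g reflect_def min.commute)
        have "reflect 1 (vector [p, q] :: real^2) = vector [1 - p, q]"
          by (simp add: reflect_def vec_eq_iff forall_2)
        then have "F (vector [1 - p, q]) = F (vector [p, q])"
          using bellman_limit_reflect[OF G_meas sym pq, of \<mu> c] by (simp add: F_def)
        then show ?thesis using that by (simp add: v_def V_eq vector_in_prior_cube)
      qed
      show "v p 0 = u p" if p: "p \<in> {0..1}" for p
      proof (rule antisym)
        have p0: "vector [x, 0] \<in> (prior_cube :: (real^2) set)" if "x \<in> {0..1}" for x
          using that by (simp add: vector_in_prior_cube)
        have g0: "g (vector [x, 0]) = u x" if "x \<in> {0..1}" for x
          using g_T[of x 0] that by simp
        show "v p 0 \<le> u p" using V_le[OF p0[OF p]] g0[OF p] by (simp add: v_def)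
        \<comment> \<open>On the edge the payoff \<open>g\<close> is \<open>u\<close>, the value of
          a problem with the cheaper running cost \<open>k\<close>; continuing at cost
          \<open>c\<close> therefore cannot improve on it.\<close>
        have "U (vec p) \<le> F (vector [p, 0])"
          unfolding F_def
        proof (rule subsolution_le_bellman_limit_edge[OF _ G_meas k(2) _ _ p])
          show "U \<in> borel_measurable borel" unfolding U_def by measurable
          show "U (vec x) \<le> belief_step \<mu> (1 / 2 ^ n) U (vec x) + ennreal (k * (1 / 2 ^ n))" if "x \<in> {0..1}" for x n
            unfolding U_def using that k h_bounds
            by (intro M1.bellman_limit_le_belief_step[where C=1])
               (auto simp: vec_in_prior_cube on_cube_eq ennreal_leI)
          show "U (vec x) \<le> on_cube g (vector [x, 0])" if "x \<in> {0..1}" for x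
            using that by (simp add: U_eq on_cube_eq p0 g0)
        qed
        from enn2real_mono[OF this F_fin[OF p0[OF p]]] show "u p \<le> v p 0"
          unfolding v_def V_eq[OF p0[OF p]] u_eq[OF p] .
      qed
    qed
    then show ?thesis using that by blast
  qed
  have "D \<inter> T = {\<pi> \<in> T. \<pi> $ 2 \<le> b (\<pi> $ 1)}"
  proof -
    have "V x = g x \<longleftrightarrow> x $ 2 \<le> b (x $ 1)" if "x \<in> T" for x
    proof -
      have x: "x $ 1 \<in> {0..1}" "0 \<le> x $ 2" "x $ 2 \<le> min (x $ 1) (1 - x $ 1)"
        using that by (auto simp: T prior_cube_def)
      have "v (x $ 1) (x $ 2) = V x" "g x = u (x $ 1) + x $ 2"
        unfolding v_def g_T[OF x, symmetric] by (simp_all only: vector_eq_2[symmetric])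
      moreover have "v (x $ 1) (x $ 2) = u (x $ 1) + x $ 2 \<longleftrightarrow> x $ 2 \<le> b (x $ 1)"
        using b(4) x by blast
      ultimately show ?thesis by simp
    qed
    then show ?thesis by (auto simp: D T)
  qed
  then show ?thesis using b by blast
qed

end
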